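(* For all sufficiently small $\varepsilon>0$ one has $\sigma_c(\mathcal{H}_\varepsilon)=\sigma_c(\mathcal{H}_0)$ and $\sigma_r(\mathcal{H}_\varepsilon)=\emptyset$.
   Context: Let $p,q:\mathbb{R}\to\mathbb{R}$ be $1$-periodic, $p$ piecewise continuously differentiable (continuous with piecewise continuous derivative), $q$ piecewise continuous, $p(x)\geq p_0>0$ for all $x$, and $p(0)=1$. Let $\mathcal{H}_0:=-\frac{d}{dx}p\frac{d}{dx}+q$ be the self-adjoint operator in $L_2(\mathbb{R})$ with domain $W_2^2(\mathbb{R})$. Let $Q\subset\mathbb{R}$ be a fixed bounded open interval. For each small $\varepsilon>0$ let $\mathcal{L}_\varepsilon:W_2^2(Q)\to L_2(Q)$ be a linear operator, bounded uniformly in $\varepsilon$ (operator norms bounded by a constant independent of $\varepsilon$). Denote also by $\mathcal{L}_\varepsilon$ the operator $W_{2,loc}^2(\mathbb{R})\to L_2(\mathbb{R})$ that restricts a function to $Q$, applies $\mathcal{L}_\varepsilon$, and extends the result by zero outside $Q$. Set $\mathcal{H}_\varepsilon:=\mathcal{H}_0-\varepsilon\mathcal{L}_\varepsilon$, an operator in $L_2(\mathbb{R})$ with domain $W_2^2(\mathbb{R})$. For a closed operator $A$, $\sigma(A)$ is the spectrum, $\sigma_p(A)$ the set of eigenvalues, $\sigma_c(A)$ the continuous spectrum in the sense of Glazman: the set of $\lambda\in\mathbb{C}$ for which there is a bounded sequence $u_n$ in the domain of $A$ having no convergent subsequence (bounded noncompact sequence may be taken) with $(A-\lambda)u_n\to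 0$. In particular $\sigma_c$ and $\sigma_p$ may intersect. The residual spectrum is $\sigma_r(A):=\sigma(A)\setminus(\sigma_c(A)\cup\sigma_p(A))$. *)

theory Defs
  imports "HOL-Analysis.Analysis"
begin

section \<open>Piecewise continuous coefficients\<close>

text \<open>Finitely many discontinuities on each bounded interval, and finite one-sided limits
  everywhere. The library's \<^verbatim>\<open>piecewise_C1_differentiable_on\<close> is weaker than what is needed
  below: it allows the derivative to be unbounded near the exceptional points.\<close>

definition piecewise_continuous :: "(real \<Rightarrow> real) \<Rightarrow> bool" where
  "piecewise_continuous f \<longleftrightarrow>
     (\<forall>a b. finite {x \<in> {a..b}. \<not> isCont f x}) \<and>
     (\<forall>x. (\<exists>l. (f \<longlongrightarrow> l) (at_left x)) \<and> (\<exists>l. (f \<longlongrightarrow> l) (at_right x)))"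

definition piecewise_C1 :: "(real \<Rightarrow> real) \<Rightarrow> bool" where
  "piecewise_C1 f \<longleftrightarrow> continuous_on UNIV f \<and>
     (\<exists>g. piecewise_continuous g \<and>
          (\<forall>a b. finite {x \<in> {a..b}. \<not> (f has_real_derivative g x) (at x)}))"


section \<open>Complex Lebesgue and Sobolev spaces on an open subset of the line\<close>

text \<open>Elements of $L_2(S)$ are represented by functions on the whole line whose values outside
  \<open>S\<close> are irrelevant; equality in $L_2(S)$ is equality almost everywhere on \<open>S\<close>.\<close>

definition L2 :: "real set \<Rightarrow> (real \<Rightarrow> complex) set" where
  "L2 S = {u \<in> borel_measurable (lebesgue_on S). integrable (lebesgue_on S) (\<lambda>x. (cmod (u x))\<^sup>2)}"

definition l2norm :: "real set \<Rightarrow> (real \<Rightarrow> complex) \<Rightarrow> real" where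
  "l2norm S u = sqrt (LINT x|lebesgue_on S. (cmod (u x))\<^sup>2)"

definition ae_eq :: "real set \<Rightarrow> (real \<Rightarrow> complex) \<Rightarrow> (real \<Rightarrow> complex) \<Rightarrow> bool" where
  "ae_eq S u v \<longleftrightarrow> (AE x in lebesgue_on S. u x = v x)"

definition test_function :: "real set \<Rightarrow> (real \<Rightarrow> real) \<Rightarrow> bool" where
  "test_function S \<phi> \<longleftrightarrow>
     (\<forall>k x. (deriv ^^ k) \<phi> differentiable (at x)) \<and>
     (\<exists>K. compact K \<and> K \<subseteq> S \<and> (\<forall>x. x \<notin> K \<longrightarrow> \<phi> x = 0))"

definition locally_integrable :: "real set \<Rightarrow> (real \<Rightarrow> complex) \<Rightarrow> bool" where
  "locally_integrable S u \<longleftrightarrow> (\<forall>K. compact K \<and> K \<subseteq> S \<longrightarrow> u absolutely_integrable_on K)"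

definition has_weak_deriv :: "real set \<Rightarrow> nat \<Rightarrow> (real \<Rightarrow> complex) \<Rightarrow> (real \<Rightarrow> complex) \<Rightarrow> bool" where
  "has_weak_deriv S k u v \<longleftrightarrow> locally_integrable S u \<and> locally_integrable S v \<and>
     (\<forall>\<phi>. test_function S \<phi> \<longrightarrow>
        (LINT x|lebesgue_on S. complex_of_real ((deriv ^^ k) \<phi> x) * u x) =
        (-1) ^ k * (LINT x|lebesgue_on S. complex_of_real (\<phi> x) * v x))"

text \<open>For open \<open>S\<close> the weak derivative is determined up to null sets; some representative is
  chosen.\<close>

definition weak_deriv :: "real set \<Rightarrow> nat \<Rightarrow> (real \<Rightarrow> complex) \<Rightarrow> real \<Rightarrow> complex" where
  "weak_deriv S k u = (SOME v. has_weak_deriv S k u v)"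

definition W22 :: "real set \<Rightarrow> (real \<Rightarrow> complex) set" where
  "W22 S = {u \<in> L2 S. \<forall>k\<le>2. \<exists>v \<in> L2 S. has_weak_deriv S k u v}"

definition w22norm :: "real set \<Rightarrow> (real \<Rightarrow> complex) \<Rightarrow> real" where
  "w22norm S u = sqrt (\<Sum>k\<le>2. (l2norm S (weak_deriv S k u))\<^sup>2)"


section \<open>Linear operators and the parts of the spectrum\<close>

text \<open>A linear map from a space \<open>D\<close> of functions on \<open>S\<close> into $L_2(S)$, both taken modulo null
  sets.\<close>

definition linear_into_L2 ::
    "real set \<Rightarrow> (real \<Rightarrow> complex) set \<Rightarrow> ((real \<Rightarrow> complex) \<Rightarrow> real \<Rightarrow> complex) \<Rightarrow> bool" where
  "linear_into_L2 S D T \<longleftrightarrow>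
     (\<forall>u\<in>D. T u \<in> L2 S) \<and>
     (\<forall>u\<in>D. \<forall>v\<in>D. ae_eq S u v \<longrightarrow> ae_eq S (T u) (T v)) \<and>
     (\<forall>u\<in>D. \<forall>v\<in>D. \<forall>c d. ae_eq S (T (\<lambda>x. c * u x + d * v x)) (\<lambda>x. c * T u x + d * T v x))"

text \<open>An unbounded operator in $L_2(\mathbb{R})$: its domain together with its action, the latter
  being meaningful on the domain only.\<close>

type_synonym l2_operator = "(real \<Rightarrow> complex) set \<times> ((real \<Rightarrow> complex) \<Rightarrow> real \<Rightarrow> complex)"

definition dom_op :: "l2_operator \<Rightarrow> (real \<Rightarrow> complex) set" where
  "dom_op A = fst A"

definition shifted :: "l2_operator \<Rightarrow> complex \<Rightarrow> (real \<Rightarrow> complex) \<Rightarrow> real \<Rightarrow> complex" where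
  "shifted A z u = (\<lambda>x. snd A u x - z * u x)"

definition resolvent_set :: "l2_operator \<Rightarrow> complex set" where
  "resolvent_set A = {z.
     (\<forall>u\<in>dom_op A. ae_eq UNIV (shifted A z u) (\<lambda>x. 0) \<longrightarrow> ae_eq UNIV u (\<lambda>x. 0)) \<and>
     (\<forall>f\<in>L2 UNIV. \<exists>u\<in>dom_op A. ae_eq UNIV (shifted A z u) f) \<and>
     (\<exists>C. \<forall>u\<in>dom_op A. l2norm UNIV u \<le> C * l2norm UNIV (shifted A z u))}"

definition spectrum :: "l2_operator \<Rightarrow> complex set" where
  "spectrum A = - resolvent_set A"

definition point_spectrum :: "l2_operator \<Rightarrow> complex set" where
  "point_spectrum A = {z. \<exists>u\<in>dom_op A.
     \<not> ae_eq UNIV u (\<lambda>x. 0) \<and> ae_eq UNIV (shifted A z u) (\<lambda>x. 0)}"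

text \<open>The continuous spectrum in the sense of Glazman; it may intersect the point spectrum.\<close>

definition continuous_spectrum :: "l2_operator \<Rightarrow> complex set" where
  "continuous_spectrum A = {z. \<exists>u :: nat \<Rightarrow> real \<Rightarrow> complex.
     (\<forall>n. u n \<in> dom_op A) \<and>
     (\<exists>C. \<forall>n. l2norm UNIV (u n) \<le> C) \<and>
     \<not> (\<exists>r v. strict_mono (r :: nat \<Rightarrow> nat) \<and> v \<in> L2 UNIV \<and>
          (\<lambda>n. l2norm UNIV (\<lambda>x. u (r n) x - v x)) \<longlonglongrightarrow> 0) \<and>
     (\<lambda>n. l2norm UNIV (shifted A z (u n))) \<longlonglongrightarrow> 0}"

definition residual_spectrum :: "l2_operator \<Rightarrow> complex set" where
  "residual_spectrum A = spectrum A - (continuous_spectrum A \<union> point_spectrum A)"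


section \<open>The periodic operator and its perturbation\<close>

definition H0 :: "(real \<Rightarrow> real) \<Rightarrow> (real \<Rightarrow> real) \<Rightarrow> l2_operator" where
  "H0 p q = (W22 UNIV,
     \<lambda>u x. - weak_deriv UNIV 1 (\<lambda>y. complex_of_real (p y) * weak_deriv UNIV 1 u y) x
           + complex_of_real (q x) * u x)"

definition cut :: "real set \<Rightarrow> (real \<Rightarrow> complex) \<Rightarrow> real \<Rightarrow> complex" where
  "cut Q u = (\<lambda>x. if x \<in> Q then u x else 0)"

text \<open>Restriction to \<open>Q\<close>, then \<open>T\<close>, then extension by zero. As values outside \<open>Q\<close> do not matter
  for an element of a function space over \<open>Q\<close>, \<^const>\<open>cut\<close> serves both for the restriction and
  for the extension.\<close>

definition localized ::
    "real set \<Rightarrow> ((real \<Rightarrow> complex) \<Rightarrow> real \<Rightarrow> complex) \<Rightarrow> (real \<Rightarrow> complex) \<Rightarrow> real \<Rightarrow> complex" where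
  "localized Q T u = cut Q (T (cut Q u))"

definition H_pert ::
    "(real \<Rightarrow> real) \<Rightarrow> (real \<Rightarrow> real) \<Rightarrow> real set \<Rightarrow>
     (real \<Rightarrow> (real \<Rightarrow> complex) \<Rightarrow> real \<Rightarrow> complex) \<Rightarrow> real \<Rightarrow> l2_operator" where
  "H_pert p q Q L \<epsilon> = (W22 UNIV,
     \<lambda>u x. snd (H0 p q) u x - complex_of_real \<epsilon> * localized Q (L \<epsilon>) u x)"

end

theory Submission
  imports Defs "HOL-Complex_Analysis.Great_Picard"
begin

text \<open>
  Write $H_0 = -\frac{d}{dx}p\frac{d}{dx}+q$ and $T = \varepsilon\mathcal{L}_\varepsilon$. The operator $T$
  is of the same order as $H_0$ and need not be relatively compact. What saves the theorem is that $T$ sees a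
  function on the bounded interval $Q$ only. A sequence that is bounded in $W_2^2$ has, by the Arzela--Ascoli
  theorem, a subsequence that converges in $C^1(\overline Q)$, and the differential expression bounds the
  remaining second derivative on $Q$ by $H_0 u / p_0$ and terms of lower order. Hence, along a subsequence, the differences $w$ of the terms satisfy
  $\|T w\| \le \eta\,\|(H_0 - z)w\| + o(1)$ with $\eta = \varepsilon |C| / p_0$
  (\<open>local_pert_compact\<close>). For small $\varepsilon$ this $\eta$ is below any prescribed constant,
  independently of $z$, and this one estimate gives both claims.

  Continuous spectrum (\<open>glazman_perturbation\<close>). Let $u_n$ be bounded without a convergent
  subsequence and let $(H_0 - T_1 - z)u_n \to 0$, where $T_1$ is $T$ or $0$. A priori estimates bound $u_n$ in
  $W_2^2$. Absorbing $\eta\,\|(H_0-z)w\|$, one sees that $T w$ and $(H_0 - z)w$ tend to zero for the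
  differences $w$ along the subsequence, whether or not $T_1$ vanishes. So differences of the $u_n$, chosen so
  that they stay separated (\<open>separated_differences\<close>), are a singular sequence for $H_0$ and for
  $H_0 - T$ alike.

  Residual spectrum (\<open>residual_spectrum_empty\<close>). Let $z$ be neither an eigenvalue of $H_0 - T$ nor in
  its continuous spectrum, which is that of $H_0$. Since $H_0$ commutes with the translations by integers, an
  approximate eigenfunction of $H_0$ can be moved off to infinity and then gives a singular sequence; thus
  $H_0 - z$ is bounded below (\<open>lower_bound_of_not_glazman\<close>). By symmetry the lower bound persists
  along a path from $z$ through non-real points to a point far to the left, and the method of continuity
  connects $H_0$ at that point with $-u''+u$, which is inverted explicitly; so $H_0 - z$ is onto
  (\<open>surjective_of_lower_bound\<close>). Now $H_0 - T - z = (1 - N)(H_0 - z)$ with $N = T(H_0 - z)^{-1}$,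
  and the estimate above says that $N$ contracts by the factor $\eta < 1/4$ up to a compact error. Riesz'
  argument for the Fredholm alternative still works for such $N$ (\<open>fredholm_alternative\<close>): as
  $1 - N$ is injective, it is onto and bounded below. Hence $z$ lies in the resolvent set.

  To be able to argue with norms and subspaces, $L_2(\mathbb{R})$ is made a Banach space type of classes of
  functions, and a function of $W_2^2(\mathbb{R})$ is replaced by the triple of the classes of
  $u, u', u''$. On triples the differential expression is a bounded map, since it is algebraic.
\<close>

section \<open>Square integrable functions\<close>

lemma L2_measurable: "u \<in> L2 S \<Longrightarrow> u \<in> borel_measurable (lebesgue_on S)"
  and L2_integrable: "u \<in> L2 S \<Longrightarrow> integrable (lebesgue_on S) (\<lambda>x. (cmod (u x))\<^sup>2)"
  by (auto simp: L2_def)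

lemma L2_of_square_le:
  assumes "u \<in> borel_measurable (lebesgue_on S)" "integrable (lebesgue_on S) g"
    and "\<And>x. (cmod (u x))\<^sup>2 \<le> g x"
  shows "u \<in> L2 S"
proof -
  have "integrable (lebesgue_on S) (\<lambda>x. (cmod (u x))\<^sup>2)"
  proof (rule Bochner_Integration.integrable_bound[OF assms(2)])
    show "(\<lambda>x. (cmod (u x))\<^sup>2) \<in> borel_measurable (lebesgue_on S)" using assms(1) by measurable
    show "AE x in lebesgue_on S. norm ((cmod (u x))\<^sup>2) \<le> norm (g x)"
    proof (rule AE_I2)
      show "norm ((cmod (u x))\<^sup>2) \<le> norm (g x)" for x using assms(3)[of x] by simp
    qed
  qed
  then show ?thesis using assms(1) by (simp add: L2_def)
qed

lemma L2_mult_bounded: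
  assumes "u \<in> L2 S" "m \<in> borel_measurable (lebesgue_on S)" "\<And>x. cmod (m x) \<le> B"
  shows "(\<lambda>x. m x * u x) \<in> L2 S"
proof (rule L2_of_square_le)
  show "(\<lambda>x. m x * u x) \<in> borel_measurable (lebesgue_on S)"
    using assms L2_measurable by measurable
  show "integrable (lebesgue_on S) (\<lambda>x. B\<^sup>2 * (cmod (u x))\<^sup>2)"
    using L2_integrable[OF assms(1)] by simp
  show "(cmod (m x * u x))\<^sup>2 \<le> B\<^sup>2 * (cmod (u x))\<^sup>2" for x
    using assms(3)[of x] by (simp add: norm_mult power_mult_distrib mult_right_mono power_mono)
qed

lemma L2_scale: "u \<in> L2 S \<Longrightarrow> (\<lambda>x. c * u x) \<in> L2 S"
  by (rule L2_mult_bounded[of _ _ _ "cmod c"]) auto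

lemma L2_add:
  assumes "u \<in> L2 S" "v \<in> L2 S"
  shows "(\<lambda>x. u x + v x) \<in> L2 S"
proof (rule L2_of_square_le)
  show "(\<lambda>x. u x + v x) \<in> borel_measurable (lebesgue_on S)"
    using assms L2_measurable by measurable
  show "integrable (lebesgue_on S) (\<lambda>x. 2 * (cmod (u x))\<^sup>2 + 2 * (cmod (v x))\<^sup>2)"
    using assms by (intro Bochner_Integration.integrable_add integrable_mult_right L2_integrable)
  show "(cmod (u x + v x))\<^sup>2 \<le> 2 * (cmod (u x))\<^sup>2 + 2 * (cmod (v x))\<^sup>2" for x
  proof -
    have "(cmod (u x + v x))\<^sup>2 \<le> (cmod (u x) + cmod (v x))\<^sup>2"
      by (simp add: norm_triangle_ineq power_mono)
    also have "\<dots> \<le> 2 * (cmod (u x))\<^sup>2 + 2 * (cmod (v x))\<^sup>2"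
      using sum_squares_bound[of "cmod (u x)" "cmod (v x)"] by (simp add: power2_sum)
    finally show ?thesis .
  qed
qed

lemma L2_zero: "(\<lambda>x. 0) \<in> L2 S"
  by (simp add: L2_def)

lemma L2_uminus: "u \<in> L2 S \<Longrightarrow> (\<lambda>x. - u x) \<in> L2 S"
  using L2_scale[of u S "-1"] by simp

lemma L2_diff: "u \<in> L2 S \<Longrightarrow> v \<in> L2 S \<Longrightarrow> (\<lambda>x. u x - v x) \<in> L2 S"
  using L2_add[OF _ L2_uminus, of u S v] by simp

lemma L2_cnj: "u \<in> L2 S \<Longrightarrow> (\<lambda>x. cnj (u x)) \<in> L2 S"
proof -
  assume u: "u \<in> L2 S"
  have "cnj \<in> borel_measurable borel" by (intro borel_measurable_continuous_onI continuous_intros)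
  then have "(\<lambda>x. cnj (u x)) \<in> borel_measurable (lebesgue_on S)"
    by (rule measurable_compose[OF L2_measurable[OF u]])
  then show ?thesis using L2_integrable[OF u] by (simp add: L2_def)
qed

lemma ae_eq_UNIV: "ae_eq UNIV u v \<longleftrightarrow> (AE x in lebesgue. u x = v x)"
  unfolding ae_eq_def lebesgue_on_UNIV_eq ..

lemma L2_ae_cong:
  assumes "u \<in> L2 UNIV" "ae_eq UNIV u v"
  shows "v \<in> L2 UNIV"
proof -
  have u [measurable]: "u \<in> borel_measurable lebesgue"
    using L2_measurable[OF assms(1)] by (simp add: lebesgue_on_UNIV_eq)
  have ae: "AE x in lebesgue. u x = v x" using assms(2) by (simp add: ae_eq_UNIV)
  have m [measurable]: "v \<in> borel_measurable lebesgue" by (rule borel_measurable_AE[OF u ae])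
  have 1: "AE x in lebesgue. (cmod (u x))\<^sup>2 = (cmod (v x))\<^sup>2"
    using ae by eventually_elim simp
  have 2: "integrable lebesgue (\<lambda>x. (cmod (u x))\<^sup>2)"
    using L2_integrable[OF assms(1)] by (simp add: lebesgue_on_UNIV_eq)
  have 3: "(\<lambda>x. (cmod (v x))\<^sup>2) \<in> borel_measurable lebesgue" by measurable
  have "integrable lebesgue (\<lambda>x. (cmod (v x))\<^sup>2)"
    by (rule integrable_cong_AE_imp[OF 2 3 1])
  then show ?thesis by (simp add: L2_def lebesgue_on_UNIV_eq m)
qed

lemma l2norm_nonneg [simp]: "0 \<le> l2norm S u"
  by (simp add: l2norm_def)

lemma l2norm_power2: "(l2norm S u)\<^sup>2 = (LINT x|lebesgue_on S. (cmod (u x))\<^sup>2)"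
  by (simp add: l2norm_def)

lemma l2norm_ae_cong:
  assumes "ae_eq S u v" "u \<in> borel_measurable (lebesgue_on S)" "v \<in> borel_measurable (lebesgue_on S)"
  shows "l2norm S u = l2norm S v"
  unfolding l2norm_def using assms
  by (intro arg_cong[where f=sqrt] integral_cong_AE) (auto simp: ae_eq_def)

lemma l2norm_scale: "l2norm S (\<lambda>x. c * u x) = cmod c * l2norm S u"
  by (simp add: l2norm_def norm_mult power_mult_distrib real_sqrt_mult)

lemma l2norm_mono:
  assumes "u \<in> borel_measurable (lebesgue_on S)" "v \<in> L2 S" "\<And>x. cmod (u x) \<le> cmod (v x)"
  shows "l2norm S u \<le> l2norm S v"
proof -
  have *: "(cmod (u x))\<^sup>2 \<le> (cmod (v x))\<^sup>2" for x by (simp add: assms(3) power_mono)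
  have "u \<in> L2 S" by (rule L2_of_square_le[OF assms(1) L2_integrable[OF assms(2)] *])
  then show ?thesis
    unfolding l2norm_def using * assms(2)
    by (intro real_sqrt_le_mono integral_mono) (auto intro: L2_integrable)
qed

lemma l2norm_mult_bounded:
  assumes "u \<in> L2 S" "m \<in> borel_measurable (lebesgue_on S)" "\<And>x. cmod (m x) \<le> B"
  shows "l2norm S (\<lambda>x. m x * u x) \<le> B * l2norm S u"
proof -
  have "B \<ge> 0" using assms(3)[of 0] norm_ge_zero order_trans by blast
  then have "cmod (m x * u x) \<le> cmod (of_real B * u x)" for x
    by (simp add: norm_mult assms(3) mult_right_mono)
  then have "l2norm S (\<lambda>x. m x * u x) \<le> l2norm S (\<lambda>x. of_real B * u x)"
    by (intro l2norm_mono L2_scale L2_measurable L2_mult_bounded[OF assms] assms(1))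
  then show ?thesis using \<open>B \<ge> 0\<close> by (simp add: l2norm_scale)
qed

lemma l2norm_eq_0:
  assumes "u \<in> L2 S"
  shows "l2norm S u = 0 \<longleftrightarrow> ae_eq S u (\<lambda>x. 0)"
  using integral_nonneg_eq_0_iff_AE[OF L2_integrable[OF assms]]
  by (simp add: l2norm_def ae_eq_def)

lemma L2_mult_integrable:
  assumes "u \<in> L2 S" "v \<in> L2 S"
  shows "integrable (lebesgue_on S) (\<lambda>x. u x * v x)"
proof (rule Bochner_Integration.integrable_bound)
  show "integrable (lebesgue_on S) (\<lambda>x. (cmod (u x))\<^sup>2 + (cmod (v x))\<^sup>2)"
    using assms by (intro Bochner_Integration.integrable_add L2_integrable)
  show "AE x in lebesgue_on S. norm (u x * v x) \<le> norm ((cmod (u x))\<^sup>2 + (cmod (v x))\<^sup>2)"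
  proof (rule AE_I2)
    fix x
    have "2 * cmod (u x) * cmod (v x) \<le> (cmod (u x))\<^sup>2 + (cmod (v x))\<^sup>2" by (rule sum_squares_bound)
    moreover have "0 \<le> cmod (u x) * cmod (v x)" by simp
    ultimately have "cmod (u x) * cmod (v x) \<le> (cmod (u x))\<^sup>2 + (cmod (v x))\<^sup>2" by linarith
    then show "norm (u x * v x) \<le> norm ((cmod (u x))\<^sup>2 + (cmod (v x))\<^sup>2)"
      by (simp add: norm_mult)
  qed
  show "(\<lambda>x. u x * v x) \<in> borel_measurable (lebesgue_on S)"
    using assms L2_measurable by measurable
qed

lemma L2_Cauchy_Schwarz_abs:
  assumes "u \<in> L2 S" "v \<in> L2 S"
  shows "(LINT x|lebesgue_on S. cmod (u x) * cmod (v x)) \<le> l2norm S u * l2norm S v"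
proof -
  let ?A = "l2norm S u" and ?B = "l2norm S v" and ?I = "LINT x|lebesgue_on S. cmod (u x) * cmod (v x)"
  have int: "integrable (lebesgue_on S) (\<lambda>x. cmod (u x) * cmod (v x))"
    using integrable_norm[OF L2_mult_integrable[OF assms]] by (simp add: norm_mult)
  show ?thesis
  proof (cases "?A = 0 \<or> ?B = 0")
    case True
    then have "ae_eq S u (\<lambda>x. 0) \<or> ae_eq S v (\<lambda>x. 0)"
      using l2norm_eq_0 assms by auto
    then have "AE x in lebesgue_on S. cmod (u x) * cmod (v x) = 0"
      by (auto simp: ae_eq_def elim: eventually_mono)
    then have "?I = 0"
      using int integral_nonneg_eq_0_iff_AE[OF int] by simp
    then show ?thesis by simp
  next
    case False
    then have pos: "?A > 0" "?B > 0" by (auto simp: less_le)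
    have "2 * (cmod (u x) * cmod (v x)) \<le> (?B / ?A) * (cmod (u x))\<^sup>2 + (?A / ?B) * (cmod (v x))\<^sup>2" for x
    proof -
      have "0 \<le> (?B * cmod (u x) - ?A * cmod (v x))\<^sup>2 / (?A * ?B)" using pos by simp
      also have "\<dots> = (?B / ?A) * (cmod (u x))\<^sup>2 + (?A / ?B) * (cmod (v x))\<^sup>2 - 2 * (cmod (u x) * cmod (v x))"
        using pos by (simp add: field_simps power2_eq_square)
      finally show ?thesis by simp
    qed
    then have "(LINT x|lebesgue_on S. 2 * (cmod (u x) * cmod (v x)))
      \<le> (LINT x|lebesgue_on S. (?B / ?A) * (cmod (u x))\<^sup>2 + (?A / ?B) * (cmod (v x))\<^sup>2)"
      using int L2_integrable[OF assms(1)] L2_integrable[OF assms(2)]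
      by (intro integral_mono Bochner_Integration.integrable_add integrable_mult_right)
    also have "\<dots> = (?B / ?A) * ?A\<^sup>2 + (?A / ?B) * ?B\<^sup>2"
      using L2_integrable[OF assms(1)] L2_integrable[OF assms(2)]
      by (subst Bochner_Integration.integral_add; (intro integrable_mult_right)?) (simp_all add: l2norm_power2)
    also have "\<dots> = 2 * (?A * ?B)" using pos by (simp add: power2_eq_square)
    finally show ?thesis by simp
  qed
qed

lemma L2_Cauchy_Schwarz:
  assumes "u \<in> L2 S" "v \<in> L2 S"
  shows "cmod (LINT x|lebesgue_on S. u x * v x) \<le> l2norm S u * l2norm S v"
proof -
  have "cmod (LINT x|lebesgue_on S. u x * v x) \<le> (LINT x|lebesgue_on S. cmod (u x * v x))"
    by (rule integral_norm_bound)
  then show ?thesis using L2_Cauchy_Schwarz_abs[OF assms] by (simp add: norm_mult)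
qed

lemma l2norm_triangle:
  assumes "u \<in> L2 S" "v \<in> L2 S"
  shows "l2norm S (\<lambda>x. u x + v x) \<le> l2norm S u + l2norm S v"
proof (rule power2_le_imp_le)
  have int: "integrable (lebesgue_on S) (\<lambda>x. cmod (u x) * cmod (v x))"
    using integrable_norm[OF L2_mult_integrable[OF assms]] by (simp add: norm_mult)
  have "(l2norm S (\<lambda>x. u x + v x))\<^sup>2
     \<le> (LINT x|lebesgue_on S. (cmod (u x))\<^sup>2 + (cmod (v x))\<^sup>2 + 2 * (cmod (u x) * cmod (v x)))"
    unfolding l2norm_power2
  proof (rule integral_mono)
    show "(cmod (u x + v x))\<^sup>2 \<le> (cmod (u x))\<^sup>2 + (cmod (v x))\<^sup>2 + 2 * (cmod (u x) * cmod (v x))" for x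
      using power_mono[OF norm_triangle_ineq norm_ge_zero, of "u x" "v x" 2] by (simp add: power2_sum)
  qed (use assms int L2_integrable[OF L2_add] L2_integrable in auto)
  also have "\<dots> = (l2norm S u)\<^sup>2 + (l2norm S v)\<^sup>2 + 2 * (LINT x|lebesgue_on S. cmod (u x) * cmod (v x))"
    using assms int L2_integrable by (simp add: l2norm_power2)
  also have "\<dots> \<le> (l2norm S u + l2norm S v)\<^sup>2"
    using L2_Cauchy_Schwarz_abs[OF assms] by (simp add: power2_sum)
  finally show "(l2norm S (\<lambda>x. u x + v x))\<^sup>2 \<le> (l2norm S u + l2norm S v)\<^sup>2" .
qed simp

lemma L2_UNIV_measurable: "f \<in> L2 UNIV \<Longrightarrow> f \<in> borel_measurable lebesgue"
  using L2_measurable[of f UNIV] by (simp add: lebesgue_on_UNIV_eq)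

lemma L2_iff_nn_integral:
  assumes [measurable]: "f \<in> borel_measurable lebesgue"
  shows "f \<in> L2 UNIV \<longleftrightarrow> (\<integral>\<^sup>+x. ennreal ((cmod (f x))\<^sup>2) \<partial>lebesgue) < \<infinity>"
  by (auto simp: L2_def lebesgue_on_UNIV_eq integrable_iff_bounded)

lemma nn_integral_l2norm:
  assumes "f \<in> L2 UNIV"
  shows "(\<integral>\<^sup>+x. ennreal ((cmod (f x))\<^sup>2) \<partial>lebesgue) = ennreal ((l2norm UNIV f)\<^sup>2)"
  using L2_integrable[OF assms] 
  by (simp add: l2norm_power2 lebesgue_on_UNIV_eq nn_integral_eq_integral)

lemma l2norm_le_nn_integral:
  assumes "f \<in> L2 UNIV" "(\<integral>\<^sup>+x. ennreal ((cmod (f x))\<^sup>2) \<partial>lebesgue) \<le> ennreal (c\<^sup>2)" "0 \<le> c"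
  shows "l2norm UNIV f \<le> c"
  using assms nn_integral_l2norm[OF assms(1)] power2_le_imp_le by auto

text \<open>The bound on the differences makes $\sum_n 2^n |h_{n+1}-h_n|^2$ integrable, so that
almost everywhere the differences decay geometrically and the sequence converges; Fatou's lemma then bounds the
norms.\<close>
lemma rapidly_Cauchy_L2_converges:
  fixes h :: "nat \<Rightarrow> real \<Rightarrow> complex"
  assumes h: "\<And>n. h n \<in> L2 UNIV"
    and fast: "\<And>m n. n \<le> m \<Longrightarrow> l2norm UNIV (\<lambda>x. h m x - h n x) \<le> (1/2) ^ n"
  obtains f where "f \<in> L2 UNIV" "\<And>n. l2norm UNIV (\<lambda>x. f x - h n x) \<le> (1/2) ^ n"
proof -
  have meas [measurable]: "h n \<in> borel_measurable lebesgue" for n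
    using L2_UNIV_measurable[OF h] .
  have diff: "(\<lambda>x. h m x - h n x) \<in> L2 UNIV" for m n using h L2_diff by blast
  have fast': "(\<integral>\<^sup>+x. ennreal ((cmod (h m x - h n x))\<^sup>2) \<partial>lebesgue) \<le> ennreal (((1/2) ^ n)\<^sup>2)" if "n \<le> m" for m n
    using fast[OF that] by (auto simp: nn_integral_l2norm[OF diff] intro!: ennreal_leI power_mono)
  let ?s = "\<lambda>n x. 2 ^ n * (cmod (h (Suc n) x - h n x))\<^sup>2"
  have "(\<integral>\<^sup>+x. (\<Sum>n. ennreal (?s n x)) \<partial>lebesgue) = (\<Sum>n. \<integral>\<^sup>+x. ennreal (?s n x) \<partial>lebesgue)"
    by (rule nn_integral_suminf) measurable
  also have "\<dots> \<le> (\<Sum>n. ennreal ((1/2)^n))"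
  proof (rule suminf_le)
    fix n
    have "(\<integral>\<^sup>+x. ennreal (?s n x) \<partial>lebesgue) = ennreal (2 ^ n) * (\<integral>\<^sup>+x. ennreal ((cmod (h (Suc n) x - h n x))\<^sup>2) \<partial>lebesgue)"
      by (subst nn_integral_cmult[symmetric]) (auto simp: ennreal_mult)
    also have "\<dots> \<le> ennreal (2 ^ n) * ennreal (((1/2) ^ n)\<^sup>2)"
      by (intro mult_left_mono fast') auto
    also have "\<dots> = ennreal (2 ^ n * ((1/2) ^ n)\<^sup>2)" by (simp add: ennreal_mult)
    also have "2 ^ n * ((1/2) ^ n)\<^sup>2 = (1/2::real) ^ n"
      by (simp add: power2_eq_square power_one_over)
    finally show "(\<integral>\<^sup>+x. ennreal (?s n x) \<partial>lebesgue) \<le> ennreal ((1/2) ^ n)" .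
  qed auto
  also have "\<dots> < \<infinity>"
    by (subst suminf_ennreal2) (auto intro!: summable_geometric)
  finally have "(\<integral>\<^sup>+x. (\<Sum>n. ennreal (?s n x)) \<partial>lebesgue) \<noteq> \<infinity>" by simp
  then have AE_fin: "AE x in lebesgue. (\<Sum>n. ennreal (?s n x)) \<noteq> \<infinity>"
    by (intro nn_integral_PInf_AE) measurable
  define f where "f x = lim (\<lambda>n. h n x)" for x
  have [measurable]: "f \<in> borel_measurable lebesgue"
    unfolding f_def by (rule borel_measurable_lim_metric) measurable
  have conv: "AE x in lebesgue. (\<lambda>n. h n x) \<longlonglongrightarrow> f x"
    using AE_fin
  proof eventually_elim
    case (elim x)
    have "summable (\<lambda>n. ?s n x)"
      using elim by (intro summable_suminf_not_top) auto
    then have "(\<lambda>n. ?s n x) \<longlonglongrightarrow> 0" by (rule summable_LIMSEQ_zero)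
    then have "Bseq (\<lambda>n. ?s n x)" using convergent_imp_Bseq convergentI by blast
    then obtain K where K: "K > 0" "\<And>n. ?s n x \<le> K" unfolding Bseq_def by (auto simp: abs_mult)
    have "cmod (h (Suc n) x - h n x) \<le> sqrt K * (sqrt (1/2)) ^ n" for n
    proof (rule power2_le_imp_le)
      have "(cmod (h (Suc n) x - h n x))\<^sup>2 \<le> K * (1/2)^n"
        using K(2)[of n] by (simp add: field_simps power_one_over)
      also have "\<dots> = (sqrt K * (sqrt (1/2)) ^ n)\<^sup>2"
        using K(1) by (simp add: power_mult_distrib power_mult[symmetric] mult.commute[of n] power_mult[of _ 2 n])
      finally show "(cmod (h (Suc n) x - h n x))\<^sup>2 \<le> (sqrt K * (sqrt (1/2)) ^ n)\<^sup>2" .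
    qed (use K in auto)
    then have diff_bound: "norm (h (Suc n) x - h n x) \<le> sqrt K * (sqrt (1/2)) ^ n" if "n \<ge> 0" for n by simp
    have "summable (\<lambda>n. sqrt K * (sqrt (1/2)) ^ n)"
      by (intro summable_mult summable_geometric) (simp add: real_sqrt_divide)
    then have "summable (\<lambda>n. h (Suc n) x - h n x)"
      using diff_bound by (rule summable_comparison_test')
    then have "convergent (\<lambda>n. h n x - h 0 x)"
      by (simp only: summable_iff_convergent sum_lessThan_telescope[of "\<lambda>n. h n x"])
    from convergent_add[OF this convergent_const[of "h 0 x"]]
    have "convergent (\<lambda>n. h n x)" by simp
    then show ?case unfolding f_def by (rule convergent_LIMSEQ_iff[THEN iffD1])
  qed
  have bound: "(\<integral>\<^sup>+x. ennreal ((cmod (f x - h n x))\<^sup>2) \<partial>lebesgue) \<le> ennreal (((1/2) ^ n)\<^sup>2)" for n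
  proof -
    have "(\<integral>\<^sup>+x. ennreal ((cmod (f x - h n x))\<^sup>2) \<partial>lebesgue)
        = (\<integral>\<^sup>+x. liminf (\<lambda>m. ennreal ((cmod (h m x - h n x))\<^sup>2)) \<partial>lebesgue)"
    proof (rule nn_integral_cong_AE)
      show "AE x in lebesgue. ennreal ((cmod (f x - h n x))\<^sup>2) = liminf (\<lambda>m. ennreal ((cmod (h m x - h n x))\<^sup>2))"
        using conv
      proof eventually_elim
        case (elim x)
        have "(\<lambda>m. ennreal ((cmod (h m x - h n x))\<^sup>2)) \<longlonglongrightarrow> ennreal ((cmod (f x - h n x))\<^sup>2)"
          by (intro tendsto_intros tendsto_ennrealI elim)
        then show ?case by (rule lim_imp_Liminf[OF sequentially_bot, symmetric])
      qed
    qed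
    also have "\<dots> \<le> liminf (\<lambda>m. \<integral>\<^sup>+x. ennreal ((cmod (h m x - h n x))\<^sup>2) \<partial>lebesgue)"
      by (rule nn_integral_liminf) measurable
    also have "\<dots> \<le> liminf (\<lambda>m::nat. ennreal (((1/2) ^ n)\<^sup>2))"
      by (intro Liminf_mono eventually_mono[OF eventually_ge_at_top[of n]] fast')
    also have "\<dots> = ennreal (((1/2) ^ n)\<^sup>2)" by (simp add: Liminf_const)
    finally show ?thesis .
  qed
  have fL: "(\<lambda>x. f x - h n x) \<in> L2 UNIV" for n
    by (subst L2_iff_nn_integral) (use bound[of n] in \<open>auto intro: le_less_trans\<close>)
  have "(\<lambda>x. (f x - h 0 x) + h 0 x) \<in> L2 UNIV" by (rule L2_add[OF fL h])
  then have "f \<in> L2 UNIV" by simp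
  moreover have "l2norm UNIV (\<lambda>x. f x - h n x) \<le> (1/2)^n" for n
    by (rule l2norm_le_nn_integral[OF fL bound]) simp
  ultimately show thesis by (rule that)
qed

lemma ae_eq_refl [simp]: "ae_eq S u u"
  and ae_eq_sym: "ae_eq S u v \<Longrightarrow> ae_eq S v u"
  by (auto simp: ae_eq_def)

lemma ae_eq_trans: "ae_eq S u v \<Longrightarrow> ae_eq S v w \<Longrightarrow> ae_eq S u w"
  unfolding ae_eq_def by (auto elim: eventually_elim2)

lemma l2norm_cong: "ae_eq UNIV u v \<Longrightarrow> u \<in> L2 UNIV \<Longrightarrow> l2norm UNIV u = l2norm UNIV v"
  by (meson L2_ae_cong L2_measurable l2norm_ae_cong)

section \<open>The Banach space of classes of functions\<close>

quotient_type l2 = "real \<Rightarrow> complex" / partial: "\<lambda>u v. u \<in> L2 UNIV \<and> v \<in> L2 UNIV \<and> ae_eq UNIV u v"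
  by (rule part_equivpI) (auto intro: L2_zero ae_eq_sym ae_eq_trans simp: symp_def transp_def)

instantiation l2 :: real_vector
begin
lift_definition zero_l2 :: l2 is "\<lambda>x. 0" by (simp add: L2_zero)
lift_definition plus_l2 :: "l2 \<Rightarrow> l2 \<Rightarrow> l2" is "\<lambda>u v x. u x + v x"
  by (auto simp: ae_eq_def intro: L2_add)
lift_definition minus_l2 :: "l2 \<Rightarrow> l2 \<Rightarrow> l2" is "\<lambda>u v x. u x - v x"
  by (auto simp: ae_eq_def intro: L2_diff)
lift_definition uminus_l2 :: "l2 \<Rightarrow> l2" is "\<lambda>u x. - u x"
  by (auto simp: ae_eq_def intro: L2_uminus)
lift_definition scaleR_l2 :: "real \<Rightarrow> l2 \<Rightarrow> l2" is "\<lambda>c u x. c *\<^sub>R u x"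
  by (auto simp: ae_eq_def scaleR_conv_of_real intro: L2_scale)
instance
proof
  fix x y z :: l2 and a b :: real
  show "x + y + z = x + (y + z)" by transfer (simp add: L2_add add.assoc)
  show "x + y = y + x" by transfer (simp add: L2_add add.commute)
  show "0 + x = x" by transfer simp
  show "- x + x = 0" by transfer (simp add: L2_zero)
  show "x - y = x + - y" by transfer (simp add: L2_diff)
  show "a *\<^sub>R (x + y) = a *\<^sub>R x + a *\<^sub>R y"
    by transfer (simp add: scaleR_conv_of_real L2_scale L2_add distrib_left)
  show "(a + b) *\<^sub>R x = a *\<^sub>R x + b *\<^sub>R x"
    by transfer (simp add: scaleR_conv_of_real L2_scale L2_add distrib_right)
  show "a *\<^sub>R b *\<^sub>R x = (a * b) *\<^sub>R x"
    by transfer (simp add: scaleR_conv_of_real L2_scale mult.assoc)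
  show "1 *\<^sub>R x = x" by transfer simp
qed
end

instantiation l2 :: real_normed_vector
begin
lift_definition norm_l2 :: "l2 \<Rightarrow> real" is "l2norm UNIV" by (auto intro: l2norm_cong)
definition "dist_l2 (x::l2) y = norm (x - y)"
definition "sgn_l2 (x::l2) = x /\<^sub>R norm x"
definition "uniformity_l2 = (INF e\<in>{0<..}. principal {(x::l2, y). dist x y < e})"
definition "open_l2 (U :: l2 set) = (\<forall>x\<in>U. eventually (\<lambda>(x', y). x' = x \<longrightarrow> y \<in> U) uniformity)"
instance
proof
  fix x y :: l2 and a :: real
  show "dist x y = norm (x - y)" by (rule dist_l2_def)
  show "sgn x = x /\<^sub>R norm x" by (rule sgn_l2_def)
  show "uniformity = (INF e\<in>{0<..}. principal {(x::l2, y). dist x y < e})" by (rule uniformity_l2_def)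
  show "open U = (\<forall>x\<in>U. eventually (\<lambda>(x', y). x' = x \<longrightarrow> y \<in> U) uniformity)" for U :: "l2 set"
    by (rule open_l2_def)
  show "(norm x = 0) = (x = 0)" by transfer (simp add: l2norm_eq_0 L2_zero)
  show "norm (x + y) \<le> norm x + norm y" by transfer (simp add: l2norm_triangle)
  show "norm (a *\<^sub>R x) = \<bar>a\<bar> * norm x" by transfer (simp add: scaleR_conv_of_real l2norm_scale)
qed
end

text \<open>Off \<open>L2 UNIV\<close> the value of the abstraction function is arbitrary, so facts about it assume membership.\<close>
abbreviation cls :: "(real \<Rightarrow> complex) \<Rightarrow> l2" where "cls \<equiv> abs_l2"

lemma cls_cases: obtains u where "x = cls u" "u \<in> L2 UNIV"
  using Quotient3_abs_rep[OF Quotient3_l2, of x] Quotient3_rep_reflp[OF Quotient3_l2, of x] by metis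

lemma cls_eq_iff: "u \<in> L2 UNIV \<Longrightarrow> v \<in> L2 UNIV \<Longrightarrow> cls u = cls v \<longleftrightarrow> ae_eq UNIV u v"
  using Quotient3_rel[OF Quotient3_l2, of u v] by auto

lemma cls_eqI: "u \<in> L2 UNIV \<Longrightarrow> ae_eq UNIV u v \<Longrightarrow> cls u = cls v"
  using cls_eq_iff L2_ae_cong by blast

lemma cls_add: "u \<in> L2 UNIV \<Longrightarrow> v \<in> L2 UNIV \<Longrightarrow> cls u + cls v = cls (\<lambda>x. u x + v x)"
  by (simp add: plus_l2.abs_eq)

lemma cls_diff: "u \<in> L2 UNIV \<Longrightarrow> v \<in> L2 UNIV \<Longrightarrow> cls u - cls v = cls (\<lambda>x. u x - v x)"
  by (simp add: minus_l2.abs_eq)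

lemma cls_scaleR: "u \<in> L2 UNIV \<Longrightarrow> c *\<^sub>R cls u = cls (\<lambda>x. c *\<^sub>R u x)"
  by (simp add: scaleR_l2.abs_eq)

lemma norm_cls: "u \<in> L2 UNIV \<Longrightarrow> norm (cls u) = l2norm UNIV u"
  by (simp add: norm_l2.abs_eq)

lemma cls_zero: "cls (\<lambda>x. 0) = 0"
  by (simp add: zero_l2.abs_eq)

instance l2 :: banach
proof
  fix X :: "nat \<Rightarrow> l2"
  assume X: "Cauchy X"
  have "\<exists>N. \<forall>m\<ge>N. \<forall>k\<ge>N. norm (X m - X k) < (1/2)^n" for n
    using CauchyD[OF X, of "(1/2)^n"] by simp
  then obtain N where N: "\<And>n m k. m \<ge> N n \<Longrightarrow> k \<ge> N n \<Longrightarrow> norm (X m - X k) < (1/2)^n" by metis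
  define r where "r n = Max (N ` {..n}) + n" for n
  have rN: "r n \<ge> N n" for n unfolding r_def by (simp add: trans_le_add1)
  have rmono: "r n \<le> r m" if "n \<le> m" for n m
    unfolding r_def using that by (intro add_mono Max_mono) auto
  have "\<forall>n. \<exists>u. X n = cls u \<and> u \<in> L2 UNIV" using cls_cases by metis
  then obtain u where u: "\<And>n. X n = cls (u n)" "\<And>n. u n \<in> L2 UNIV" by metis
  obtain f where f: "f \<in> L2 UNIV" "\<And>n. l2norm UNIV (\<lambda>x. f x - u (r n) x) \<le> (1/2)^n"
  proof (rule rapidly_Cauchy_L2_converges[of "\<lambda>n. u (r n)"])
    show "l2norm UNIV (\<lambda>x. u (r m) x - u (r n) x) \<le> (1/2)^n" if "n \<le> m" for m n
      using N[of n "r m" "r n"] rN[of n] rmono[OF that] u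
      by (simp add: cls_diff norm_cls L2_diff)
  qed (use u in auto)
  have lim: "norm (cls f - X (r n)) \<le> (1/2)^n" for n
    using f u by (simp add: cls_diff norm_cls L2_diff)
  have sub: "(\<lambda>n. X (r n)) \<longlonglongrightarrow> cls f"
  proof (rule LIMSEQ_I)
    fix e :: real assume "e > 0"
    then obtain n0 where n0: "(1/2)^n0 < e" using real_arch_pow_inv[of e "1/2"] by auto
    have "norm (X (r n) - cls f) < e" if "n \<ge> n0" for n
    proof -
      have "(1/2::real)^n \<le> (1/2)^n0" using that by (intro power_decreasing) auto
      then have "norm (cls f - X (r n)) < e" using lim[of n] n0 by linarith
      then show ?thesis by (simp add: norm_minus_commute)
    qed
    then show "\<exists>no. \<forall>n\<ge>no. norm (X (r n) - cls f) < e" by blast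
  qed
  have "X \<longlonglongrightarrow> cls f"
  proof (rule LIMSEQ_I)
    fix e :: real assume e: "e > 0"
    obtain K where K: "\<And>m k. m \<ge> K \<Longrightarrow> k \<ge> K \<Longrightarrow> norm (X m - X k) < e/2"
      using CauchyD[OF X, of "e/2"] e by auto
    obtain K' where K': "\<And>n. n \<ge> K' \<Longrightarrow> norm (X (r n) - cls f) < e/2"
      using LIMSEQ_D[OF sub, of "e/2"] e by auto
    define k where "k = max K K'"
    have "r k \<ge> K" unfolding r_def k_def by simp
    have "norm (X m - cls f) < e" if "m \<ge> K" for m
      using norm_triangle_ineq[of "X m - X (r k)" "X (r k) - cls f"] K[OF that \<open>r k \<ge> K\<close>] K'[of k]
      by (simp add: k_def)
    then show "\<exists>no. \<forall>n\<ge>no. norm (X n - cls f) < e" by blast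
  qed
  then show "convergent X" by (rule convergentI)
qed

text \<open>Coefficients, cut-offs and complex scalars all act as multiplication operators on classes. The type carries the
real vector space structure only, which suffices because complex scalars are treated in this way.\<close>
definition multiplier :: "(real \<Rightarrow> complex) \<Rightarrow> bool" where
  "multiplier m \<longleftrightarrow> m \<in> borel_measurable lebesgue \<and> (\<exists>B. \<forall>x. cmod (m x) \<le> B)"

lemma multiplier_L2: "multiplier m \<Longrightarrow> u \<in> L2 UNIV \<Longrightarrow> (\<lambda>x. m x * u x) \<in> L2 UNIV"
  unfolding multiplier_def by (auto intro: L2_mult_bounded simp: lebesgue_on_UNIV_eq)

lift_definition mult_l2 :: "(real \<Rightarrow> complex) \<Rightarrow> l2 \<Rightarrow> l2" is
  "\<lambda>m u x. if multiplier m then m x * u x else 0"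
proof -
  fix m u v :: "real \<Rightarrow> complex"
  assume uv: "u \<in> L2 UNIV \<and> v \<in> L2 UNIV \<and> ae_eq UNIV u v"
  show "(\<lambda>x. if multiplier m then m x * u x else 0) \<in> L2 UNIV \<and>
    (\<lambda>x. if multiplier m then m x * v x else 0) \<in> L2 UNIV \<and>
    ae_eq UNIV (\<lambda>x. if multiplier m then m x * u x else 0) (\<lambda>x. if multiplier m then m x * v x else 0)"
  proof (cases "multiplier m")
    case True
    have "ae_eq UNIV (\<lambda>x. m x * u x) (\<lambda>x. m x * v x)"
      using uv unfolding ae_eq_def by (auto elim: eventually_mono)
    then show ?thesis using True uv by (simp add: multiplier_L2)
  qed (simp add: L2_zero)
qed

lemma mult_l2_cls: "multiplier m \<Longrightarrow> u \<in> L2 UNIV \<Longrightarrow> mult_l2 m (cls u) = cls (\<lambda>x. m x * u x)"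
  by (subst mult_l2.abs_eq) auto

lemma norm_mult_l2:
  assumes "m \<in> borel_measurable lebesgue" "\<And>x. cmod (m x) \<le> B"
  shows "norm (mult_l2 m x) \<le> B * norm x"
proof -
  have m: "multiplier m" using assms by (auto simp: multiplier_def)
  obtain u where u: "x = cls u" "u \<in> L2 UNIV" by (rule cls_cases)
  then show ?thesis
    using l2norm_mult_bounded[OF u(2), of m B] assms
    by (simp add: mult_l2_cls m norm_cls multiplier_L2 lebesgue_on_UNIV_eq)
qed

lemma bounded_linear_mult_l2: "bounded_linear (mult_l2 m)"
proof (cases "multiplier m")
  case True
  then obtain B where B: "m \<in> borel_measurable lebesgue" "\<And>x. cmod (m x) \<le> B" by (auto simp: multiplier_def)
  show ?thesis
  proof (rule bounded_linear_intro)
    fix x y c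
    obtain u where u: "x = cls u" "u \<in> L2 UNIV" by (rule cls_cases)
    obtain v where v: "y = cls v" "v \<in> L2 UNIV" by (rule cls_cases)
    show "mult_l2 m (x + y) = mult_l2 m x + mult_l2 m y"
      using u v True by (simp add: cls_add mult_l2_cls multiplier_L2 L2_add distrib_left)
    have "(\<lambda>x. c *\<^sub>R u x) \<in> L2 UNIV" using u by (simp add: scaleR_conv_of_real L2_scale)
    then show "mult_l2 m (c *\<^sub>R x) = c *\<^sub>R mult_l2 m x"
      using u True by (simp add: cls_scaleR mult_l2_cls multiplier_L2)
    show "norm (mult_l2 m x) \<le> norm x * B" for x using norm_mult_l2[OF B] by (simp add: mult.commute)
  qed
next
  case False
  have "mult_l2 m x = 0" for x
  proof -
    obtain u where u: "x = cls u" "u \<in> L2 UNIV" by (rule cls_cases)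
    then show ?thesis using False by (simp add: mult_l2.abs_eq cls_zero)
  qed
  then have "mult_l2 m = (\<lambda>x. 0)" by auto
  then show ?thesis by simp
qed

section \<open>Primitives of locally integrable functions\<close>

text \<open>Absolute continuity, stated through the fundamental theorem of calculus instead of differentiability almost
everywhere.\<close>
definition primitive :: "(real \<Rightarrow> complex) \<Rightarrow> (real \<Rightarrow> complex) \<Rightarrow> bool" where
  "primitive F f \<longleftrightarrow> (\<forall>x y. x \<le> y \<longrightarrow> f absolutely_integrable_on {x..y} \<and> F y - F x = integral {x..y} f)"

lemma primitive_integrable: "primitive F f \<Longrightarrow> f absolutely_integrable_on {x..y}"
  unfolding primitive_def by (cases "x \<le> y") (auto simp: absolutely_integrable_on_def)

lemma primitive_diff: "primitive F f \<Longrightarrow> x \<le> y \<Longrightarrow> F y - F x = integral {x..y} f"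
  unfolding primitive_def by blast

lemma primitiveI:
  assumes "\<And>x y. x \<le> y \<Longrightarrow> f absolutely_integrable_on {x..y}"
    "\<And>x y. x \<le> y \<Longrightarrow> F y - F x = integral {x..y} f"
  shows "primitive F f"
  using assms unfolding primitive_def by blast

lemma absolutely_integrable_integrable: "(f :: real \<Rightarrow> complex) absolutely_integrable_on S \<Longrightarrow> f integrable_on S"
  by (rule set_lebesgue_integral_eq_integral(1))

lemma primitive_continuous:
  assumes "primitive F f"
  shows "continuous_on UNIV F"
proof -
  have "isCont F x" for x
  proof -
    have eq: "F (x - 1) + integral {x - 1..y} f = F y" if "y \<in> {x - 1..x + 1}" for y
      using primitive_diff[OF assms, of "x - 1" y] that by (simp add: algebra_simps)
    have "continuous_on {x - 1..x + 1} (\<lambda>y. F (x - 1) + integral {x - 1..y} f)"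
      using primitive_integrable[OF assms] absolutely_integrable_integrable
      by (intro continuous_intros indefinite_integral_continuous_1) blast
    then have "continuous_on {x - 1..x + 1} F"
      by (rule continuous_on_eq) (rule eq)
    then show ?thesis
      by (rule continuous_on_interior) (simp add: interior_atLeastAtMost_real)
  qed
  then show ?thesis by (simp add: continuous_at_imp_continuous_on)
qed

lemma primitive_const: "primitive (\<lambda>x. c) (\<lambda>x. 0)"
  by (rule primitiveI) (auto simp: set_integrable_def)

lemma primitive_add:
  assumes "primitive F f" "primitive G g"
  shows "primitive (\<lambda>x. F x + G x) (\<lambda>x. f x + g x)"
proof (rule primitiveI)
  fix x y :: real assume xy: "x \<le> y"
  note i = primitive_integrable[OF assms(1), of x y] primitive_integrable[OF assms(2), of x y]
  show "(\<lambda>x. f x + g x) absolutely_integrable_on {x..y}"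
    using i by (rule set_integral_add)
  have "integral {x..y} (\<lambda>x. f x + g x) = integral {x..y} f + integral {x..y} g"
    using i by (intro Henstock_Kurzweil_Integration.integral_add absolutely_integrable_integrable)
  then show "F y + G y - (F x + G x) = integral {x..y} (\<lambda>x. f x + g x)"
    using primitive_diff[OF assms(1) xy] primitive_diff[OF assms(2) xy] by (simp add: algebra_simps)
qed

lemma primitive_scale:
  assumes "primitive F f"
  shows "primitive (\<lambda>x. c * F x) (\<lambda>x. c * f x)"
proof (rule primitiveI)
  fix x y :: real assume xy: "x \<le> y"
  note i = primitive_integrable[OF assms(1), of x y]
  show "(\<lambda>x. c * f x) absolutely_integrable_on {x..y}"
    using i by (intro set_integrable_mult_right) auto
  have "integral {x..y} (\<lambda>x. c * f x) = c * integral {x..y} f" by simp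
  then show "c * F y - c * F x = integral {x..y} (\<lambda>x. c * f x)"
    using primitive_diff[OF assms(1) xy] by (simp add: algebra_simps flip: right_diff_distrib)
qed

lemma primitive_uminus: "primitive F f \<Longrightarrow> primitive (\<lambda>x. - F x) (\<lambda>x. - f x)"
  using primitive_scale[of F f "-1"] by simp

lemma primitive_minus: "primitive F f \<Longrightarrow> primitive G g \<Longrightarrow> primitive (\<lambda>x. F x - G x) (\<lambda>x. f x - g x)"
  using primitive_add[OF _ primitive_uminus, of F f G g] by simp

lemma primitive_cnj:
  assumes "primitive F f"
  shows "primitive (\<lambda>x. cnj (F x)) (\<lambda>x. cnj (f x))"
proof (rule primitiveI)
  fix x y :: real assume xy: "x \<le> y"
  note i = primitive_integrable[OF assms(1), of x y]
  show "(\<lambda>x. cnj (f x)) absolutely_integrable_on {x..y}"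
    using absolutely_integrable_linear[OF i bounded_linear_cnj] by (simp add: o_def)
  show "cnj (F y) - cnj (F x) = integral {x..y} (\<lambda>x. cnj (f x))"
    using primitive_diff[OF assms(1) xy] integral_linear[OF absolutely_integrable_integrable[OF i] bounded_linear_cnj]
    by (simp add: o_def flip: complex_cnj_diff)
qed

lemma primitive_shift:
  assumes "primitive F f"
  shows "primitive (\<lambda>x. F (x + c)) (\<lambda>x. f (x + c))"
proof (rule primitiveI)
  fix x y :: real assume xy: "x \<le> y"
  show "(\<lambda>x. f (x + c)) absolutely_integrable_on {x..y}"
    using primitive_integrable[OF assms(1), of "x + c" "y + c"]
      integrable_shift_real_ivl[of f "x + c" "y + c" c]
      integrable_shift_real_ivl[of "\<lambda>x. norm (f x)" "x + c" "y + c" c]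
    by (simp add: absolutely_integrable_on_def)
  show "F (y + c) - F (x + c) = integral {x..y} (\<lambda>x. f (x + c))"
    using primitive_diff[OF assms(1), of "x + c" "y + c"] xy
      integral_shift_real_ivl[of "x + c" c "y + c" f] by simp
qed

lemma primitive_ae_cong:
  assumes "primitive F f" "AE x in lebesgue. f x = g x"
  shows "primitive F g"
proof -
  obtain N where N: "negligible N" "\<And>x. x \<notin> N \<Longrightarrow> f x = g x"
    using assms(2) unfolding eventually_ae_filter negligible_iff_null_sets by auto
  show ?thesis
  proof (rule primitiveI)
    fix x y :: real assume xy: "x \<le> y"
    show "g absolutely_integrable_on {x..y}"
      by (rule absolutely_integrable_spike[OF primitive_integrable[OF assms(1)] N(1)]) (use N(2) in auto)
    show "F y - F x = integral {x..y} g"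
      unfolding primitive_diff[OF assms(1) xy] by (rule integral_spike[OF N(1)]) (use N(2) in auto)
  qed
qed

lemma primitive_C1:
  assumes "\<And>x. (F has_vector_derivative f x) (at x)" "continuous_on UNIV f"
  shows "primitive F f"
proof (rule primitiveI)
  fix x y :: real assume xy: "x \<le> y"
  show "f absolutely_integrable_on {x..y}"
    using assms(2) continuous_on_subset by (intro absolutely_integrable_continuous_real) blast
  have "(f has_integral F y - F x) {x..y}"
    using xy assms(1) by (intro fundamental_theorem_of_calculus) (auto intro: has_vector_derivative_at_within)
  then show "F y - F x = integral {x..y} f" by (simp add: integral_unique)
qed

lemma absolutely_integrable_mult_continuous:
  fixes f g :: "real \<Rightarrow> complex"
  assumes "f absolutely_integrable_on {x..y}" "continuous_on {x..y} g"
  shows "(\<lambda>t. g t * f t) absolutely_integrable_on {x..y}"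
proof (rule absolutely_integrable_bounded_measurable_product[of "(*)"])
  show "bilinear ((*) :: complex \<Rightarrow> complex \<Rightarrow> complex)"
    by (auto simp: bilinear_def intro!: linearI simp: algebra_simps)
  show "g \<in> borel_measurable (lebesgue_on {x..y})"
    using assms(2) by (intro continuous_imp_measurable_on_sets_lebesgue) auto
  show "bounded (g ` {x..y})"
    using assms(2) compact_continuous_image compact_imp_bounded by blast
qed (use assms in auto)

text \<open>The defect of the formula is additive over adjacent intervals, and on a short interval it is at most the
oscillation of $F$ and $G$ times $\int (|f|+|g|)$. Bisection (\<open>Bolzano\<close>) makes it at most $e$
times that integral on every interval, hence zero.\<close>
lemma primitive_mult:
  assumes F: "primitive F f" and G: "primitive G g"
  shows "primitive (\<lambda>x. F x * G x) (\<lambda>x. G x * f x + F x * g x)"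
proof -
  have cF: "continuous_on A F" and cG: "continuous_on A G" for A
    using primitive_continuous[OF F] primitive_continuous[OF G] continuous_on_subset by blast+
  have iGf: "(\<lambda>t. G t * f t) absolutely_integrable_on {x..y}" for x y
    by (rule absolutely_integrable_mult_continuous[OF primitive_integrable[OF F] cG])
  have iFg: "(\<lambda>t. F t * g t) absolutely_integrable_on {x..y}" for x y
    by (rule absolutely_integrable_mult_continuous[OF primitive_integrable[OF G] cF])
  have i: "(\<lambda>t. G t * f t + F t * g t) absolutely_integrable_on {x..y}" for x y
    using iGf iFg by (rule set_integral_add)
  let ?h = "\<lambda>t. G t * f t + F t * g t"
  let ?\<mu> = "\<lambda>x y. integral {x..y} (\<lambda>t. norm (f t) + norm (g t))"
  have in1: "(\<lambda>t. norm (f t)) integrable_on {x..y}" "(\<lambda>t. norm (g t)) integrable_on {x..y}" for x y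
    using primitive_integrable[OF F] primitive_integrable[OF G] by (auto simp: absolutely_integrable_on_def)
  have in2: "(\<lambda>t. norm (f t) + norm (g t)) integrable_on {x..y}" for x y
    using in1 by (intro integrable_add)
  have main: "norm (F y * G y - F x * G x - integral {x..y} ?h) \<le> e * ?\<mu> x y" if "x \<le> y" "0 < e" for x y e
    using that(1)
  proof (rule Bolzano)
    fix a b c :: real
    let ?P = "\<lambda>x y. norm (F y * G y - F x * G x - integral {x..y} ?h) \<le> e * ?\<mu> x y"
    assume P: "?P a b" "?P b c" and abc: "a \<le> b" "b \<le> c"
    have "integral {a..b} ?h + integral {b..c} ?h = integral {a..c} ?h"
      by (rule Henstock_Kurzweil_Integration.integral_combine[OF abc absolutely_integrable_integrable[OF i]])
    then have eq: "F c * G c - F a * G a - integral {a..c} ?h =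
      (F b * G b - F a * G a - integral {a..b} ?h) + (F c * G c - F b * G b - integral {b..c} ?h)"
      by (simp add: algebra_simps)
    have "norm (F c * G c - F a * G a - integral {a..c} ?h) \<le> e * ?\<mu> a b + e * ?\<mu> b c"
      unfolding eq by (rule norm_triangle_mono[OF P])
    also have "\<dots> = e * ?\<mu> a c"
      using Henstock_Kurzweil_Integration.integral_combine[OF abc in2] by (simp flip: distrib_left)
    finally show "?P a c" .
  next
    fix z :: real
    have "isCont F z" "isCont G z" using cF[of UNIV] cG[of UNIV] by (simp_all add: continuous_on_eq_continuous_at)
    then obtain d1 d2 where d: "d1 > 0" "d2 > 0"
      "\<And>t. \<bar>t - z\<bar> < d1 \<Longrightarrow> norm (F t - F z) < e/2" "\<And>t. \<bar>t - z\<bar> < d2 \<Longrightarrow> norm (G t - G z) < e/2"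
      using \<open>0 < e\<close> unfolding continuous_at_eps_delta
      by (metis dist_norm half_gt_zero real_norm_def)
    show "\<exists>d>0. \<forall>a b. a \<le> z \<and> z \<le> b \<and> b - a < d \<longrightarrow>
        norm (F b * G b - F a * G a - integral {a..b} ?h) \<le> e * ?\<mu> a b"
    proof (intro exI[of _ "min d1 d2"] conjI allI impI)
      fix a b assume ab: "a \<le> z \<and> z \<le> b \<and> b - a < min d1 d2"
      then have le: "a \<le> b" by simp
      have near: "norm (F t - F s) \<le> e" "norm (G t - G s) \<le> e" if "t \<in> {a..b}" "s \<in> {a..b}" for t s
      proof -
        have "\<bar>t - z\<bar> < d1" "\<bar>s - z\<bar> < d1" "\<bar>t - z\<bar> < d2" "\<bar>s - z\<bar> < d2" using that ab by auto
        then have "norm (F t - F z) < e/2" "norm (F s - F z) < e/2" "norm (G t - G z) < e/2" "norm (G s - G z) < e/2"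
          using d by blast+
        then show "norm (F t - F s) \<le> e" "norm (G t - G s) \<le> e"
          using norm_triangle_ineq4[of "F t - F z" "F s - F z"] norm_triangle_ineq4[of "G t - G z" "G s - G z"] by simp_all
      qed
      have I1: "integral {a..b} (\<lambda>t. G b * f t) = G b * (F b - F a)"
        and I2: "integral {a..b} (\<lambda>t. F a * g t) = F a * (G b - G a)"
        using primitive_diff[OF F le] primitive_diff[OF G le] by simp_all
      have i1: "(\<lambda>t. G b * f t) integrable_on {a..b}" "(\<lambda>t. F a * g t) integrable_on {a..b}"
        using absolutely_integrable_integrable[OF primitive_integrable[OF F]] absolutely_integrable_integrable[OF primitive_integrable[OF G]]
        by (simp_all add: integrable_on_mult_right)
      have "F b * G b - F a * G a - integral {a..b} ?h
        = integral {a..b} (\<lambda>t. G b * f t) + integral {a..b} (\<lambda>t. F a * g t) - integral {a..b} ?h"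
        unfolding I1 I2 by (simp add: algebra_simps)
      also have "\<dots> = integral {a..b} (\<lambda>t. G b * f t + F a * g t - ?h t)"
        using i1 absolutely_integrable_integrable[OF i] absolutely_integrable_integrable[OF iGf] absolutely_integrable_integrable[OF iFg]
        by (simp add: Henstock_Kurzweil_Integration.integral_add Henstock_Kurzweil_Integration.integral_diff integrable_add)
      also have "norm \<dots> \<le> integral {a..b} (\<lambda>t. e * (norm (f t) + norm (g t)))"
      proof (rule Henstock_Kurzweil_Integration.integral_norm_bound_integral)
        show "(\<lambda>t. G b * f t + F a * g t - ?h t) integrable_on {a..b}"
          by (rule integrable_diff[OF integrable_add[OF i1] absolutely_integrable_integrable[OF i]])
        show "(\<lambda>t. e * (norm (f t) + norm (g t))) integrable_on {a..b}"
          using in2 by (rule integrable_on_mult_right)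
        fix t assume t: "t \<in> {a..b}"
        have "G b * f t + F a * g t - ?h t = (G b - G t) * f t + (F a - F t) * g t" by (simp add: algebra_simps)
        also have "norm \<dots> \<le> e * norm (f t) + e * norm (g t)"
          using near[of b t] near[of a t] t le
          by (intro norm_triangle_mono) (auto simp: norm_mult intro!: mult_right_mono)
        finally show "norm (G b * f t + F a * g t - ?h t) \<le> e * (norm (f t) + norm (g t))"
          by (simp add: distrib_left)
      qed
      also have "\<dots> = e * ?\<mu> a b" by simp
      finally show "norm (F b * G b - F a * G a - integral {a..b} ?h) \<le> e * ?\<mu> a b" .
    qed (use d in auto)
  qed
  show ?thesis
  proof (rule primitiveI)
    fix x y :: real assume xy: "x \<le> y"
    show "?h absolutely_integrable_on {x..y}" by (rule i)
    have "norm (F y * G y - F x * G x - integral {x..y} ?h) \<le> 0"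
    proof (rule field_le_epsilon)
      fix e :: real assume e: "e > 0"
      have pos: "?\<mu> x y \<ge> 0" using in2 by (intro integral_nonneg) auto
      have "norm (F y * G y - F x * G x - integral {x..y} ?h) \<le> e / (?\<mu> x y + 1) * ?\<mu> x y"
        using pos e by (intro main[OF xy]) auto
      also have "\<dots> \<le> e" using pos e by (simp add: field_simps)
      finally show "norm (F y * G y - F x * G x - integral {x..y} ?h) \<le> 0 + e" by simp
    qed
    then show "F y * G y - F x * G x = integral {x..y} ?h" by simp
  qed
qed

lemma primitive_piecewise:
  assumes "continuous_on UNIV F" "\<And>x y. finite {t \<in> {x..y}. \<not> (F has_vector_derivative f t) (at t)}"
    "f \<in> borel_measurable lebesgue" "\<And>t. norm (f t) \<le> B"
  shows "primitive F f"
proof (rule primitiveI)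
  fix x y :: real assume xy: "x \<le> y"
  show "f absolutely_integrable_on {x..y}"
  proof (rule measurable_bounded_by_integrable_imp_absolutely_integrable)
    show "f \<in> borel_measurable (lebesgue_on {x..y})" using assms(3) by (simp add: measurable_restrict_space1)
    show "(\<lambda>t. B) integrable_on {x..y}" by (rule integrable_const_ivl)
  qed (use assms in auto)
  have "(f has_integral F y - F x) {x..y}"
    by (rule fundamental_theorem_of_calculus_interior_strong[OF assms(2)[of x y] xy])
      (use assms(1) in \<open>auto intro: continuous_on_subset\<close>)
  then show "F y - F x = integral {x..y} f" by (simp add: integral_unique)
qed

section \<open>Smooth bump functions\<close>

text \<open>Each derivative of $e^{-1/x}$, extended by zero to the left half line, is a combination of these functions, so
smoothness follows from a single differentiation rule.\<close>
definition psi :: "nat \<Rightarrow> real \<Rightarrow> real" where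
  "psi k x = (if x \<le> 0 then 0 else (1 / x) ^ k * exp (- (1 / x)))"

lemma psi_has_derivative: "(psi k has_real_derivative (psi (k + 2) x - real k * psi (k + 1) x)) (at x)"
proof -
  consider "x < 0" | "x = 0" | "x > 0" by linarith
  then show ?thesis
  proof cases
    case 1
    have "((\<lambda>x. 0) has_real_derivative 0) (at x)" by simp
    then have "(psi k has_real_derivative 0) (at x)"
      by (rule has_field_derivative_transform_within_open[of _ _ _ "{..<0}"]) (use 1 in \<open>auto simp: psi_def\<close>)
    then show ?thesis using 1 by (simp add: psi_def)
  next
    case 2
    have "((\<lambda>t::real. t ^ (k + 1) / exp t) \<longlongrightarrow> 0) at_top" by (rule tendsto_power_div_exp_0)
    then have "((\<lambda>h::real. (inverse h) ^ (k + 1) / exp (inverse h)) \<longlongrightarrow> 0) (at_right 0)"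
      by (rule filterlim_compose[OF _ filterlim_inverse_at_top_right])
    then have "((\<lambda>h. (psi k h - psi k 0) / (h - 0)) \<longlongrightarrow> 0) (at_right 0)"
      by (rule Lim_transform_eventually)
        (auto simp: eventually_at_right_field psi_def exp_minus field_simps intro!: exI[of _ 1])
    moreover have "((\<lambda>h. (psi k h - psi k 0) / (h - 0)) \<longlongrightarrow> 0) (at_left 0)"
      by (rule Lim_transform_eventually[OF tendsto_const])
        (auto simp: eventually_at_left_field psi_def intro!: exI[of _ "-1"])
    ultimately have "((\<lambda>h. (psi k h - psi k 0) / (h - 0)) \<longlongrightarrow> 0) (at 0)"
      by (rule filterlim_split_at[rotated])
    then show ?thesis using 2 by (simp add: psi_def has_field_derivative_iff)
  next
    case 3
    have "((\<lambda>x. (1 / x) ^ k * exp (- (1 / x))) has_real_derivative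
        (psi (k + 2) x - real k * psi (k + 1) x)) (at x)"
    proof -
      have d1: "((\<lambda>x. 1 / x) has_real_derivative - ((1 / x)\<^sup>2)) (at x)"
        using 3 by (auto intro!: derivative_eq_intros simp: power2_eq_square)
      have d2: "((\<lambda>x. exp (- (1 / x))) has_real_derivative exp (- (1 / x)) * (1 / x)\<^sup>2) (at x)"
        using 3 by (auto intro!: derivative_eq_intros simp: power2_eq_square)
      show ?thesis
        by (rule DERIV_cong[OF DERIV_mult[OF DERIV_power[OF d1] d2]])
          (use 3 in \<open>cases k; simp add: psi_def power2_eq_square field_simps\<close>)
    qed
    then show ?thesis
      by (rule has_field_derivative_transform_within_open[of _ _ _ "{0<..}"]) (use 3 in \<open>auto simp: psi_def\<close>)
  qed
qed

text \<open>An algebra that contains all functions \<open>psi k\<close> and is closed under differentiation. Membership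
therefore proves that a function is smooth, without a product rule for higher derivatives.\<close>
inductive_set psi_alg :: "(real \<Rightarrow> real) set" where
  psi: "psi k \<in> psi_alg"
| const: "(\<lambda>x. c) \<in> psi_alg"
| add: "f \<in> psi_alg \<Longrightarrow> g \<in> psi_alg \<Longrightarrow> (\<lambda>x. f x + g x) \<in> psi_alg"
| mult: "f \<in> psi_alg \<Longrightarrow> g \<in> psi_alg \<Longrightarrow> (\<lambda>x. f x * g x) \<in> psi_alg"
| affine: "f \<in> psi_alg \<Longrightarrow> (\<lambda>x. f (a * x + b)) \<in> psi_alg"

lemma psi_alg_deriv: "f \<in> psi_alg \<Longrightarrow> \<exists>f'\<in>psi_alg. \<forall>x. (f has_real_derivative f' x) (at x)"
proof (induction rule: psi_alg.induct)
  case (psi k)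
  have "(\<lambda>x. psi (k + 2) x + (- real k) * psi (k + 1) x) \<in> psi_alg"
    by (intro psi_alg.intros)
  then show ?case using psi_has_derivative[of k] by (intro bexI) auto
next
  case (const c)
  then show ?case by (intro bexI[OF _ psi_alg.const[of 0]]) auto
next
  case (add f g)
  then obtain f' g' where "f' \<in> psi_alg" "g' \<in> psi_alg"
    "\<And>x. (f has_real_derivative f' x) (at x)" "\<And>x. (g has_real_derivative g' x) (at x)" by blast
  then show ?case by (intro bexI[OF _ psi_alg.add[of f' g']]) (auto intro: DERIV_add)
next
  case (mult f g)
  then obtain f' g' where *: "f' \<in> psi_alg" "g' \<in> psi_alg"
    "\<And>x. (f has_real_derivative f' x) (at x)" "\<And>x. (g has_real_derivative g' x) (at x)" by blast
  have "(\<lambda>x. f' x * g x + g' x * f x) \<in> psi_alg"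
    using mult.hyps * by (intro psi_alg.intros)
  then show ?case using * by (intro bexI[of _ "\<lambda>x. f' x * g x + g' x * f x"]) (auto intro: DERIV_mult)
next
  case (affine f a b)
  then obtain f' where *: "f' \<in> psi_alg" "\<And>x. (f has_real_derivative f' x) (at x)" by blast
  have "((\<lambda>x. f (a * x + b)) has_real_derivative f' (a * x + b) * a) (at x)" for x
    by (rule DERIV_chain2[OF *(2)]) (auto intro!: derivative_eq_intros)
  moreover have "(\<lambda>x. f' (a * x + b) * a) \<in> psi_alg"
    using * by (intro psi_alg.intros)
  ultimately show ?case by (intro bexI[of _ "\<lambda>x. f' (a * x + b) * a"]) auto
qed

lemma psi_alg_higher_deriv: "f \<in> psi_alg \<Longrightarrow> (deriv ^^ k) f \<in> psi_alg"
proof (induction k arbitrary: f)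
  case (Suc k)
  obtain f' where f': "f' \<in> psi_alg" "\<And>x. (f has_real_derivative f' x) (at x)"
    using psi_alg_deriv[OF Suc.prems] by blast
  then have "deriv f = f'" by (auto intro: DERIV_imp_deriv)
  then show ?case using Suc.IH[OF f'(1)] by (simp only: funpow_Suc_right o_apply)
qed simp

lemma psi_alg_differentiable: "f \<in> psi_alg \<Longrightarrow> (deriv ^^ k) f differentiable (at x)"
  using psi_alg_deriv[OF psi_alg_higher_deriv] real_differentiable_def by blast

lemma psi_alg_continuous: "f \<in> psi_alg \<Longrightarrow> continuous_on A f"
  using psi_alg_differentiable[of f 0]
  by (auto intro!: continuous_at_imp_continuous_on differentiable_imp_continuous_within)

text \<open>As $n$ grows, this tends to the indicator function of the open interval from $c$ to $d$.\<close>
definition bump :: "real \<Rightarrow> real \<Rightarrow> nat \<Rightarrow> real \<Rightarrow> real" where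
  "bump c d n x = psi 0 (real n * (x - c)) * psi 0 (real n * (d - x))"

lemma bump_psi_alg: "bump c d n \<in> psi_alg"
proof -
  have "(\<lambda>x. psi 0 (real n * x + (- real n * c)) * psi 0 (- real n * x + real n * d)) \<in> psi_alg"
    by (intro psi_alg.intros psi_alg.affine[OF psi_alg.psi])
  then show ?thesis by (simp add: bump_def[abs_def] algebra_simps)
qed

lemma bump_bounds: "0 \<le> bump c d n x" "bump c d n x \<le> 1"
proof -
  have "0 \<le> psi 0 y" "psi 0 y \<le> 1" for y by (auto simp: psi_def)
  then show "0 \<le> bump c d n x" "bump c d n x \<le> 1"
    by (auto simp: bump_def intro: mult_le_one)
qed

lemma bump_outside: "x \<notin> {c<..<d} \<Longrightarrow> bump c d n x = 0"
  by (auto simp: bump_def psi_def mult_le_0_iff zero_le_mult_iff)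

lemma bump_tendsto:
  assumes "x \<in> {c<..<d}"
  shows "(\<lambda>n. bump c d n x) \<longlonglongrightarrow> 1"
proof -
  have *: "(\<lambda>n. psi 0 (real n * y)) \<longlonglongrightarrow> 1" if "y > 0" for y
  proof -
    have "(\<lambda>n. exp (- (1 / y * (1 / real n)))) \<longlonglongrightarrow> exp (- (1 / y * 0))"
      by (intro tendsto_intros lim_1_over_n)
    moreover have "\<forall>\<^sub>F n in sequentially. exp (- (1 / y * (1 / real n))) = psi 0 (real n * y)"
      using eventually_gt_at_top[of 0] 
      by eventually_elim (use that in \<open>auto simp: psi_def mult_le_0_iff field_simps\<close>)
    ultimately show ?thesis by (simp add: Lim_transform_eventually)
  qed
  have "(\<lambda>n. psi 0 (real n * (x - c)) * psi 0 (real n * (d - x))) \<longlonglongrightarrow> 1 * 1"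
    using assms by (intro tendsto_mult *) auto
  then show ?thesis by (simp add: bump_def)
qed

lemma test_function_bump: "{c..d} \<subseteq> S \<Longrightarrow> test_function S (bump c d n)"
  unfolding test_function_def
  using psi_alg_differentiable[OF bump_psi_alg] bump_outside
  by (intro conjI allI exI[of _ "{c..d}"]) (auto simp: compact_Icc)

section \<open>Test functions and weak derivatives\<close>

lemma test_function_continuous:
  assumes "test_function S \<phi>"
  shows "continuous_on A \<phi>" "continuous_on A (deriv \<phi>)"
    "(\<phi> has_real_derivative deriv \<phi> x) (at x)"
proof -
  have d: "(deriv ^^ k) \<phi> differentiable (at x)" for k x using assms by (auto simp: test_function_def)
  show "continuous_on A \<phi>" "continuous_on A (deriv \<phi>)"
    using d[of 0] d[of 1] by (auto intro!: continuous_at_imp_continuous_on differentiable_imp_continuous_within)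
  show "(\<phi> has_real_derivative deriv \<phi> x) (at x)"
    using d[of 0 x] DERIV_deriv_iff_real_differentiable by auto
qed

lemma test_function_support:
  assumes "test_function S \<phi>"
  obtains K where "compact K" "K \<subseteq> S" "\<And>x k. x \<notin> K \<Longrightarrow> (deriv ^^ k) \<phi> x = 0"
proof -
  obtain K where K: "compact K" "K \<subseteq> S" "\<And>x. x \<notin> K \<Longrightarrow> \<phi> x = 0"
    using assms by (auto simp: test_function_def)
  have "open (- K)" using K(1) by (simp add: compact_imp_closed open_Compl)
  have "(deriv ^^ k) \<phi> x = 0" if "x \<notin> K" for x k
    using that
  proof (induction k arbitrary: x)
    case 0 then show ?case using K by simp
  next
    case (Suc k)
    have "((\<lambda>x. 0) has_real_derivative 0) (at x)" by simp
    then have "((deriv ^^ k) \<phi> has_real_derivative 0) (at x)"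
      using \<open>open (- K)\<close> by (rule has_field_derivative_transform_within_open) (use Suc in auto)
    then show ?case by (simp add: DERIV_imp_deriv)
  qed
  with K show ?thesis using that by blast
qed

lemma test_function_deriv: 
  assumes "test_function S \<phi>" shows "test_function S (deriv \<phi>)"
proof -
  obtain K where K: "compact K" "K \<subseteq> S" "\<And>x k. x \<notin> K \<Longrightarrow> (deriv ^^ k) \<phi> x = 0"
    using test_function_support[OF assms] by blast
  have "(deriv ^^ k) (deriv \<phi>) differentiable (at x)" for k x
    using assms by (metis test_function_def funpow_Suc_right o_apply)
  moreover have "\<forall>x. x \<notin> K \<longrightarrow> deriv \<phi> x = 0" using K(3)[of _ 1] by simp
  ultimately show ?thesis using K(1,2) unfolding test_function_def by blast
qed

lemma test_function_mono: "test_function S \<phi> \<Longrightarrow> S \<subseteq> T \<Longrightarrow> test_function T \<phi>"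
  unfolding test_function_def by (meson order_trans)

lemma locally_integrableI:
  fixes f :: "real \<Rightarrow> complex"
  assumes "\<And>x y. f absolutely_integrable_on {x..y}"
  shows "locally_integrable S f"
  unfolding locally_integrable_def
proof (intro allI impI)
  fix K :: "real set" assume K: "compact K \<and> K \<subseteq> S"
  then obtain a where "K \<subseteq> cbox (-a) a" using bounded_subset_cbox_symmetric compact_imp_bounded by blast
  moreover have "K \<in> sets lebesgue" using K by (simp add: borel_compact)
  ultimately show "f absolutely_integrable_on K"
    by (intro set_integrable_subset[OF assms[of "-a" a]]) auto
qed

text \<open>Reduces an integral over \<open>S\<close> to a compact interval, on which a locally integrable function is
integrable.\<close>
lemma test_integral:
  fixes g :: "real \<Rightarrow> complex" and \<phi> :: "real \<Rightarrow> real"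
  assumes "g absolutely_integrable_on {c..d}" "continuous_on {c..d} \<phi>" "{c..d} \<subseteq> S" "S \<in> sets lebesgue"
    "\<And>x. x \<notin> {c..d} \<Longrightarrow> \<phi> x = 0"
  shows "integrable (lebesgue_on S) (\<lambda>x. of_real (\<phi> x) * g x)"
    and "(LINT x|lebesgue_on S. of_real (\<phi> x) * g x) = integral {c..d} (\<lambda>x. of_real (\<phi> x) * g x)"
proof -
  have "continuous_on {c..d} (\<lambda>x. complex_of_real (\<phi> x))" using assms(2) by (intro continuous_intros)
  from absolutely_integrable_mult_continuous[OF assms(1) this]
  have ai: "set_integrable lebesgue {c..d} (\<lambda>x. of_real (\<phi> x) * g x)" .
  have eq: "(\<lambda>x. indicator S x *\<^sub>R (of_real (\<phi> x) * g x)) = (\<lambda>x. indicator {c..d} x *\<^sub>R (of_real (\<phi> x) * g x))"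
    using assms(3,5) by (auto simp: indicator_def fun_eq_iff)
  show "integrable (lebesgue_on S) (\<lambda>x. of_real (\<phi> x) * g x)"
    using ai eq assms(4) by (simp add: integrable_restrict_space set_integrable_def)
  have "(LINT x|lebesgue_on S. of_real (\<phi> x) * g x) = (LINT x:{c..d}|lebesgue. of_real (\<phi> x) * g x)"
    using eq assms(4) by (simp add: integral_restrict_space set_lebesgue_integral_def)
  then show "(LINT x|lebesgue_on S. of_real (\<phi> x) * g x) = integral {c..d} (\<lambda>x. of_real (\<phi> x) * g x)"
    using set_lebesgue_integral_eq_integral(2)[OF ai] by simp
qed

text \<open>By Lebesgue's differentiation theorem a function is almost everywhere the limit of its means.\<close>
lemma zero_ae_of_zero_integrals:
  fixes v :: "real \<Rightarrow> complex"
  assumes "v absolutely_integrable_on {c..d}"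
    and "\<And>x y. c \<le> x \<Longrightarrow> x \<le> y \<Longrightarrow> y \<le> d \<Longrightarrow> integral {x..y} v = 0"
  shows "AE x in lebesgue. x \<in> {c<..<d} \<longrightarrow> v x = 0"
proof -
  define f where "f x = (if x \<in> {c..d} then v x else 0)" for x
  have "f integrable_on cbox a b" for a b :: real
  proof -
    have "v integrable_on {max c a..min d b}"
      using assms(1) absolutely_integrable_integrable integrable_on_subinterval by (metis atLeastatMost_subset_iff max.cobounded1 min.cobounded1)
    moreover have "{c..d} \<inter> cbox a b = {max c a..min d b}" by auto
    ultimately show ?thesis using integrable_restrict_Int[of "{c..d}" v "cbox a b"] unfolding f_def by metis
  qed
  then obtain N where N: "negligible N" "\<And>x e. x \<notin> N \<Longrightarrow> 0 < e \<Longrightarrow>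
      \<exists>d>0. \<forall>h. 0 < h \<and> h < d \<longrightarrow> norm (integral (cbox x (x + h *\<^sub>R One)) f /\<^sub>R h ^ DIM(real) - f x) < e"
    using integrable_ccontinuous_explicit[of f] by metis
  have "v x = 0" if x: "x \<notin> N" "x \<in> {c<..<d}" for x
  proof -
    have "norm (v x) < e" if e: "e > 0" for e
    proof -
      obtain \<delta> where \<delta>: "\<delta> > 0" "\<And>h. 0 < h \<Longrightarrow> h < \<delta> \<Longrightarrow> norm (integral {x..x + h} f /\<^sub>R h - f x) < e"
        using N(2)[OF x(1) e] by auto
      define h where "h = min (\<delta> / 2) (d - x)"
      have h: "0 < h" "h < \<delta>" "x + h \<le> d" using \<delta>(1) x(2) by (auto simp: h_def)
      have "integral {x..x + h} f = integral {x..x + h} v"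
        using x(2) h by (intro Henstock_Kurzweil_Integration.integral_cong) (auto simp: f_def)
      also have "\<dots> = 0" using x(2) h by (intro assms(2)) auto
      finally show ?thesis using \<delta>(2)[OF h(1,2)] x(2) by (simp add: f_def)
    qed
    then show ?thesis by (metis norm_eq_zero norm_ge_zero less_irrefl order_le_less)
  qed
  then show ?thesis
    using N(1) unfolding negligible_iff_null_sets by (intro AE_I'[of N]) auto
qed

text \<open>The bumps tend boundedly to indicator functions of intervals, so the integral of \<open>v\<close> over each
interval in \<open>S\<close> vanishes. Countably many rational intervals cover \<open>S\<close>.\<close>
lemma zero_ae_of_bumps:
  assumes "open S" "locally_integrable S v"
    and zero: "\<And>c d n. c < d \<Longrightarrow> {c..d} \<subseteq> S \<Longrightarrow> (LINT x|lebesgue_on S. of_real (bump c d n x) * v x) = 0"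
  shows "ae_eq S v (\<lambda>x. 0)"
proof -
  have S: "S \<in> sets lebesgue" using assms(1) by (simp add: borel_open)
  have ai: "v absolutely_integrable_on {c..d}" if "{c..d} \<subseteq> S" for c d
    using assms(2) that by (auto simp: locally_integrable_def)
  have int0: "integral {c..d} v = 0" if cd: "{c..d} \<subseteq> S" for c d
  proof (cases "c < d")
    case True
    let ?w = "\<lambda>x. indicator {c<..<d} x *\<^sub>R v x"
    have vi: "integrable lebesgue (\<lambda>x. indicator {c..d} x *\<^sub>R v x)" using ai[OF cd] by (simp add: set_integrable_def)
    have wi: "set_integrable lebesgue {c<..<d} v" using ai[OF cd] by (rule set_integrable_subset) auto
    have "(\<lambda>n. LINT x|lebesgue. of_real (bump c d n x) * ?w x) \<longlonglongrightarrow> (LINT x|lebesgue. ?w x)"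
    proof (rule integral_dominated_convergence[where w = "\<lambda>x. norm (?w x)"])
      show "?w \<in> borel_measurable lebesgue" using wi by (auto simp: set_integrable_def)
      have "continuous_on UNIV (\<lambda>x. complex_of_real (bump c d n x))" for n
        using psi_alg_continuous[OF bump_psi_alg] by (intro continuous_intros) 
      then have "(\<lambda>x. complex_of_real (bump c d n x)) \<in> borel_measurable lebesgue" for n
        by (intro measurable_completion) (simp add: borel_measurable_continuous_onI)
      then show "(\<lambda>x. of_real (bump c d n x) * ?w x) \<in> borel_measurable lebesgue" for n
        using \<open>?w \<in> borel_measurable lebesgue\<close> by (intro borel_measurable_times)
      show "integrable lebesgue (\<lambda>x. norm (?w x))"
        using wi unfolding set_integrable_def by (rule integrable_norm)
      show "AE x in lebesgue. (\<lambda>n. of_real (bump c d n x) * ?w x) \<longlonglongrightarrow> ?w x"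
      proof (rule AE_I2)
        fix x
        show "(\<lambda>n. of_real (bump c d n x) * ?w x) \<longlonglongrightarrow> ?w x"
        proof (cases "x \<in> {c<..<d}")
          case True
          have "(\<lambda>n. of_real (bump c d n x) * ?w x) \<longlonglongrightarrow> of_real 1 * ?w x"
            by (intro tendsto_mult tendsto_of_real bump_tendsto True tendsto_const)
          then show ?thesis by simp
        qed simp
      qed
      show "AE x in lebesgue. norm (of_real (bump c d n x) * ?w x) \<le> norm (?w x)" for n
        using bump_bounds[of c d n] by (intro AE_I2) (simp add: norm_mult mult_left_le_one_le mult_left_mono)
    qed
    moreover have "(LINT x|lebesgue. of_real (bump c d n x) * ?w x) = 0" for n
    proof -
      have "(LINT x|lebesgue. of_real (bump c d n x) * ?w x)
          = (LINT x:S|lebesgue. of_real (bump c d n x) * v x)"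
        unfolding set_lebesgue_integral_def using cd bump_outside[of _ c d n]
        by (intro Bochner_Integration.integral_cong) (auto simp: indicator_def subset_iff)
      also have "\<dots> = (LINT x|lebesgue_on S. of_real (bump c d n x) * v x)"
        using S by (simp add: integral_restrict_space set_lebesgue_integral_def)
      also have "\<dots> = 0" by (rule zero[OF True cd])
      finally show ?thesis .
    qed
    ultimately have "(LINT x|lebesgue. ?w x) = 0" by (simp add: LIMSEQ_const_iff)
    then have "integral {c<..<d} v = 0"
      using set_lebesgue_integral_eq_integral(2)[OF wi] by (simp add: set_lebesgue_integral_def)
    moreover have "integral {c<..<d} v = integral {c..d} v"
      using integral_open_interval_real[of c d v] by simp
    ultimately show ?thesis by simp
  next
    case False
    then show ?thesis by (cases "c = d") auto
  qed
  have "AE x in lebesgue. \<forall>c\<in>\<rat>. \<forall>d\<in>\<rat>. {c..d} \<subseteq> S \<longrightarrow> x \<in> {c<..<d} \<longrightarrow> v x = 0"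
  proof (intro AE_ball_countable' countable_rat)
    fix c d :: real
    show "AE x in lebesgue. {c..d} \<subseteq> S \<longrightarrow> x \<in> {c<..<d} \<longrightarrow> v x = 0"
    proof (cases "{c..d} \<subseteq> S")
      case True
      have "AE x in lebesgue. x \<in> {c<..<d} \<longrightarrow> v x = 0"
      proof (rule zero_ae_of_zero_integrals[OF ai[OF True]])
        fix x y assume "c \<le> x" "x \<le> y" "y \<le> d"
        then have "{x..y} \<subseteq> S" using True by auto
        then show "integral {x..y} v = 0" by (rule int0)
      qed
      then show ?thesis by (rule eventually_mono) simp
    qed simp
  qed
  then have "AE x in lebesgue. x \<in> S \<longrightarrow> v x = 0"
  proof (rule eventually_mono, intro impI)
    fix x assume *: "\<forall>c\<in>\<rat>. \<forall>d\<in>\<rat>. {c..d} \<subseteq> S \<longrightarrow> x \<in> {c<..<d} \<longrightarrow> v x = 0" and "x \<in> S"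
    obtain e where e: "e > 0" "ball x e \<subseteq> S" using \<open>open S\<close> \<open>x \<in> S\<close> openE by blast
    obtain c where c: "c \<in> \<rat>" "x - e < c" "c < x" using Rats_dense_in_real[of "x - e" x] e by auto
    obtain d where d: "d \<in> \<rat>" "x < d" "d < x + e" using Rats_dense_in_real[of x "x + e"] e by auto
    have "{c..d} \<subseteq> ball x e" using c d by (auto simp: dist_real_def)
    then show "v x = 0" using * c d e(2) by auto
  qed
  then show ?thesis unfolding ae_eq_def using S by (simp add: AE_restrict_space_iff)
qed

lemma primitive_exists:
  fixes v :: "real \<Rightarrow> complex"
  assumes ai: "\<And>x y. v absolutely_integrable_on {x..y}"
  obtains V where "primitive V v"
proof -
  define V where "V x = (if x \<ge> 0 then integral {0..x} v else - integral {x..0} v)" for x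
  have i: "v integrable_on {x..y}" for x y using absolutely_integrable_integrable[OF ai] .
  have "V y - V x = integral {x..y} v" if xy: "x \<le> y" for x y
  proof -
    consider "0 \<le> x" | "x < 0" "0 \<le> y" | "y < 0" by linarith
    then show ?thesis
    proof cases
      case 1
      then show ?thesis
        using Henstock_Kurzweil_Integration.integral_combine[OF 1 xy i] xy by (simp add: V_def algebra_simps)
    next
      case 2
      then show ?thesis
        using Henstock_Kurzweil_Integration.integral_combine[of x 0 y v] i by (simp add: V_def algebra_simps)
    next
      case 3
      then show ?thesis
        using Henstock_Kurzweil_Integration.integral_combine[of x y 0 v] i xy by (simp add: V_def algebra_simps)
    qed
  qed
  then have "primitive V v" using ai by (intro primitiveI) auto
  then show thesis by (rule that)
qed

lemma compact_in_symmetric_interval: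
  assumes "compact (K :: real set)"
  obtains R where "R > 0" "K \<subseteq> {-R<..<R}"
proof -
  obtain B where B: "\<And>x. x \<in> K \<Longrightarrow> norm x \<le> B" 
    using compact_imp_bounded[OF assms] bounded_iff by blast
  have "x \<in> {- (\<bar>B\<bar> + 1)<..<\<bar>B\<bar> + 1}" if "x \<in> K" for x
    using B[OF that] by (auto simp: abs_le_iff)
  then show thesis by (intro that[of "\<bar>B\<bar> + 1"]) auto
qed

lemma test_function_interval:
  assumes "test_function S \<phi>"
  obtains R where "R > 0" "\<forall>x k. x \<notin> {-R<..<R} \<longrightarrow> (deriv ^^ k) \<phi> x = 0"
proof (rule test_function_support[OF assms])
  fix K assume K: "compact K" "K \<subseteq> S" "\<And>x k. x \<notin> K \<Longrightarrow> (deriv ^^ k) \<phi> x = 0"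
  obtain R where R: "R > 0" "K \<subseteq> {-R<..<R}" using compact_in_symmetric_interval[OF K(1)] .
  show thesis
  proof (rule that[OF R(1)])
    show "\<forall>x k. x \<notin> {-R<..<R} \<longrightarrow> (deriv ^^ k) \<phi> x = 0"
      using R(2) K(3) by (meson subsetD)
  qed
qed

lemma test_function_primitive:
  assumes "test_function S \<phi>"
  shows "primitive (\<lambda>x. complex_of_real (\<phi> x)) (\<lambda>x. complex_of_real (deriv \<phi> x))"
  using test_function_continuous[OF assms]
  by (intro primitive_C1 continuous_intros has_vector_derivative_of_real)
    (auto simp: has_real_derivative_iff_has_vector_derivative)

lemma primitive_parts_test:
  assumes "primitive F f" "test_function UNIV \<phi>"
  shows "(LINT x|lebesgue_on UNIV. of_real (deriv \<phi> x) * F x) = - (LINT x|lebesgue_on UNIV. of_real (\<phi> x) * f x)"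
proof -
  obtain R where R: "R > 0" "\<forall>x k. x \<notin> {-R<..<R} \<longrightarrow> (deriv ^^ k) \<phi> x = 0"
    using test_function_interval[OF assms(2)] .
  have out: "\<phi> x = 0" "deriv \<phi> x = 0" if "x \<notin> {-R<..<R}" for x
    using R(2)[rule_format, OF that, of 0] R(2)[rule_format, OF that, of 1] by auto
  have aiF: "F absolutely_integrable_on {x..y}" for x y
    using primitive_continuous[OF assms(1)] continuous_on_subset by (intro absolutely_integrable_continuous_real) blast
  note c = test_function_continuous[OF assms(2)]
  have 1: "(LINT x|lebesgue_on UNIV. of_real (deriv \<phi> x) * F x) = integral {-R..R} (\<lambda>x. of_real (deriv \<phi> x) * F x)"
    by (rule test_integral(2)[OF aiF c(2)]) (use out in auto)
  have 2: "(LINT x|lebesgue_on UNIV. of_real (\<phi> x) * f x) = integral {-R..R} (\<lambda>x. of_real (\<phi> x) * f x)"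
    by (rule test_integral(2)[OF primitive_integrable[OF assms(1)] c(1)]) (use out in auto)
  have "integral {-R..R} (\<lambda>x. F x * of_real (deriv \<phi> x) + of_real (\<phi> x) * f x) = 0"
    using primitive_diff[OF primitive_mult[OF test_function_primitive[OF assms(2)] assms(1)], of "-R" R] R(1) out[of R] out[of "-R"]
    by simp
  moreover have "integral {-R..R} (\<lambda>x. F x * of_real (deriv \<phi> x) + of_real (\<phi> x) * f x)
     = integral {-R..R} (\<lambda>x. F x * of_real (deriv \<phi> x)) + integral {-R..R} (\<lambda>x. of_real (\<phi> x) * f x)"
    using aiF primitive_integrable[OF assms(1)] c continuous_on_of_real
    by (intro Henstock_Kurzweil_Integration.integral_add absolutely_integrable_integrable)
      (auto intro!: absolutely_integrable_mult_continuous simp: mult.commute[of "F _"])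
  ultimately show ?thesis unfolding 1 2 by (simp add: mult.commute[of "F _"] eq_neg_iff_add_eq_0)
qed

lemma primitive_has_weak_deriv:
  assumes "primitive F f"
  shows "has_weak_deriv UNIV 1 F f"
proof -
  have "F absolutely_integrable_on {x..y}" for x y
    using primitive_continuous[OF assms(1)] continuous_on_subset by (intro absolutely_integrable_continuous_real) blast
  then show ?thesis
    using assms primitive_parts_test[OF assms] primitive_integrable locally_integrableI
    by (simp add: has_weak_deriv_def)
qed

lemma locally_integrable_Icc: "locally_integrable UNIV u \<Longrightarrow> u absolutely_integrable_on {x..y}"
  by (simp add: locally_integrable_def)

text \<open>The lemma of du Bois-Reymond. A bump minus the multiple of a fixed bump with the same integral is the derivative of
a test function; so the integral of \<open>w\<close> against any bump is \<open>\<kappa>\<close> times the integral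
of the bump.\<close>
lemma zero_weak_deriv_imp_const:
  assumes w: "locally_integrable UNIV w"
    and zero: "\<And>\<phi>. test_function UNIV \<phi> \<Longrightarrow> (LINT x|lebesgue_on UNIV. of_real (deriv \<phi> x) * w x) = 0"
  obtains c where "ae_eq UNIV w (\<lambda>x. c)"
proof -
  let ?I = "\<lambda>\<phi> g. LINT x|lebesgue_on UNIV. complex_of_real (\<phi> x) * g x"
  have int: "integrable (lebesgue_on UNIV) (\<lambda>x. of_real (bump c d n x) * g x)"
    if "locally_integrable UNIV g" for c d n g
    by (rule test_integral(1)[OF locally_integrable_Icc[OF that, of c d] psi_alg_continuous[OF bump_psi_alg]])
      (use bump_outside in auto)
  have bumpI: "?I (bump c d n) (\<lambda>x. z) = of_real (integral {c..d} (bump c d n)) * z" for c d n z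
  proof -
    have "?I (bump c d n) (\<lambda>x. z) = integral {c..d} (\<lambda>x. of_real (bump c d n x) * z)"
      by (rule test_integral(2)[OF _ psi_alg_continuous[OF bump_psi_alg]])
        (use bump_outside in \<open>auto intro!: absolutely_integrable_continuous_real\<close>)
    also have "\<dots> = integral {c..d} (\<lambda>x. of_real (bump c d n x)) * z" by simp
    also have "integral {c..d} (\<lambda>x. complex_of_real (bump c d n x)) = of_real (integral {c..d} (bump c d n))"
      using integral_linear[OF integrable_continuous_real[OF psi_alg_continuous[OF bump_psi_alg]] bounded_linear_of_real]
      by (simp add: o_def)
    finally show ?thesis .
  qed
  define J where "J c d n = integral {c..d} (bump c d n)" for c d n
  have J0: "J 0 1 1 > 0"
  proof -
    have "0 \<le> J 0 1 1" unfolding J_def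
      using bump_bounds by (intro integral_nonneg integrable_continuous_real psi_alg_continuous bump_psi_alg) auto
    moreover have "J 0 1 1 \<noteq> 0"
    proof
      assume "J 0 1 1 = 0"
      then have "((bump 0 1 1) has_integral 0) (cbox 0 1)"
        using integrable_continuous_real[OF psi_alg_continuous[OF bump_psi_alg[of 0 1 1]], of 0 1]
        by (simp add: J_def has_integral_iff)
      then have "bump 0 1 1 (1/2) = 0"
        by (rule has_integral_0_cbox_imp_0[rotated 2])
          (use bump_bounds psi_alg_continuous[OF bump_psi_alg] in auto)
      then show False by (simp add: bump_def psi_def)
    qed
    ultimately show ?thesis by simp
  qed
  define \<kappa> where "\<kappa> = ?I (bump 0 1 1) w / of_real (J 0 1 1)"
  have key: "?I (bump c d n) (\<lambda>x. w x - \<kappa>) = 0" if cd: "c < d" for c d n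
  proof -
    define r where "r = J c d n / J 0 1 1"
    define \<theta> where "\<theta> x = bump c d n x + (- r) * bump 0 1 1 x" for x
    have th: "\<theta> \<in> psi_alg"
      unfolding \<theta>_def by (intro psi_alg.intros bump_psi_alg)
    define R where "R = max (max \<bar>c\<bar> \<bar>d\<bar>) 1"
    have R: "c \<ge> - R" "d \<le> R" "R \<ge> 1" unfolding R_def by auto
    have out: "\<theta> x = 0" if "x \<notin> {-R<..<R}" for x
      using that R bump_outside[of x c d n] bump_outside[of x 0 1 1] by (auto simp: \<theta>_def)
    have "\<exists>F. \<forall>x. - \<infinity> < ereal x \<longrightarrow> ereal x < \<infinity> \<longrightarrow> (F has_vector_derivative \<theta> x) (at x)"
      using psi_alg_continuous[OF th, of UNIV]
      by (intro einterval_antiderivative) (auto simp: continuous_on_eq_continuous_at)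
    then obtain \<Theta> where \<Theta>: "\<And>x. (\<Theta> has_vector_derivative \<theta> x) (at x)" by auto
    have ftc: "(\<theta> has_integral \<Theta> y - \<Theta> x) {x..y}" if "x \<le> y" for x y
      using that \<Theta> by (intro fundamental_theorem_of_calculus) (auto intro: has_vector_derivative_at_within)
    have const: "\<Theta> x = \<Theta> y" if "x \<le> y" "y \<le> - R \<or> R \<le> x" for x y
    proof -
      have "integral {x..y} \<theta> = integral {x..y} (\<lambda>x. 0)"
        using that out by (intro Henstock_Kurzweil_Integration.integral_cong) auto
      then show ?thesis using integral_unique[OF ftc[OF that(1)]] by simp
    qed
    have Jeq: "(bump c d n has_integral J c d n) {-R..R}" if "c \<ge> - R" "d \<le> R" for c d n
    proof -
      have "(bump c d n has_integral J c d n) {c..d}"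
        unfolding J_def by (intro integrable_integral integrable_continuous_real psi_alg_continuous bump_psi_alg)
      then have "(bump c d n has_integral J c d n) UNIV"
        by (rule has_integral_on_superset) (use bump_outside in auto)
      moreover have i: "(bump c d n has_integral integral {-R..R} (bump c d n)) {-R..R}"
        by (intro integrable_integral integrable_continuous_real psi_alg_continuous bump_psi_alg)
      then have "(bump c d n has_integral integral {-R..R} (bump c d n)) UNIV"
        by (rule has_integral_on_superset) (use bump_outside[of _ c d n] that in auto)
      ultimately have "J c d n = integral {-R..R} (bump c d n)" by (rule has_integral_unique)
      then show ?thesis using i by simp
    qed
    have "(\<theta> has_integral J c d n + (- r) * J 0 1 1) {-R..R}"
      unfolding \<theta>_def using R by (intro has_integral_add has_integral_mult_right Jeq) auto
    moreover have "(\<theta> has_integral \<Theta> R - \<Theta> (- R)) {-R..R}" using R by (intro ftc) auto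
    ultimately have "\<Theta> R - \<Theta> (- R) = J c d n + (- r) * J 0 1 1"
      by (rule has_integral_unique[rotated])
    \<comment> \<open>the primitive vanishes to the right of the support because the integral of \<open>\<theta>\<close> is zero\<close>
    then have eqR: "\<Theta> R = \<Theta> (- R)" using J0 by (simp add: r_def)
    define \<psi> where "\<psi> x = \<Theta> x - \<Theta> (- R)" for x
    have d\<psi>: "(\<psi> has_real_derivative \<theta> x) (at x)" for x
      unfolding \<psi>_def using \<Theta>[of x]
      by (auto intro!: derivative_eq_intros simp: has_real_derivative_iff_has_vector_derivative[symmetric])
    then have deriv_\<psi>: "deriv \<psi> = \<theta>" by (auto intro: DERIV_imp_deriv)
    have "test_function UNIV \<psi>"
      unfolding test_function_def
    proof (intro conjI allI exI[of _ "{-R..R}"] impI)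
      fix k x
      show "(deriv ^^ k) \<psi> differentiable (at x)"
      proof (cases k)
        case 0
        then show ?thesis using d\<psi> real_differentiable_def by auto
      next
        case (Suc j)
        then show ?thesis using psi_alg_differentiable[OF th, of j]
          by (simp only: funpow_Suc_right o_apply deriv_\<psi>)
      qed
    next
      fix x assume "x \<notin> {-R..R}"
      then have "x < - R \<or> R < x" by auto
      then show "\<psi> x = 0" using const[of x "-R"] const[of R x] eqR by (auto simp: \<psi>_def)
    qed auto
    from zero[OF this] have "?I \<theta> w = 0" by (simp add: deriv_\<psi>)
    moreover have "?I \<theta> w = ?I (bump c d n) w - of_real r * ?I (bump 0 1 1) w"
    proof -
      have "?I \<theta> w = (LINT x|lebesgue_on UNIV. of_real (bump c d n x) * w x - of_real r * (of_real (bump 0 1 1 x) * w x))"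
        by (simp add: \<theta>_def algebra_simps)
      also have "\<dots> = ?I (bump c d n) w - (LINT x|lebesgue_on UNIV. of_real r * (of_real (bump 0 1 1 x) * w x))"
        using int[OF w] by (intro Bochner_Integration.integral_diff integrable_mult_right)
      finally show ?thesis by simp
    qed
    ultimately have 1: "?I (bump c d n) w = of_real (J c d n) * \<kappa>"
      using J0 by (simp add: r_def \<kappa>_def)
    have "?I (bump c d n) (\<lambda>x. w x - \<kappa>) = ?I (bump c d n) w - ?I (bump c d n) (\<lambda>x. \<kappa>)"
      unfolding right_diff_distrib
      by (intro Bochner_Integration.integral_diff int w)
        (auto simp: locally_integrable_def intro!: locally_integrableI[unfolded locally_integrable_def, rule_format, of _ _ UNIV] absolutely_integrable_continuous_real)
    then show ?thesis by (simp only: 1 bumpI J_def diff_self)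
  qed
  have "locally_integrable UNIV (\<lambda>x. w x - \<kappa>)"
    using w locally_integrable_Icc by (intro locally_integrableI set_integral_diff)
      (auto intro!: absolutely_integrable_continuous_real)
  then have "ae_eq UNIV (\<lambda>x. w x - \<kappa>) (\<lambda>x. 0)"
    by (rule zero_ae_of_bumps[OF open_UNIV]) (rule key)
  then have "ae_eq UNIV w (\<lambda>x. \<kappa>)" by (simp add: ae_eq_def)
  then show thesis by (rule that)
qed

lemma weak_deriv_imp_primitive:
  assumes "has_weak_deriv UNIV 1 u v"
  obtains U where "primitive U v" "ae_eq UNIV u U"
proof -
  have lu: "locally_integrable UNIV u" and lv: "locally_integrable UNIV v" using assms by (auto simp: has_weak_deriv_def)
  obtain V where V: "primitive V v" using primitive_exists locally_integrable_Icc[OF lv] by blast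
  have aiV: "V absolutely_integrable_on {x..y}" for x y
    using primitive_continuous[OF V] continuous_on_subset by (intro absolutely_integrable_continuous_real) blast
  have lw: "locally_integrable UNIV (\<lambda>x. u x - V x)"
    by (intro locally_integrableI set_integral_diff locally_integrable_Icc[OF lu] aiV)
  obtain c where c: "ae_eq UNIV (\<lambda>x. u x - V x) (\<lambda>x. c)"
  proof (rule zero_weak_deriv_imp_const[OF lw])
    fix \<phi> assume t: "test_function UNIV \<phi>"
    obtain R where R: "R > 0" "\<forall>x k. x \<notin> {-R<..<R} \<longrightarrow> (deriv ^^ k) \<phi> x = 0"
      using test_function_interval[OF t] .
    have out: "deriv \<phi> x = 0" if "x \<notin> {-R..R}" for x
      using R(2)[rule_format, of x 1] that by auto
    have int: "integrable (lebesgue_on UNIV) (\<lambda>x. of_real (deriv \<phi> x) * g x)" if "\<And>x y. g absolutely_integrable_on {x..y}" for g :: "real \<Rightarrow> complex"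
      by (rule test_integral(1)[OF that test_function_continuous(2)[OF t]]) (use out in auto)
    have "(LINT x|lebesgue_on UNIV. of_real (deriv \<phi> x) * (u x - V x)) =
       (LINT x|lebesgue_on UNIV. of_real (deriv \<phi> x) * u x) - (LINT x|lebesgue_on UNIV. of_real (deriv \<phi> x) * V x)"
      unfolding right_diff_distrib by (intro Bochner_Integration.integral_diff int locally_integrable_Icc[OF lu] aiV)
    moreover have "(LINT x|lebesgue_on UNIV. of_real (deriv \<phi> x) * u x) = - (LINT x|lebesgue_on UNIV. of_real (\<phi> x) * v x)"
      using assms t by (simp add: has_weak_deriv_def)
    ultimately show "(LINT x|lebesgue_on UNIV. of_real (deriv \<phi> x) * (u x - V x)) = 0"
      using primitive_parts_test[OF V t] by simp
  qed
  have "primitive (\<lambda>x. V x + c) v" using primitive_add[OF V primitive_const[of c]] by simp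
  moreover have "ae_eq UNIV u (\<lambda>x. V x + c)"
    using c unfolding ae_eq_def by eventually_elim (simp add: algebra_simps)
  ultimately show thesis by (rule that)
qed

text \<open>This makes the representative that \<^const>\<open>weak_deriv\<close> chooses irrelevant.\<close>
lemma has_weak_deriv_unique:
  assumes "open S" "has_weak_deriv S k u v" "has_weak_deriv S k u w"
  shows "ae_eq S v w"
proof -
  have S: "S \<in> sets lebesgue" using assms(1) by (simp add: borel_open)
  have l: "locally_integrable S v" "locally_integrable S w" using assms by (auto simp: has_weak_deriv_def)
  have lvw: "locally_integrable S (\<lambda>x. v x - w x)"
    using l unfolding locally_integrable_def by (auto intro: set_integral_diff)
  have "ae_eq S (\<lambda>x. v x - w x) (\<lambda>x. 0)"
  proof (rule zero_ae_of_bumps[OF assms(1) lvw])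
    fix c d n assume cd: "c < d" "{c..d} \<subseteq> S"
    have int: "integrable (lebesgue_on S) (\<lambda>x. of_real (bump c d n x) * g x)" if "locally_integrable S g" for g
      by (rule test_integral(1)[OF _ psi_alg_continuous[OF bump_psi_alg] cd(2) S])
        (use bump_outside that cd(2) in \<open>auto simp: locally_integrable_def\<close>)
    have "(-1) ^ k * (LINT x|lebesgue_on S. of_real (bump c d n x) * v x)
        = (-1) ^ k * (LINT x|lebesgue_on S. of_real (bump c d n x) * w x)"
      using assms(2,3) test_function_bump[OF cd(2), of n] by (simp add: has_weak_deriv_def)
    then have "(LINT x|lebesgue_on S. of_real (bump c d n x) * v x) = (LINT x|lebesgue_on S. of_real (bump c d n x) * w x)"
      by simp
    then show "(LINT x|lebesgue_on S. of_real (bump c d n x) * (v x - w x)) = 0"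
      unfolding right_diff_distrib using int l by (simp add: Bochner_Integration.integral_diff)
  qed
  then show ?thesis by (simp add: ae_eq_def)
qed

lemma weak_deriv_ae:
  assumes "open S" "has_weak_deriv S k u v"
  shows "ae_eq S (weak_deriv S k u) v"
proof -
  have "has_weak_deriv S k u (weak_deriv S k u)"
    unfolding weak_deriv_def by (rule someI[of _ v]) (rule assms(2))
  then show ?thesis using has_weak_deriv_unique[OF assms(1)] assms(2) by blast
qed

lemma has_weak_deriv_of_first:
  assumes "has_weak_deriv S 1 u v" "has_weak_deriv S 2 u w"
  shows "has_weak_deriv S 1 v w"
  unfolding has_weak_deriv_def
proof (intro conjI allI impI)
  fix \<phi> assume t: "test_function S \<phi>"
  have "(LINT x|lebesgue_on S. of_real ((deriv ^^ 2) \<phi> x) * u x) = (LINT x|lebesgue_on S. of_real (\<phi> x) * w x)"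
    using assms(2) t by (simp add: has_weak_deriv_def)
  moreover have "(LINT x|lebesgue_on S. of_real (deriv (deriv \<phi>) x) * u x) = - (LINT x|lebesgue_on S. of_real (deriv \<phi> x) * v x)"
    using assms(1) test_function_deriv[OF t] by (simp add: has_weak_deriv_def)
  ultimately show "(LINT x|lebesgue_on S. of_real ((deriv ^^ 1) \<phi> x) * v x) = (- 1) ^ 1 * (LINT x|lebesgue_on S. of_real (\<phi> x) * w x)"
    by (simp add: numeral_2_eq_2 minus_equation_iff[of "LINT x|lebesgue_on S. of_real (deriv \<phi> x) * v x"])
qed (use assms in \<open>auto simp: has_weak_deriv_def\<close>)

lemma has_weak_deriv_second:
  assumes "has_weak_deriv S 1 u v" "has_weak_deriv S 1 v w"
  shows "has_weak_deriv S 2 u w"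
  unfolding has_weak_deriv_def
proof (intro conjI allI impI)
  fix \<phi> assume t: "test_function S \<phi>"
  have "(LINT x|lebesgue_on S. of_real (deriv (deriv \<phi>) x) * u x) = - (LINT x|lebesgue_on S. of_real (deriv \<phi> x) * v x)"
    using assms(1) test_function_deriv[OF t] by (simp add: has_weak_deriv_def)
  moreover have "(LINT x|lebesgue_on S. of_real (deriv \<phi> x) * v x) = - (LINT x|lebesgue_on S. of_real (\<phi> x) * w x)"
    using assms(2) t by (simp add: has_weak_deriv_def)
  ultimately show "(LINT x|lebesgue_on S. of_real ((deriv ^^ 2) \<phi> x) * u x) = (- 1) ^ 2 * (LINT x|lebesgue_on S. of_real (\<phi> x) * w x)"
    by (simp add: numeral_2_eq_2)
qed (use assms in \<open>auto simp: has_weak_deriv_def\<close>)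

lemma has_weak_deriv_cong:
  assumes "has_weak_deriv S k u v" "\<And>x. x \<in> S \<Longrightarrow> u x = u' x" "S \<in> sets lebesgue"
  shows "has_weak_deriv S k u' v"
proof -
  have "locally_integrable S u'"
    unfolding locally_integrable_def
  proof (intro allI impI)
    fix K :: "real set" assume K: "compact K \<and> K \<subseteq> S"
    then have "u absolutely_integrable_on K"
      using assms(1) by (simp add: has_weak_deriv_def locally_integrable_def)
    then show "u' absolutely_integrable_on K"
      by (rule absolutely_integrable_spike[OF _ negligible_empty]) (use assms(2) K in auto)
  qed
  moreover have "(LINT x|lebesgue_on S. of_real (\<psi> x) * u' x) = (LINT x|lebesgue_on S. of_real (\<psi> x) * u x)" for \<psi> :: "real \<Rightarrow> real"
    using assms(2,3) by (intro Bochner_Integration.integral_cong) auto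
  ultimately show ?thesis using assms(1) by (simp add: has_weak_deriv_def)
qed

lemma has_weak_deriv_ae_cong:
  assumes "has_weak_deriv UNIV k u v" "ae_eq UNIV u u'" 
  shows "has_weak_deriv UNIV k u' v"
proof -
  have ae: "AE x in lebesgue. u x = u' x" using assms(2) by (simp add: ae_eq_UNIV)
  then obtain N where N: "negligible N" "\<And>x. x \<notin> N \<Longrightarrow> u x = u' x"
    unfolding eventually_ae_filter negligible_iff_null_sets by auto
  have lu: "locally_integrable UNIV u" using assms(1) by (simp add: has_weak_deriv_def)
  have lu': "locally_integrable UNIV u'"
    unfolding locally_integrable_def
  proof (intro allI impI)
    fix K :: "real set" assume "compact K \<and> K \<subseteq> UNIV"
    then have "u absolutely_integrable_on K" using lu by (simp add: locally_integrable_def)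
    then show "u' absolutely_integrable_on K"
      by (rule absolutely_integrable_spike[OF _ N(1)]) (use N(2) in auto)
  qed
  have "(LINT x|lebesgue_on UNIV. of_real ((deriv ^^ k) \<phi> x) * u' x)
      = (LINT x|lebesgue_on UNIV. of_real ((deriv ^^ k) \<phi> x) * u x)" if t: "test_function UNIV \<phi>" for \<phi>
  proof -
    obtain R where R: "R > 0" "\<forall>x k. x \<notin> {-R<..<R} \<longrightarrow> (deriv ^^ k) \<phi> x = 0"
      using test_function_interval[OF t] .
    have out: "(deriv ^^ k) \<phi> x = 0" if "x \<notin> {-R..R}" for x
      using R(2)[rule_format, of x k] that by auto
    have c: "continuous_on {-R..R} ((deriv ^^ k) \<phi>)" 
      using t by (auto simp: test_function_def intro!: continuous_at_imp_continuous_on differentiable_imp_continuous_within)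
    have e: "(LINT x|lebesgue_on UNIV. of_real ((deriv ^^ k) \<phi> x) * g x) = integral {-R..R} (\<lambda>x. of_real ((deriv ^^ k) \<phi> x) * g x)"
      if "locally_integrable UNIV g" for g
      by (rule test_integral(2)[OF locally_integrable_Icc[OF that] c]) (use out in auto)
    show ?thesis unfolding e[OF lu] e[OF lu']
      by (rule integral_spike[OF N(1)]) (use N(2) in auto)
  qed
  then show ?thesis using assms(1) lu' by (simp add: has_weak_deriv_def)
qed

lemma has_weak_deriv_restrict:
  assumes "has_weak_deriv UNIV k u v" "open S"
  shows "has_weak_deriv S k u v"
  unfolding has_weak_deriv_def
proof (intro conjI allI impI)
  show "locally_integrable S u" "locally_integrable S v"
    using assms(1) by (auto simp: has_weak_deriv_def locally_integrable_def)
  have S: "S \<in> sets lebesgue" using assms(2) by (simp add: borel_open)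
  fix \<phi> assume t: "test_function S \<phi>"
  obtain K where K: "compact K" "K \<subseteq> S" "\<And>x k. x \<notin> K \<Longrightarrow> (deriv ^^ k) \<phi> x = 0"
    using test_function_support[OF t] by blast
  have e: "(LINT x|lebesgue_on S. of_real ((deriv ^^ j) \<phi> x) * g x) = (LINT x|lebesgue_on UNIV. of_real ((deriv ^^ j) \<phi> x) * g x)" for j and g :: "real \<Rightarrow> complex"
  proof -
    have "indicator S x *\<^sub>R (of_real ((deriv ^^ j) \<phi> x) * g x) = of_real ((deriv ^^ j) \<phi> x) * g x" for x
      using K(2) K(3)[of x j] by (cases "x \<in> K") (auto simp: indicator_def)
    note ind = this
    show ?thesis unfolding lebesgue_on_UNIV_eq
      by (subst integral_restrict_space) (use S in \<open>simp_all add: ind\<close>)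
  qed
  show "(LINT x|lebesgue_on S. of_real ((deriv ^^ k) \<phi> x) * u x) = (- 1) ^ k * (LINT x|lebesgue_on S. of_real (\<phi> x) * v x)"
    using assms(1) test_function_mono[OF t subset_UNIV] e[of k u] e[of 0 v] by (simp add: has_weak_deriv_def)
qed

section \<open>The domain of the operator\<close>

text \<open>Test the derivative with the dilations $\beta(x/(n+1))$ of one bump: they tend to the constant $\beta(0)$, and
their derivatives are bounded by a multiple of $1/(n+1)$.\<close>
lemma integral_derivative_zero:
  assumes Ff: "primitive F f" and F: "integrable lebesgue F" and f: "integrable lebesgue f"
  shows "(LINT x|lebesgue. f x) = 0"
proof -
  define \<beta> where "\<beta> = bump (-1) 1 1"
  have \<beta>: "\<beta> \<in> psi_alg" unfolding \<beta>_def by (rule bump_psi_alg)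
  obtain \<beta>' where \<beta>': "\<beta>' \<in> psi_alg" "\<And>x. (\<beta> has_real_derivative \<beta>' x) (at x)"
    using psi_alg_deriv[OF \<beta>] by blast
  have "deriv \<beta> = \<beta>'" using \<beta>'(2) by (auto intro: DERIV_imp_deriv)
  obtain R where R: "R > 0" "\<forall>x k. x \<notin> {-R<..<R} \<longrightarrow> (deriv ^^ k) \<beta> x = 0"
    using test_function_interval[OF test_function_bump[OF subset_UNIV], of "-1" 1 1] unfolding \<beta>_def .
  have "bounded (\<beta>' ` {-R..R})"
    by (intro compact_imp_bounded compact_continuous_image psi_alg_continuous \<beta>'(1) compact_Icc)
  then obtain D where D: "\<forall>x\<in>{-R..R}. \<bar>\<beta>' x\<bar> \<le> D" unfolding bounded_iff by auto
  have bd': "\<bar>\<beta>' x\<bar> \<le> \<bar>D\<bar>" for x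
  proof (cases "x \<in> {-R..R}")
    case False
    then have "deriv \<beta> x = 0" using R(2)[rule_format, of x 1] by auto
    then show ?thesis using \<open>deriv \<beta> = \<beta>'\<close> by simp
  qed (use D in force)
  define \<phi> where "\<phi> n x = \<beta> (1 / real (Suc n) * x + 0)" for n x
  have \<phi>: "\<phi> n \<in> psi_alg" for n unfolding \<phi>_def by (intro psi_alg.intros \<beta>)
  have d\<phi>: "(\<phi> n has_real_derivative \<beta>' (1 / real (Suc n) * x + 0) * (1 / real (Suc n))) (at x)" for n x
    unfolding \<phi>_def by (rule DERIV_chain2[OF \<beta>'(2)]) (auto intro!: derivative_eq_intros)
  then have deriv\<phi>: "deriv (\<phi> n) x = \<beta>' (1 / real (Suc n) * x + 0) * (1 / real (Suc n))" for n x
    by (rule DERIV_imp_deriv)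
  have "test_function UNIV (\<phi> n)" for n
    unfolding test_function_def
  proof (intro conjI allI exI[of _ "{- real (Suc n)..real (Suc n)}"] impI)
    show "(deriv ^^ k) (\<phi> n) differentiable at x" for k x by (rule psi_alg_differentiable[OF \<phi>])
    fix x assume "x \<notin> {- real (Suc n)..real (Suc n)}"
    then show "\<phi> n x = 0" unfolding \<phi>_def \<beta>_def by (intro bump_outside) (auto simp: field_simps)
  qed auto
  from primitive_parts_test[OF Ff this]
  have eq: "(LINT x|lebesgue. of_real (deriv (\<phi> n) x) * F x) = - (LINT x|lebesgue. of_real (\<phi> n x) * f x)" for n
    by (simp add: lebesgue_on_UNIV_eq)
  have cont_meas: "(\<lambda>x. complex_of_real (g x)) \<in> borel_measurable lebesgue" if "continuous_on UNIV g" for g :: "real \<Rightarrow> real"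
    using that by (intro measurable_completion) (simp add: borel_measurable_continuous_onI continuous_on_of_real)
  have m1: "(\<lambda>x. complex_of_real (\<phi> n x)) \<in> borel_measurable lebesgue" for n
    by (rule cont_meas[OF psi_alg_continuous[OF \<phi>]])
  have m2: "(\<lambda>x. complex_of_real (deriv (\<phi> n) x)) \<in> borel_measurable lebesgue" for n
    using psi_alg_higher_deriv[OF \<phi>, of 1 n] by (intro cont_meas psi_alg_continuous) simp
  note mF = borel_measurable_integrable[OF F] and mf = borel_measurable_integrable[OF f]
  have lim1: "(\<lambda>n. LINT x|lebesgue. of_real (\<phi> n x) * f x) \<longlonglongrightarrow> (LINT x|lebesgue. of_real (\<beta> 0) * f x)"
  proof (rule integral_dominated_convergence[where w = "\<lambda>x. norm (f x)"])
    show "integrable lebesgue (\<lambda>x. norm (f x))" using f by simp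
    show "AE x in lebesgue. (\<lambda>n. of_real (\<phi> n x) * f x) \<longlonglongrightarrow> of_real (\<beta> 0) * f x"
    proof (rule AE_I2)
      fix x
      have "(\<lambda>n. x * (1 / real (Suc n))) \<longlonglongrightarrow> x * 0"
        using LIMSEQ_Suc[OF lim_1_over_n] by (intro tendsto_mult tendsto_const) 
      then have "(\<lambda>n. 1 / real (Suc n) * x + 0) \<longlonglongrightarrow> 0" by (simp add: mult.commute)
      moreover have "isCont \<beta> 0" using \<beta>'(2) by (rule DERIV_isCont)
      ultimately have "(\<lambda>n. \<phi> n x) \<longlonglongrightarrow> \<beta> 0" unfolding \<phi>_def by (rule isCont_tendsto_compose[rotated])
      then show "(\<lambda>n. of_real (\<phi> n x) * f x) \<longlonglongrightarrow> of_real (\<beta> 0) * f x"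
        by (intro tendsto_mult tendsto_of_real tendsto_const)
    qed
    show "AE x in lebesgue. norm (of_real (\<phi> n x) * f x) \<le> norm (f x)" for n
      using bump_bounds unfolding \<phi>_def \<beta>_def by (intro AE_I2) (simp add: norm_mult mult_left_le_one_le)
  qed (use m1 mf in \<open>auto intro!: borel_measurable_times\<close>)
  have lim2: "(\<lambda>n. LINT x|lebesgue. of_real (deriv (\<phi> n) x) * F x) \<longlonglongrightarrow> integral\<^sup>L lebesgue (\<lambda>x::real. 0::complex)"
  proof (rule integral_dominated_convergence[where w = "\<lambda>x. \<bar>D\<bar> * norm (F x)"])
    show "integrable lebesgue (\<lambda>x. \<bar>D\<bar> * norm (F x))" using F by simp
    have b: "\<bar>deriv (\<phi> n) x\<bar> \<le> \<bar>D\<bar> * (1 / real (Suc n))" for n x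
      unfolding deriv\<phi> using bd' by (simp add: abs_mult divide_right_mono)
    show "AE x in lebesgue. (\<lambda>n. of_real (deriv (\<phi> n) x) * F x) \<longlonglongrightarrow> 0"
    proof (rule AE_I2)
      fix x
      have "(\<lambda>n. \<bar>D\<bar> * (1 / real (Suc n))) \<longlonglongrightarrow> \<bar>D\<bar> * 0"
        using LIMSEQ_Suc[OF lim_1_over_n] by (intro tendsto_mult tendsto_const) 
      then have lim0: "(\<lambda>n. \<bar>D\<bar> * (1 / real (Suc n))) \<longlonglongrightarrow> 0" by simp
      have "(\<lambda>n. deriv (\<phi> n) x) \<longlonglongrightarrow> 0"
        by (rule Lim_null_comparison[OF _ lim0]) (use b in auto)
      then have "(\<lambda>n. of_real (deriv (\<phi> n) x) * F x) \<longlonglongrightarrow> of_real 0 * F x"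
        by (intro tendsto_mult tendsto_of_real tendsto_const)
      then show "(\<lambda>n. of_real (deriv (\<phi> n) x) * F x) \<longlonglongrightarrow> 0" by simp
    qed
    show "AE x in lebesgue. norm (of_real (deriv (\<phi> n) x) * F x) \<le> \<bar>D\<bar> * norm (F x)" for n
    proof (intro AE_I2)
      fix x
      have "\<bar>D\<bar> * (1 / real (Suc n)) \<le> \<bar>D\<bar> * 1" by (intro mult_left_mono) auto
      then show "norm (of_real (deriv (\<phi> n) x) * F x) \<le> \<bar>D\<bar> * norm (F x)"
        using b[of n x] by (simp add: norm_mult mult_right_mono)
    qed
  qed (use m2 mF in \<open>auto intro!: borel_measurable_times\<close>)
  have "(\<lambda>n. - (LINT x|lebesgue. of_real (\<phi> n x) * f x)) \<longlonglongrightarrow> 0" using lim2 unfolding eq by simp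
  then have "(\<lambda>n. LINT x|lebesgue. of_real (\<phi> n x) * f x) \<longlonglongrightarrow> 0" using tendsto_minus_cancel_left[of _ 0] by fastforce
  then have "(LINT x|lebesgue. of_real (\<beta> 0) * f x) = 0" using lim1 LIMSEQ_unique by blast
  moreover have "\<beta> 0 \<noteq> 0" by (simp add: \<beta>_def bump_def psi_def)
  ultimately show ?thesis by simp
qed

lemma L2_parts:
  assumes "primitive F f" "primitive G g" "F \<in> L2 UNIV" "f \<in> L2 UNIV" "G \<in> L2 UNIV" "g \<in> L2 UNIV"
  shows "(LINT x|lebesgue_on UNIV. f x * G x) = - (LINT x|lebesgue_on UNIV. F x * g x)"
proof -
  have i: "integrable lebesgue (\<lambda>x. F x * G x)" "integrable lebesgue (\<lambda>x. G x * f x)" "integrable lebesgue (\<lambda>x. F x * g x)"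
    using assms L2_mult_integrable[of _ UNIV] by (auto simp: lebesgue_on_UNIV_eq)
  have "(LINT x|lebesgue. G x * f x + F x * g x) = 0"
    by (rule integral_derivative_zero[OF primitive_mult[OF assms(1,2)] i(1)]) (use i in auto)
  then show ?thesis using i by (simp add: lebesgue_on_UNIV_eq mult.commute[of "f _"] eq_neg_iff_add_eq_0)
qed

text \<open>The continuously differentiable representative of a function of $W_2^2(\mathbb{R})$ with its first two
derivatives.\<close>
definition W22_triple :: "(real \<Rightarrow> complex) \<Rightarrow> (real \<Rightarrow> complex) \<Rightarrow> (real \<Rightarrow> complex) \<Rightarrow> bool" where
  "W22_triple U U1 U2 \<longleftrightarrow> U \<in> L2 UNIV \<and> U1 \<in> L2 UNIV \<and> U2 \<in> L2 UNIV \<and> primitive U U1 \<and> primitive U1 U2"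

lemma W22_triple_weak_deriv:
  assumes "W22_triple U U1 U2" "ae_eq UNIV U u"
  shows "has_weak_deriv UNIV 0 u u" "has_weak_deriv UNIV 1 u U1" "has_weak_deriv UNIV 2 u U2"
proof -
  have 1: "has_weak_deriv UNIV 1 U U1" "has_weak_deriv UNIV 1 U1 U2"
    using assms(1) primitive_has_weak_deriv by (auto simp: W22_triple_def)
  then have "has_weak_deriv UNIV 2 U U2" by (rule has_weak_deriv_second)
  then show 2: "has_weak_deriv UNIV 1 u U1" "has_weak_deriv UNIV 2 u U2"
    using 1 assms(2) has_weak_deriv_ae_cong by blast+
  show "has_weak_deriv UNIV 0 u u" using 2(1) by (simp add: has_weak_deriv_def)
qed

lemma W22_triple_imp_W22:
  assumes "W22_triple U U1 U2" "ae_eq UNIV U u"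
  shows "u \<in> W22 UNIV"
proof -
  have L: "u \<in> L2 UNIV" "U1 \<in> L2 UNIV" "U2 \<in> L2 UNIV"
    using assms L2_ae_cong by (auto simp: W22_triple_def)
  have "\<exists>v\<in>L2 UNIV. has_weak_deriv UNIV k u v" if k: "k \<le> 2" for k
  proof -
    consider "k = 0" | "k = 1" | "k = 2" using k by linarith
    then show ?thesis using L W22_triple_weak_deriv[OF assms] by cases blast+
  qed
  then show ?thesis using L(1) by (simp add: W22_def)
qed

lemma W22_imp_triple:
  assumes "u \<in> W22 UNIV"
  obtains U U1 U2 where "W22_triple U U1 U2" "ae_eq UNIV U u"
proof -
  have "\<forall>k\<le>2. \<exists>v\<in>L2 UNIV. has_weak_deriv UNIV k u v" and u: "u \<in> L2 UNIV" using assms by (auto simp: W22_def)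
  then obtain v1 v2 where v: "v1 \<in> L2 UNIV" "has_weak_deriv UNIV 1 u v1" "v2 \<in> L2 UNIV" "has_weak_deriv UNIV 2 u v2"
    by (meson one_le_numeral order_refl)
  obtain U where U: "primitive U v1" "ae_eq UNIV u U" using weak_deriv_imp_primitive[OF v(2)] .
  obtain U1 where U1: "primitive U1 v2" "ae_eq UNIV v1 U1"
    using weak_deriv_imp_primitive[OF has_weak_deriv_of_first[OF v(2,4)]] .
  have "primitive U U1" using primitive_ae_cong[OF U(1)] U1(2) by (simp add: ae_eq_UNIV)
  then have "W22_triple U U1 v2"
    using L2_ae_cong[OF u U(2)] L2_ae_cong[OF v(1) U1(2)] v(3) U1(1) by (simp add: W22_triple_def)
  then show thesis using ae_eq_sym[OF U(2)] by (rule that)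
qed

lemma W22_triple_add:
  assumes "W22_triple U U1 U2" "W22_triple V V1 V2"
  shows "W22_triple (\<lambda>x. U x + V x) (\<lambda>x. U1 x + V1 x) (\<lambda>x. U2 x + V2 x)"
  using assms by (simp add: W22_triple_def L2_add primitive_add)

lemma W22_triple_scale: "W22_triple U U1 U2 \<Longrightarrow> W22_triple (\<lambda>x. c * U x) (\<lambda>x. c * U1 x) (\<lambda>x. c * U2 x)"
  by (simp add: W22_triple_def L2_scale primitive_scale)

lemma W22_triple_shift:
  assumes "W22_triple U U1 U2"
  shows "primitive (\<lambda>x. U (x + c)) (\<lambda>x. U1 (x + c))" "primitive (\<lambda>x. U1 (x + c)) (\<lambda>x. U2 (x + c))"
  using assms primitive_shift by (auto simp: W22_triple_def)

text \<open>$W_2^2(\mathbb{R})$ as a subspace of $L_2(\mathbb{R})^3$; \<^const>\<open>fst\<close> is the embedding into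
$L_2(\mathbb{R})$.\<close>
definition W22_triples :: "(l2 \<times> l2 \<times> l2) set" where
  "W22_triples = {(cls U, cls U1, cls U2) | U U1 U2. W22_triple U U1 U2}"

lemma subspace_W22_triples: "subspace W22_triples"
proof (rule subspaceI)
  have "W22_triple (\<lambda>x. 0) (\<lambda>x. 0) (\<lambda>x. 0)" by (simp add: W22_triple_def L2_zero primitive_const)
  then show "0 \<in> W22_triples" unfolding W22_triples_def zero_prod_def cls_zero[symmetric] by blast
next
  fix s t assume "s \<in> W22_triples" "t \<in> W22_triples"
  then obtain U U1 U2 V V1 V2 where "s = (cls U, cls U1, cls U2)" "t = (cls V, cls V1, cls V2)" and W: "W22_triple U U1 U2" "W22_triple V V1 V2"
    unfolding W22_triples_def by blast
  then have "s + t = (cls (\<lambda>x. U x + V x), cls (\<lambda>x. U1 x + V1 x), cls (\<lambda>x. U2 x + V2 x))"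
    by (simp add: W22_triple_def cls_add)
  then show "s + t \<in> W22_triples" using W22_triple_add[OF W] unfolding W22_triples_def by blast
next
  fix c :: real and t assume "t \<in> W22_triples"
  then obtain U U1 U2 where "t = (cls U, cls U1, cls U2)" and W: "W22_triple U U1 U2" unfolding W22_triples_def by blast
  then have "c *\<^sub>R t = (cls (\<lambda>x. of_real c * U x), cls (\<lambda>x. of_real c * U1 x), cls (\<lambda>x. of_real c * U2 x))"
    by (simp add: W22_triple_def cls_scaleR scaleR_conv_of_real)
  then show "c *\<^sub>R t \<in> W22_triples" using W22_triple_scale[OF W] unfolding W22_triples_def by blast
qed

lemma W22_triples_cases:
  assumes "t \<in> W22_triples"
  obtains U U1 U2 where "t = (cls U, cls U1, cls U2)" "W22_triple U U1 U2"
  using assms unfolding W22_triples_def by blast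

lemma mult_mult_l2:
  assumes "multiplier m" "multiplier n"
  shows "mult_l2 m (mult_l2 n x) = mult_l2 (\<lambda>t. m t * n t) x" "multiplier (\<lambda>t. m t * n t)"
proof -
  obtain A B where AB: "\<And>x. cmod (m x) \<le> A" "\<And>x. cmod (n x) \<le> B" using assms by (auto simp: multiplier_def)
  have "cmod (m x * n x) \<le> A * B" for x
    unfolding norm_mult using AB(1)[of x] AB(2)[of x] norm_ge_zero order_trans by (intro mult_mono) blast+
  then show m: "multiplier (\<lambda>t. m t * n t)"
    using assms unfolding multiplier_def by (intro conjI borel_measurable_times) auto
  obtain u where u: "x = cls u" "u \<in> L2 UNIV" by (rule cls_cases)
  then show "mult_l2 m (mult_l2 n x) = mult_l2 (\<lambda>t. m t * n t) x"
    using m assms by (simp add: mult_l2_cls multiplier_L2 mult.assoc)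
qed

lemma multiplier_const [simp]: "multiplier (\<lambda>x. c)" by (auto simp: multiplier_def)

lemma mult_l2_of_real: "mult_l2 (\<lambda>_. of_real r) x = r *\<^sub>R x"
proof -
  obtain u where u: "x = cls u" "u \<in> L2 UNIV" by (rule cls_cases)
  then show ?thesis by (simp add: mult_l2_cls cls_scaleR scaleR_conv_of_real)
qed

lemma norm_mult_l2_const: "norm (mult_l2 (\<lambda>_. c) x) = cmod c * norm x"
proof -
  obtain u where u: "x = cls u" "u \<in> L2 UNIV" by (rule cls_cases)
  then show ?thesis by (simp add: mult_l2_cls norm_cls L2_scale l2norm_scale)
qed

section \<open>A priori estimates\<close>

abbreviation rmult :: "(real \<Rightarrow> real) \<Rightarrow> l2 \<Rightarrow> l2" where
  "rmult m \<equiv> mult_l2 (\<lambda>x. complex_of_real (m x))"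

text \<open>The expression $-(pu')'+qu = qu-(du'+pu'')$ on triples, where $d$ plays the role of $p'$.\<close>
definition SL :: "(real \<Rightarrow> real) \<Rightarrow> (real \<Rightarrow> real) \<Rightarrow> (real \<Rightarrow> real) \<Rightarrow> l2 \<times> l2 \<times> l2 \<Rightarrow> l2" where
  "SL p d q t = rmult q (fst t) - (rmult d (fst (snd t)) + rmult p (snd (snd t)))"

definition SLz :: "(real \<Rightarrow> real) \<Rightarrow> (real \<Rightarrow> real) \<Rightarrow> (real \<Rightarrow> real) \<Rightarrow> complex \<Rightarrow> l2 \<times> l2 \<times> l2 \<Rightarrow> l2" where
  "SLz p d q z t = SL p d q t - mult_l2 (\<lambda>_. z) (fst t)"

lemma linear_mult_l2: "linear (mult_l2 m)"
  using bounded_linear_mult_l2 bounded_linear.linear by blast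

lemma linear_SL: "linear (SL p d q)"
  unfolding SL_def
  by (intro linearI) (simp_all add: linear_add[OF linear_mult_l2] linear_scale[OF linear_mult_l2] algebra_simps)

lemma linear_SLz: "linear (SLz p d q z)"
  unfolding SLz_def
  by (intro linearI) (simp_all add: linear_add[OF linear_mult_l2] linear_scale[OF linear_mult_l2]
      linear_add[OF linear_SL] linear_scale[OF linear_SL] algebra_simps)

lemma weighted_arith_geo_mean:
  fixes a b c e :: real
  assumes "c\<^sup>2 \<le> a * b" "e > 0" "a \<ge> 0" "b \<ge> 0"
  shows "2 * c \<le> e * a + b / e"
proof -
  have "(2 * c)\<^sup>2 \<le> 4 * (a * b)" using assms(1) by (simp add: power2_eq_square)
  also have "\<dots> \<le> (e * a + b / e)\<^sup>2"
  proof -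
    have "(e * a + b / e)\<^sup>2 - 4 * (a * b) = (e * a - b / e)\<^sup>2"
      using assms(2) by (simp add: power2_sum power2_diff)
    then show ?thesis by (metis diff_ge_0_iff_ge zero_le_power2)
  qed
  finally have sq: "(2 * c)\<^sup>2 \<le> (e * a + b / e)\<^sup>2" .
  have "0 \<le> e * a + b / e" using assms(2-4) by simp
  with sq show ?thesis by (rule power2_le_imp_le)
qed

text \<open>One constant \<open>B\<close> bounds all coefficients. The class is convex, so that a homotopy of
coefficients stays in it with the same constants.\<close>
locale coeffs =
  fixes p d q :: "real \<Rightarrow> real" and p0 B :: real
  assumes p_primitive: "primitive (\<lambda>x. complex_of_real (p x)) (\<lambda>x. complex_of_real (d x))"
    and measurable_d: "d \<in> borel_measurable lebesgue"
    and measurable_q: "q \<in> borel_measurable lebesgue"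
    and p0_pos: "0 < p0"
    and p_lower: "\<And>x. p0 \<le> p x"
    and p_upper: "\<And>x. p x \<le> B"
    and d_bound: "\<And>x. \<bar>d x\<bar> \<le> B"
    and q_bound: "\<And>x. \<bar>q x\<bar> \<le> B"
begin

lemma B_pos: "0 < B" using p0_pos p_lower[of 0] p_upper[of 0] by linarith

lemma p_pos: "0 < p x" using p0_pos p_lower[of x] by linarith

lemma abs_p: "\<bar>p x\<bar> \<le> B" using p_pos[of x] p_upper[of x] by linarith

lemma continuous_p: "continuous_on UNIV p"
proof -
  have "continuous_on UNIV (\<lambda>x. Re (complex_of_real (p x)))"
    by (intro continuous_intros primitive_continuous[OF p_primitive])
  then show ?thesis by simp
qed

lemma measurable_p: "p \<in> borel_measurable lebesgue"
  by (intro measurable_completion) (simp add: borel_measurable_continuous_onI continuous_p)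

lemma real_multiplier:
  "m \<in> borel_measurable lebesgue \<Longrightarrow> (\<And>x. \<bar>m x\<bar> \<le> C) \<Longrightarrow> multiplier (\<lambda>x. complex_of_real (m x))"
  unfolding multiplier_def by (intro conjI exI[of _ C]) auto

lemmas mult_p = real_multiplier[OF measurable_p abs_p]
lemmas mult_d = real_multiplier[OF measurable_d d_bound]
lemmas mult_q = real_multiplier[OF measurable_q q_bound]

lemma norm_rmult:
  assumes "m \<in> borel_measurable lebesgue" "\<And>x. \<bar>m x\<bar> \<le> C"
  shows "norm (rmult m x) \<le> C * norm x"
  using assms by (intro norm_mult_l2) auto

lemma norm_rmult_p: "p0 * norm x \<le> norm (rmult p x)"
proof -
  have m: "(\<lambda>x. 1 / p x) \<in> borel_measurable lebesgue" using measurable_p by measurable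
  have b: "\<bar>1 / p x\<bar> \<le> 1 / p0" for x
    using p_pos[of x] p0_pos p_lower[of x] by (simp add: frac_le)
  have "rmult (\<lambda>x. 1 / p x) (rmult p x) = x"
  proof -
    have eq: "complex_of_real (1 / p t) * complex_of_real (p t) = complex_of_real 1" for t
      using p_pos[of t] by (simp flip: of_real_mult)
    show ?thesis
      unfolding mult_mult_l2(1)[OF real_multiplier[OF m b] mult_p] eq mult_l2_of_real by simp
  qed
  then have "norm x \<le> 1 / p0 * norm (rmult p x)" using norm_rmult[OF m b, of "rmult p x"] by simp
  then show ?thesis using p0_pos by (simp add: field_simps)
qed

lemma SL_cls:
  assumes "W22_triple U U1 U2"
  shows "SL p d q (cls U, cls U1, cls U2)
    = cls (\<lambda>x. of_real (q x) * U x - (of_real (d x) * U1 x + of_real (p x) * U2 x))"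
    and "(\<lambda>x. of_real (q x) * U x - (of_real (d x) * U1 x + of_real (p x) * U2 x)) \<in> L2 UNIV"
  using assms mult_p mult_d mult_q
  by (simp_all add: W22_triple_def SL_def mult_l2_cls cls_add cls_diff multiplier_L2 L2_add L2_diff)

text \<open>Integration by parts turns $\int -(pu')'\overline u$ into $\int p|u'|^2$, which is real and nonnegative.\<close>
lemma quadratic_form:
  assumes W: "W22_triple U U1 U2"
  shows "(LINT x|lebesgue_on UNIV. (of_real (q x) * U x - (of_real (d x) * U1 x + of_real (p x) * U2 x)) * cnj (U x))
    = of_real ((LINT x|lebesgue_on UNIV. q x * (cmod (U x))\<^sup>2) + (LINT x|lebesgue_on UNIV. p x * (cmod (U1 x))\<^sup>2))"
    and "integrable (lebesgue_on UNIV) (\<lambda>x. q x * (cmod (U x))\<^sup>2)"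
    and "integrable (lebesgue_on UNIV) (\<lambda>x. p x * (cmod (U1 x))\<^sup>2)"
proof -
  have L: "U \<in> L2 UNIV" "U1 \<in> L2 UNIV" "U2 \<in> L2 UNIV" and pr: "primitive U U1" "primitive U1 U2"
    using W by (auto simp: W22_triple_def)
  have f: "(\<lambda>x. of_real (d x) * U1 x + of_real (p x) * U2 x) \<in> L2 UNIV"
    using L mult_d mult_p by (intro L2_add multiplier_L2)
  have pU1: "(\<lambda>x. of_real (p x) * U1 x) \<in> L2 UNIV" using L mult_p by (intro multiplier_L2)
  have qU: "(\<lambda>x. of_real (q x) * U x) \<in> L2 UNIV" using L mult_q by (intro multiplier_L2)
  have "primitive (\<lambda>x. of_real (p x) * U1 x) (\<lambda>x. of_real (d x) * U1 x + of_real (p x) * U2 x)"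
    using primitive_mult[OF p_primitive pr(2)] by (simp add: mult.commute)
  from L2_parts[OF this primitive_cnj[OF pr(1)] pU1 f L2_cnj[OF L(1)] L2_cnj[OF L(2)]]
  have parts: "(LINT x|lebesgue_on UNIV. (of_real (d x) * U1 x + of_real (p x) * U2 x) * cnj (U x))
    = - (LINT x|lebesgue_on UNIV. of_real (p x) * U1 x * cnj (U1 x))" .
  have sq: "z * cnj z = of_real ((cmod z)\<^sup>2)" for z by (rule complex_norm_square[symmetric])
  have eqs: "of_real (p x) * U1 x * cnj (U1 x) = of_real (p x * (cmod (U1 x))\<^sup>2)"
    "of_real (q x) * U x * cnj (U x) = of_real (q x * (cmod (U x))\<^sup>2)" for x
    by (simp_all add: mult.assoc sq)
  have i1: "integrable (lebesgue_on UNIV) (\<lambda>x. of_real (q x) * U x * cnj (U x))"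
    using L2_mult_integrable[OF qU L2_cnj[OF L(1)]] .
  have i2: "integrable (lebesgue_on UNIV) (\<lambda>x. of_real (p x) * U1 x * cnj (U1 x))"
    using L2_mult_integrable[OF pU1 L2_cnj[OF L(2)]] .
  show "integrable (lebesgue_on UNIV) (\<lambda>x. q x * (cmod (U x))\<^sup>2)" "integrable (lebesgue_on UNIV) (\<lambda>x. p x * (cmod (U1 x))\<^sup>2)"
    using i1 i2 unfolding eqs by (simp_all only: integrable_of_real complex_of_real_integrable_eq)
  have "(LINT x|lebesgue_on UNIV. (of_real (q x) * U x - (of_real (d x) * U1 x + of_real (p x) * U2 x)) * cnj (U x))
    = (LINT x|lebesgue_on UNIV. of_real (q x) * U x * cnj (U x)) - (LINT x|lebesgue_on UNIV. (of_real (d x) * U1 x + of_real (p x) * U2 x) * cnj (U x))"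
    unfolding left_diff_distrib
    by (intro Bochner_Integration.integral_diff i1 L2_mult_integrable[OF f L2_cnj[OF L(1)]])
  also have "\<dots> = of_real ((LINT x|lebesgue_on UNIV. q x * (cmod (U x))\<^sup>2) + (LINT x|lebesgue_on UNIV. p x * (cmod (U1 x))\<^sup>2))"
    unfolding parts eqs integral_complex_of_real by simp
  finally show "(LINT x|lebesgue_on UNIV. (of_real (q x) * U x - (of_real (d x) * U1 x + of_real (p x) * U2 x)) * cnj (U x))
    = of_real ((LINT x|lebesgue_on UNIV. q x * (cmod (U x))\<^sup>2) + (LINT x|lebesgue_on UNIV. p x * (cmod (U1 x))\<^sup>2))" .
qed

text \<open>Symmetry of the operator enters only here: the quadratic form is real, so the cross term of $(H-\xi)u$ and
$i\tau u$ drops out.\<close>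
lemma norm_shift_imaginary:
  assumes "t \<in> W22_triples"
  shows "(norm (SLz p d q (Complex \<xi> \<tau>) t))\<^sup>2 = (norm (SLz p d q (of_real \<xi>) t))\<^sup>2 + \<tau>\<^sup>2 * (norm (fst t))\<^sup>2"
proof -
  obtain U U1 U2 where t: "t = (cls U, cls U1, cls U2)" and W: "W22_triple U U1 U2" using W22_triples_cases[OF assms] .
  define E where "E x = of_real (q x) * U x - (of_real (d x) * U1 x + of_real (p x) * U2 x)" for x
  have E: "E \<in> L2 UNIV" "SL p d q t = cls E" using SL_cls[OF W] unfolding t E_def[abs_def] by auto
  have U: "U \<in> L2 UNIV" using W by (simp add: W22_triple_def)
  define V where "V x = E x - of_real \<xi> * U x" for x
  have V: "V \<in> L2 UNIV" unfolding V_def[abs_def] using E U by (intro L2_diff L2_scale)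
  have Z: "SLz p d q z t = cls (\<lambda>x. E x - z * U x)" "(\<lambda>x. E x - z * U x) \<in> L2 UNIV" for z
    using E U unfolding SLz_def by (simp_all add: t mult_l2_cls cls_diff L2_scale L2_diff)
  have int: "(LINT x|lebesgue_on UNIV. E x * cnj (U x)) \<in> \<real>"
    unfolding E_def quadratic_form(1)[OF W] by simp
  have i: "integrable (lebesgue_on UNIV) (\<lambda>x. E x * cnj (U x))" "integrable (lebesgue_on UNIV) (\<lambda>x. V x * cnj (U x))"
    using E U V L2_mult_integrable L2_cnj by blast+
  have i2: "integrable (lebesgue_on UNIV) (\<lambda>x. of_real (\<xi> * (cmod (U x))\<^sup>2) :: complex)"
    by (intro integrable_of_real integrable_mult_right L2_integrable[OF U])
  have VU: "V x * cnj (U x) = E x * cnj (U x) - of_real (\<xi> * (cmod (U x))\<^sup>2)" for x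
    by (simp add: V_def left_diff_distrib mult.assoc complex_norm_square del: of_real_power)
  have "Im (LINT x|lebesgue_on UNIV. V x * cnj (U x)) = Im (LINT x|lebesgue_on UNIV. E x * cnj (U x))"
    unfolding VU Bochner_Integration.integral_diff[OF i(1) i2] integral_complex_of_real by simp
  also have "\<dots> = 0" using int complex_is_Real_iff by blast
  finally have Im0: "(LINT x|lebesgue_on UNIV. Im (V x * cnj (U x))) = 0"
    using integral_Im[OF i(2)] by simp
  have iIm: "integrable (lebesgue_on UNIV) (\<lambda>x. Im (V x * cnj (U x)))" using i(2) by (rule integrable_Im)
  have pt: "(cmod (E x - Complex \<xi> \<tau> * U x))\<^sup>2 = (cmod (V x))\<^sup>2 + \<tau>\<^sup>2 * (cmod (U x))\<^sup>2 - 2 * \<tau> * Im (V x * cnj (U x))" for x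
  proof -
    have "E x - Complex \<xi> \<tau> * U x = V x - \<i> * of_real \<tau> * U x"
      by (simp add: V_def Complex_eq algebra_simps)
    then show ?thesis
      by (simp only: cmod_power2) (simp add: algebra_simps power2_eq_square)
  qed
  have "(norm (SLz p d q (Complex \<xi> \<tau>) t))\<^sup>2
    = (LINT x|lebesgue_on UNIV. (cmod (V x))\<^sup>2 + \<tau>\<^sup>2 * (cmod (U x))\<^sup>2 - 2 * \<tau> * Im (V x * cnj (U x)))"
    using Z by (simp add: norm_cls l2norm_power2 pt)
  also have "\<dots> = (LINT x|lebesgue_on UNIV. (cmod (V x))\<^sup>2) + \<tau>\<^sup>2 * (LINT x|lebesgue_on UNIV. (cmod (U x))\<^sup>2)"
    using L2_integrable[OF V] L2_integrable[OF U] iIm Im0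
    by (simp add: Bochner_Integration.integral_diff Bochner_Integration.integral_add)
  also have "\<dots> = (norm (SLz p d q (of_real \<xi>) t))\<^sup>2 + \<tau>\<^sup>2 * (norm (fst t))\<^sup>2"
    using Z U by (simp add: norm_cls l2norm_power2 t V_def)
  finally show ?thesis .
qed

text \<open>The quadratic form of $H+B+1$ is at least the square of the norm.\<close>
lemma coercive:
  assumes "t \<in> W22_triples"
  shows "norm (fst t) \<le> norm (SLz p d q (of_real (- (B + 1))) t)"
proof -
  obtain U U1 U2 where t: "t = (cls U, cls U1, cls U2)" and W: "W22_triple U U1 U2" using W22_triples_cases[OF assms] .
  define E where "E x = of_real (q x) * U x - (of_real (d x) * U1 x + of_real (p x) * U2 x)" for x
  have E: "E \<in> L2 UNIV" "SL p d q t = cls E" using SL_cls[OF W] unfolding t E_def[abs_def] by auto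
  have U: "U \<in> L2 UNIV" using W by (simp add: W22_triple_def)
  define V where "V x = E x - of_real (- (B + 1)) * U x" for x
  have V: "V \<in> L2 UNIV" unfolding V_def[abs_def] using E U by (intro L2_diff L2_scale)
  have Z: "SLz p d q (of_real (- (B + 1))) t = cls V"
    using E U unfolding SLz_def V_def[abs_def] by (simp add: t mult_l2_cls cls_diff L2_scale)
  have i: "integrable (lebesgue_on UNIV) (\<lambda>x. E x * cnj (U x))"
    using E U L2_mult_integrable L2_cnj by blast
  have i2: "integrable (lebesgue_on UNIV) (\<lambda>x. of_real ((B + 1) * (cmod (U x))\<^sup>2) :: complex)"
    by (intro integrable_of_real integrable_mult_right L2_integrable[OF U])
  have VU: "V x * cnj (U x) = E x * cnj (U x) + of_real ((B + 1) * (cmod (U x))\<^sup>2)" for x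
    by (simp add: V_def algebra_simps complex_norm_square del: of_real_power)
  have "(LINT x|lebesgue_on UNIV. V x * cnj (U x))
     = of_real ((LINT x|lebesgue_on UNIV. q x * (cmod (U x))\<^sup>2) + (LINT x|lebesgue_on UNIV. p x * (cmod (U1 x))\<^sup>2)
         + (LINT x|lebesgue_on UNIV. (B + 1) * (cmod (U x))\<^sup>2))"
    unfolding VU Bochner_Integration.integral_add[OF i i2] unfolding E_def quadratic_form(1)[OF W] integral_complex_of_real
    by simp
  then have "Re (LINT x|lebesgue_on UNIV. V x * cnj (U x))
     = (LINT x|lebesgue_on UNIV. q x * (cmod (U x))\<^sup>2) + (LINT x|lebesgue_on UNIV. p x * (cmod (U1 x))\<^sup>2)
         + (LINT x|lebesgue_on UNIV. (B + 1) * (cmod (U x))\<^sup>2)" by simp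
  moreover have "(LINT x|lebesgue_on UNIV. p x * (cmod (U1 x))\<^sup>2) \<ge> 0"
    using p_pos by (intro integral_nonneg_AE AE_I2) (simp add: less_imp_le)
  moreover have "(LINT x|lebesgue_on UNIV. (cmod (U x))\<^sup>2)
     \<le> (LINT x|lebesgue_on UNIV. q x * (cmod (U x))\<^sup>2 + (B + 1) * (cmod (U x))\<^sup>2)"
  proof (rule integral_mono)
    show "(cmod (U x))\<^sup>2 \<le> q x * (cmod (U x))\<^sup>2 + (B + 1) * (cmod (U x))\<^sup>2" for x
    proof -
      have "1 * (cmod (U x))\<^sup>2 \<le> (q x + (B + 1)) * (cmod (U x))\<^sup>2"
        using q_bound[of x] by (intro mult_right_mono) auto
      then show ?thesis by (simp add: algebra_simps)
    qed
  qed (use L2_integrable[OF U] quadratic_form(2)[OF W] in auto)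
  moreover have "\<dots> = (LINT x|lebesgue_on UNIV. q x * (cmod (U x))\<^sup>2) + (LINT x|lebesgue_on UNIV. (B + 1) * (cmod (U x))\<^sup>2)"
    using L2_integrable[OF U] quadratic_form(2)[OF W] by (intro Bochner_Integration.integral_add) auto
  ultimately have "(l2norm UNIV U)\<^sup>2 \<le> Re (LINT x|lebesgue_on UNIV. V x * cnj (U x))"
    by (simp add: l2norm_power2)
  also have "\<dots> \<le> cmod (LINT x|lebesgue_on UNIV. V x * cnj (U x))" by (rule complex_Re_le_cmod)
  also have "\<dots> \<le> l2norm UNIV V * l2norm UNIV (\<lambda>x. cnj (U x))"
    by (rule L2_Cauchy_Schwarz[OF V L2_cnj[OF U]])
  also have "l2norm UNIV (\<lambda>x. cnj (U x)) = l2norm UNIV U" by (simp add: l2norm_def)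
  finally have "l2norm UNIV U * l2norm UNIV U \<le> l2norm UNIV V * l2norm UNIV U" by (simp add: power2_eq_square)
  then have "l2norm UNIV U \<le> l2norm UNIV V"
    by (cases "l2norm UNIV U = 0") (simp_all add: mult_le_cancel_right less_le)
  then show ?thesis using U V Z by (simp add: t norm_cls)
qed

end

text \<open>Integrate $u'\overline{u'}$ by parts.\<close>
lemma interpolation:
  assumes "t \<in> W22_triples"
  shows "(norm (fst (snd t)))\<^sup>2 \<le> norm (fst t) * norm (snd (snd t))"
proof -
  obtain U U1 U2 where t: "t = (cls U, cls U1, cls U2)" and W: "W22_triple U U1 U2" using W22_triples_cases[OF assms] .
  have L: "U \<in> L2 UNIV" "U1 \<in> L2 UNIV" "U2 \<in> L2 UNIV" and pr: "primitive U U1" "primitive U1 U2"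
    using W by (auto simp: W22_triple_def)
  have "(LINT x|lebesgue_on UNIV. U1 x * cnj (U1 x)) = of_real ((l2norm UNIV U1)\<^sup>2)"
    unfolding l2norm_power2 complex_norm_square[symmetric] by (simp add: integral_complex_of_real del: of_real_power flip: of_real_power)
  then have "(l2norm UNIV U1)\<^sup>2 = cmod (LINT x|lebesgue_on UNIV. U1 x * cnj (U1 x))"
    by (simp del: of_real_power)
  also have "\<dots> = cmod (LINT x|lebesgue_on UNIV. U x * cnj (U2 x))"
    using L2_parts[OF pr(1) primitive_cnj[OF pr(2)] L(1,2) L2_cnj[OF L(2)] L2_cnj[OF L(3)]] by simp
  also have "\<dots> \<le> l2norm UNIV U * l2norm UNIV (\<lambda>x. cnj (U2 x))"
    by (rule L2_Cauchy_Schwarz[OF L(1) L2_cnj[OF L(3)]])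
  also have "l2norm UNIV (\<lambda>x. cnj (U2 x)) = l2norm UNIV U2" by (simp add: l2norm_def)
  finally show ?thesis using L by (simp add: t norm_cls)
qed

lemma norm_first_derivative:
  assumes "t \<in> W22_triples"
  shows "norm (fst (snd t)) \<le> norm (fst t) + norm (snd (snd t))"
proof -
  have "2 * norm (fst (snd t)) \<le> 1 * norm (fst t) + norm (snd (snd t)) / 1"
    by (rule weighted_arith_geo_mean[OF interpolation[OF assms]]) auto
  then show ?thesis using norm_ge_zero[of "fst t"] norm_ge_zero[of "snd (snd t)"] by linarith
qed

context coeffs begin

text \<open>The equation gives $p_0\|u''\| \le \|Hu\| + B\|u'\| + B\|u\|$, and interpolation absorbs the term with $u'$
into half of the left-hand side.\<close>
lemma norm_second_derivative:
  assumes "t \<in> W22_triples"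
  shows "p0 * norm (snd (snd t)) \<le> 2 * norm (SL p d q t) + (B\<^sup>2 / p0 + 2 * B) * norm (fst t)"
proof -
  obtain x x1 x2 where t: "t = (x, x1, x2)" by (cases t) auto
  have "rmult p x2 = rmult q x - rmult d x1 - SL p d q t" by (simp add: SL_def t)
  then have "norm (rmult p x2) \<le> norm (rmult q x) + norm (rmult d x1) + norm (SL p d q t)"
    using norm_triangle_ineq4[of "rmult q x - rmult d x1" "SL p d q t"] norm_triangle_ineq4[of "rmult q x" "rmult d x1"]
    by simp
  then have 1: "p0 * norm x2 \<le> B * norm x + B * norm x1 + norm (SL p d q t)"
    using norm_rmult_p[of x2] norm_rmult[OF measurable_q q_bound, of x] norm_rmult[OF measurable_d d_bound, of x1] by linarith
  have "2 * norm x1 \<le> B / p0 * norm x + norm x2 / (B / p0)"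
    using interpolation[OF assms] B_pos p0_pos by (intro weighted_arith_geo_mean) (auto simp: t)
  then have "B * (2 * norm x1) \<le> B * (B / p0 * norm x + norm x2 / (B / p0))"
    using B_pos by (intro mult_left_mono) auto
  also have "\<dots> = B\<^sup>2 / p0 * norm x + p0 * norm x2"
    using B_pos p0_pos by (simp add: field_simps power2_eq_square)
  finally show ?thesis using 1 by (simp add: t algebra_simps)
qed

end

section \<open>Solving the free equation\<close>

lemma L2_affine:
  assumes f: "f \<in> L2 UNIV" and c: "\<bar>c\<bar> = 1"
  shows "(\<lambda>x. f (s + c * x)) \<in> L2 UNIV" "l2norm UNIV (\<lambda>x. f (s + c * x)) = l2norm UNIV f"
proof -
  have c0: "c \<noteq> 0" using c by auto
  have m: "(\<lambda>x. s + c * x) \<in> lebesgue \<rightarrow>\<^sub>M lebesgue"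
    using lebesgue_affine_measurable[of "\<lambda>_. c" s] c0 by simp
  have "(\<lambda>x. f (s + c * x)) \<in> borel_measurable lebesgue"
    by (rule measurable_compose[OF m L2_UNIV_measurable[OF f]])
  moreover have "integrable lebesgue (\<lambda>x. (cmod (f (s + c * x)))\<^sup>2)"
    using L2_integrable[OF f] lebesgue_integrable_real_affine_iff[OF c0, of "\<lambda>x. (cmod (f x))\<^sup>2" s]
    by (simp add: lebesgue_on_UNIV_eq)
  ultimately show "(\<lambda>x. f (s + c * x)) \<in> L2 UNIV" by (simp add: L2_def lebesgue_on_UNIV_eq)
  show "l2norm UNIV (\<lambda>x. f (s + c * x)) = l2norm UNIV f"
    using lebesgue_integral_real_affine[OF c0, of "\<lambda>x. (cmod (f x))\<^sup>2" s] c
    by (simp add: l2norm_def lebesgue_on_UNIV_eq)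
qed

lemma primitive_reflect:
  assumes "primitive F f"
  shows "primitive (\<lambda>x. F (- x)) (\<lambda>x. - f (- x))"
proof (rule primitiveI)
  fix x y :: real assume xy: "x \<le> y"
  have i: "f integrable_on {-y..-x}" "(\<lambda>t. norm (f t)) integrable_on {-y..-x}"
    using primitive_integrable[OF assms, of "-y" "-x"] by (auto simp: absolutely_integrable_on_def)
  have j: "(\<lambda>t. f (- t)) integrable_on {x..y}" "(\<lambda>t. norm (f (- t))) integrable_on {x..y}"
    using i Henstock_Kurzweil_Integration.integrable_reflect_real[of f "-x" "-y"]
      Henstock_Kurzweil_Integration.integrable_reflect_real[of "\<lambda>t. norm (f t)" "-x" "-y"] by simp_all
  show "(\<lambda>x. - f (- x)) absolutely_integrable_on {x..y}"
    using j integrable_neg[OF j(1)] by (simp add: absolutely_integrable_on_def)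
  have "integral {x..y} (\<lambda>t. - f (- t)) = - integral {x..y} (\<lambda>t. f (- t))" by simp
  also have "integral {x..y} (\<lambda>t. f (- t)) = integral {-y..-x} f"
    using Henstock_Kurzweil_Integration.integral_reflect_real[of "-x" "-y" f] by simp
  finally show "F (- y) - F (- x) = integral {x..y} (\<lambda>x. - f (- x))"
    using primitive_diff[OF assms, of "-y" "-x"] xy by (simp add: algebra_simps)
qed

text \<open>For a continuous function, square integrability follows from a bound on all symmetric truncations by Fatou's
lemma.\<close>
lemma L2_of_bounded_truncations:
  assumes c: "continuous_on UNIV v" and K: "\<And>R. R > 0 \<Longrightarrow> integral {-R..R} (\<lambda>x. (cmod (v x))\<^sup>2) \<le> K"
  shows "v \<in> L2 UNIV"
proof -
  have m: "v \<in> borel_measurable lebesgue"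
    using c by (intro measurable_completion) (simp add: borel_measurable_continuous_onI)
  have cc: "continuous_on A (\<lambda>x. (cmod (v x))\<^sup>2)" for A
    using c continuous_on_subset by (intro continuous_intros) blast
  let ?f = "\<lambda>n x. ennreal (indicator {- real (Suc n)..real (Suc n)} x * (cmod (v x))\<^sup>2)"
  have ind: "(\<lambda>x. indicator {- real (Suc n)..real (Suc n)} x * (cmod (v x))\<^sup>2) \<in> borel_measurable lebesgue" for n
    using m by (intro borel_measurable_times borel_measurable_indicator borel_measurable_power borel_measurable_norm) auto
  have "(\<integral>\<^sup>+x. ennreal ((cmod (v x))\<^sup>2) \<partial>lebesgue) = (\<integral>\<^sup>+x. liminf (\<lambda>n. ?f n x) \<partial>lebesgue)"
  proof (rule nn_integral_cong)
    fix x :: real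
    obtain n0 :: nat where n0: "\<bar>x\<bar> \<le> real n0" using real_arch_simple by blast
    have "\<forall>\<^sub>F n in sequentially. ennreal ((cmod (v x))\<^sup>2) = ?f n x"
      using eventually_ge_at_top[of n0]
    proof eventually_elim
      case (elim n)
      then have "x \<in> {- real (Suc n)..real (Suc n)}" using n0 by (auto simp: abs_le_iff)
      then show ?case by simp
    qed
    then have "(\<lambda>n. ?f n x) \<longlonglongrightarrow> ennreal ((cmod (v x))\<^sup>2)"
      by (rule Lim_transform_eventually[OF tendsto_const])
    then show "ennreal ((cmod (v x))\<^sup>2) = liminf (\<lambda>n. ?f n x)"
      by (rule lim_imp_Liminf[OF sequentially_bot, symmetric])
  qed
  also have "\<dots> \<le> liminf (\<lambda>n. \<integral>\<^sup>+x. ?f n x \<partial>lebesgue)"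
    by (intro nn_integral_liminf measurable_compose[OF ind measurable_ennreal])
  also have "\<dots> \<le> liminf (\<lambda>n::nat. ennreal K)"
  proof (intro Liminf_mono always_eventually allI)
    fix n
    have ai: "(\<lambda>x. (cmod (v x))\<^sup>2) absolutely_integrable_on {- real (Suc n)..real (Suc n)}"
      by (rule absolutely_integrable_continuous_real[OF cc])
    have "(\<integral>\<^sup>+x. ?f n x \<partial>lebesgue) = ennreal (LINT x|lebesgue. indicator {- real (Suc n)..real (Suc n)} x * (cmod (v x))\<^sup>2)"
      using ai by (intro nn_integral_eq_integral) (auto simp: set_integrable_def)
    also have "(LINT x|lebesgue. indicator {- real (Suc n)..real (Suc n)} x * (cmod (v x))\<^sup>2)
        = integral {- real (Suc n)..real (Suc n)} (\<lambda>x. (cmod (v x))\<^sup>2)"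
      using set_lebesgue_integral_eq_integral(2)[OF ai] by (simp add: set_lebesgue_integral_def)
    finally show "(\<integral>\<^sup>+x. ?f n x \<partial>lebesgue) \<le> ennreal K"
      using K[of "real (Suc n)"] by (simp add: ennreal_leI)
  qed
  also have "\<dots> = ennreal K" by (simp add: Liminf_const)
  finally show ?thesis
    unfolding L2_iff_nn_integral[OF m] by (simp add: le_less_trans)
qed

lemma exp_tail_L2:
  fixes x :: real
  defines "e \<equiv> \<lambda>y. complex_of_real (indicator {x..} y * exp (- y))"
  shows "e \<in> L2 UNIV" "(l2norm UNIV e)\<^sup>2 = exp (- 2 * x) / 2"
proof -
  have "((\<lambda>y::real. exp (- 2 * y)) has_integral exp (- 2 * x) / 2) {x..}"
    by (rule has_integral_exp_minus_to_infinity) simp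
  then have ai: "(\<lambda>y. exp (- 2 * y)) absolutely_integrable_on {x..}"
    and I: "integral {x..} (\<lambda>y. exp (- 2 * y)) = exp (- 2 * x) / 2"
    by (auto intro!: nonnegative_absolutely_integrable_1 simp: has_integral_iff)
  have sq: "(cmod (e y))\<^sup>2 = indicator {x..} y *\<^sub>R exp (- 2 * y)" for y
    by (auto simp: e_def indicator_def norm_mult power2_eq_square simp flip: exp_add)
  have "continuous_on UNIV (\<lambda>y::real. exp (- y))" by (intro continuous_intros)
  then have "(\<lambda>y::real. exp (- y)) \<in> borel_measurable lebesgue"
    by (intro measurable_completion) (simp add: borel_measurable_continuous_onI)
  then have "(\<lambda>y. indicator {x..} y * exp (- y)) \<in> borel_measurable lebesgue"
    by (intro borel_measurable_times borel_measurable_indicator) auto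
  then have "e \<in> borel_measurable lebesgue" unfolding e_def by measurable
  then show "e \<in> L2 UNIV"
    using ai by (simp add: L2_def lebesgue_on_UNIV_eq sq set_integrable_def)
  show "(l2norm UNIV e)\<^sup>2 = exp (- 2 * x) / 2"
    using set_lebesgue_integral_eq_integral(2)[OF ai] I
    by (simp add: l2norm_power2 lebesgue_on_UNIV_eq sq set_lebesgue_integral_def)
qed

text \<open>The solution of $v-v'=f$ is $v(x)=e^x\int_x^\infty e^{-y}f(y)\,dy$. The Cauchy--Schwarz inequality bounds
$v$ by $\|f\|$. Integrating $(|v|^2)' = 2\,\mathrm{Re}\,\overline v(v-f) \ge |v|^2-|f|^2$ over a symmetric
interval then bounds the truncations of $\int|v|^2$.\<close>
lemma first_order_solution:
  assumes f: "f \<in> L2 UNIV"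
  obtains v where "v \<in> L2 UNIV" "primitive v (\<lambda>x. v x - f x)"
proof -
  define e where "e x y = complex_of_real (indicator {x..} y * exp (- y))" for x y :: real
  have e: "e x \<in> L2 UNIV" "(l2norm UNIV (e x))\<^sup>2 = exp (- 2 * x) / 2" for x
    using exp_tail_L2[of x] by (simp_all add: e_def[abs_def])
  define W where "W x = - (LINT y|lebesgue. e x y * f y)" for x
  define g where "g y = of_real (exp (- y)) * f y" for y
  have ef: "e x y * f y = indicator {x..} y *\<^sub>R g y" for x y by (simp add: e_def g_def scaleR_conv_of_real)
  have ig: "set_integrable lebesgue {x..} g" for x
    using L2_mult_integrable[OF e(1) f, of x] by (simp add: lebesgue_on_UNIV_eq set_integrable_def ef)
  have ig': "g absolutely_integrable_on {x..y}" for x y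
    by (rule set_integrable_subset[OF ig[of x]]) auto
  have W: "primitive W g"
  proof (rule primitiveI)
    fix x y :: real assume xy: "x \<le> y"
    have "integral {x..} g = integral {x..y} g + integral {y..} g"
    proof -
      have "integral ({x..y} \<union> {y..}) g = integral {x..y} g + integral {y..} g"
        by (rule Henstock_Kurzweil_Integration.integral_Un)
          (auto intro!: absolutely_integrable_integrable ig ig' negligible_subset[OF negligible_sing[of y]])
      moreover have "{x..y} \<union> {y..} = {x..}" using xy by auto
      ultimately show ?thesis by simp
    qed
    moreover have "W z = - integral {z..} g" for z
      using set_lebesgue_integral_eq_integral(2)[OF ig[of z]] by (simp add: W_def ef set_lebesgue_integral_def)
    ultimately show "W y - W x = integral {x..y} g" by simp
  qed (rule ig')
  define v where "v x = - of_real (exp x) * W x" for x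
  have ex: "primitive (\<lambda>x. complex_of_real (exp x)) (\<lambda>x. complex_of_real (exp x))"
    by (rule primitive_C1) (auto intro!: continuous_intros derivative_eq_intros has_vector_derivative_of_real
        simp: has_real_derivative_iff_has_vector_derivative[symmetric])
  have "primitive (\<lambda>x. - (of_real (exp x) * W x)) (\<lambda>x. - (W x * of_real (exp x) + of_real (exp x) * g x))"
    by (rule primitive_uminus[OF primitive_mult[OF ex W]])
  moreover have "complex_of_real (exp x) * g x = f x" for x
    by (simp add: g_def mult.assoc[symmetric] exp_minus flip: of_real_mult)
  ultimately have pv: "primitive v (\<lambda>x. v x - f x)"
    by (simp add: v_def[abs_def] algebra_simps)
  have bound: "(cmod (v x))\<^sup>2 \<le> (l2norm UNIV f)\<^sup>2" for x
  proof -
    have "cmod (W x) \<le> l2norm UNIV (e x) * l2norm UNIV f"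
      using L2_Cauchy_Schwarz[OF e(1)[of x] f] by (simp add: W_def lebesgue_on_UNIV_eq)
    then have "(cmod (W x))\<^sup>2 \<le> (l2norm UNIV (e x) * l2norm UNIV f)\<^sup>2" by (intro power_mono) auto
    also have "\<dots> = exp (- 2 * x) / 2 * (l2norm UNIV f)\<^sup>2" by (simp only: power_mult_distrib e)
    finally have "(exp x)\<^sup>2 * (cmod (W x))\<^sup>2 \<le> (exp x)\<^sup>2 * (exp (- 2 * x) / 2 * (l2norm UNIV f)\<^sup>2)"
      by (intro mult_left_mono) auto
    also have "\<dots> = ((exp x)\<^sup>2 * exp (- 2 * x)) * ((l2norm UNIV f)\<^sup>2 / 2)" by simp
    also have "(exp x)\<^sup>2 * exp (- 2 * x) = 1" by (simp add: power2_eq_square flip: exp_add)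
    finally have "2 * ((exp x)\<^sup>2 * (cmod (W x))\<^sup>2) \<le> (l2norm UNIV f)\<^sup>2" by simp
    moreover have "0 \<le> (exp x)\<^sup>2 * (cmod (W x))\<^sup>2" by simp
    moreover have "(cmod (v x))\<^sup>2 = (exp x)\<^sup>2 * (cmod (W x))\<^sup>2" by (simp add: v_def norm_mult power_mult_distrib)
    ultimately show ?thesis by linarith
  qed
  have "v \<in> L2 UNIV"
  proof (rule L2_of_bounded_truncations[OF primitive_continuous[OF pv]])
    fix R :: real assume R: "R > 0"
    have cv: "continuous_on A v" for A using primitive_continuous[OF pv] continuous_on_subset by blast
    let ?h = "\<lambda>x. cnj (v x) * (v x - f x) + v x * cnj (v x - f x)"
    note pm = primitive_mult[OF pv primitive_cnj[OF pv]]
    have hi: "?h absolutely_integrable_on {-R..R}" using primitive_integrable[OF pm] .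
    have Reh: "(\<lambda>x. Re (?h x)) integrable_on {-R..R}" 
      using integrable_linear[OF absolutely_integrable_integrable[OF hi] bounded_linear_Re] by (simp add: o_def)
    have "Re (v R * cnj (v R) - v (-R) * cnj (v (-R))) = Re (integral {-R..R} ?h)"
      using primitive_diff[OF pm, of "-R" R] R by simp
    also have "\<dots> = integral {-R..R} (\<lambda>x. Re (?h x))"
      using integral_linear[OF absolutely_integrable_integrable[OF hi] bounded_linear_Re] by (simp add: o_def)
    finally have E: "integral {-R..R} (\<lambda>x. Re (?h x)) = (cmod (v R))\<^sup>2 - (cmod (v (-R)))\<^sup>2"
      by (simp only: complex_norm_square[symmetric] minus_complex.sel Re_complex_of_real)
    have fi: "(\<lambda>x. (cmod (f x))\<^sup>2) integrable_on UNIV" "integral UNIV (\<lambda>x. (cmod (f x))\<^sup>2) = (l2norm UNIV f)\<^sup>2"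
    proof -
      have "set_integrable lebesgue UNIV (\<lambda>x. (cmod (f x))\<^sup>2)"
        using L2_integrable[OF f] by (simp add: lebesgue_on_UNIV_eq set_integrable_def)
      from set_lebesgue_integral_eq_integral[OF this] show "(\<lambda>x. (cmod (f x))\<^sup>2) integrable_on UNIV"
        "integral UNIV (\<lambda>x. (cmod (f x))\<^sup>2) = (l2norm UNIV f)\<^sup>2"
        by (simp_all add: l2norm_power2 lebesgue_on_UNIV_eq set_lebesgue_integral_def)
    qed
    have fi2: "(\<lambda>x. (cmod (f x))\<^sup>2) integrable_on {-R..R}"
      using integrable_on_subinterval[OF fi(1)] by simp
    have vi: "(\<lambda>x. (cmod (v x))\<^sup>2) integrable_on {-R..R}"
      by (intro integrable_continuous_real continuous_intros cv)
    have "integral {-R..R} (\<lambda>x. (cmod (v x))\<^sup>2) \<le> integral {-R..R} (\<lambda>x. Re (?h x) + (cmod (f x))\<^sup>2)"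
    proof (rule integral_le[OF vi integrable_add[OF Reh fi2]])
      fix x
      have "0 \<le> (cmod (v x - f x))\<^sup>2" by simp
      then show "(cmod (v x))\<^sup>2 \<le> Re (?h x) + (cmod (f x))\<^sup>2"
        unfolding cmod_power2 by (simp add: algebra_simps power2_eq_square)
    qed
    also have "\<dots> = (cmod (v R))\<^sup>2 - (cmod (v (-R)))\<^sup>2 + integral {-R..R} (\<lambda>x. (cmod (f x))\<^sup>2)"
      using Reh fi2 E by (simp add: Henstock_Kurzweil_Integration.integral_add)
    also have "\<dots> \<le> (l2norm UNIV f)\<^sup>2 + integral UNIV (\<lambda>x. (cmod (f x))\<^sup>2)"
    proof -
      have "integral {-R..R} (\<lambda>x. (cmod (f x))\<^sup>2) \<le> integral UNIV (\<lambda>x. (cmod (f x))\<^sup>2)"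
        by (rule integral_subset_le[OF _ fi2 fi(1)]) auto
      then show ?thesis using bound[of R] zero_le_power2[of "cmod (v (-R))"] by linarith
    qed
    finally show "integral {-R..R} (\<lambda>x. (cmod (v x))\<^sup>2) \<le> (l2norm UNIV f)\<^sup>2 + (l2norm UNIV f)\<^sup>2"
      using fi(2) by simp
  qed
  then show thesis using pv by (rule that)
qed

text \<open>Since $1-\partial^2=(1-\partial)(1+\partial)$, two first-order equations suffice; the second is the reflection of
the first.\<close>
lemma free_equation_solvable:
  assumes f: "f \<in> L2 UNIV"
  obtains u u1 where "W22_triple u u1 (\<lambda>x. u x - f x)"
proof -
  obtain v where v: "v \<in> L2 UNIV" "primitive v (\<lambda>x. v x - f x)" using first_order_solution[OF f] .
  have "(\<lambda>x. v (- x)) \<in> L2 UNIV" using L2_affine(1)[OF v(1), of "-1" 0] by simp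
  then obtain w where w: "w \<in> L2 UNIV" "primitive w (\<lambda>x. w x - v (- x))" using first_order_solution by blast
  define u where "u x = w (- x)" for x
  have u: "u \<in> L2 UNIV" unfolding u_def[abs_def] using L2_affine(1)[OF w(1), of "-1" 0] by simp
  have pu: "primitive u (\<lambda>x. v x - u x)" using primitive_reflect[OF w(2)] by (simp add: u_def[abs_def])
  have "primitive (\<lambda>x. v x - u x) (\<lambda>x. (v x - f x) - (v x - u x))" by (rule primitive_minus[OF v(2) pu])
  then have "primitive (\<lambda>x. v x - u x) (\<lambda>x. u x - f x)" by simp
  with pu have "W22_triple u (\<lambda>x. v x - u x) (\<lambda>x. u x - f x)"
    using u v(1) f by (simp add: W22_triple_def L2_diff)
  then show thesis by (rule that)
qed

section \<open>The method of continuity\<close>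

text \<open>A right inverse \<open>R\<close> of \<open>A\<close>, not assumed linear, reduces \<open>A' u = y\<close> to a
fixed point of $x \mapsto y-(A'-A)Rx$, which is a contraction because $A$ maps $Rx-Rz$ to $x-z$.\<close>
lemma continuity_method_step:
  fixes A A' :: "'d::real_normed_vector \<Rightarrow> 'x::banach"
  assumes D: "subspace D" and A: "linear A" "linear A'"
    and surj: "\<forall>y. \<exists>u\<in>D. A u = y"
    and close: "\<And>u. u \<in> D \<Longrightarrow> norm (A' u - A u) \<le> k * norm (A u)" and k: "0 \<le> k" "k < 1"
  shows "\<forall>y. \<exists>u\<in>D. A' u = y"
proof
  fix y
  obtain R where R: "\<And>x. R x \<in> D" "\<And>x. A (R x) = x" using surj by metis
  let ?\<Phi> = "\<lambda>x. y - (A' (R x) - A (R x))"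
  have "dist (?\<Phi> x) (?\<Phi> z) \<le> k * dist x z" for x z
  proof -
    have "?\<Phi> x - ?\<Phi> z = - (A' (R x - R z) - A (R x - R z))"
      by (simp add: linear_diff[OF A(1)] linear_diff[OF A(2)])
    then have "dist (?\<Phi> x) (?\<Phi> z) = norm (A' (R x - R z) - A (R x - R z))"
      unfolding dist_norm by (simp only: norm_minus_cancel)
    also have "\<dots> \<le> k * norm (A (R x - R z))"
      by (rule close) (simp add: subspace_diff[OF D] R)
    finally show ?thesis by (simp add: linear_diff[OF A(1)] R dist_norm)
  qed
  then have "\<exists>!x. ?\<Phi> x = x" using k by (intro banach_fix_type) auto
  then obtain x where "?\<Phi> x = x" by blast
  then have "A' (R x) = y" by (simp add: R algebra_simps)
  then show "\<exists>u\<in>D. A' u = y" using R(1) by blast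
qed

lemma continuity_method:
  fixes A :: "real \<Rightarrow> 'd::real_normed_vector \<Rightarrow> 'x::banach"
  assumes D: "subspace D" and A: "\<And>t. linear (A t)"
    and close: "\<And>s t u. s \<in> {0..1} \<Longrightarrow> t \<in> {0..1} \<Longrightarrow> u \<in> D \<Longrightarrow> norm (A s u - A t u) \<le> K * \<bar>s - t\<bar> * norm (A t u)"
    and surj: "\<forall>y. \<exists>u\<in>D. A 0 u = y"
  shows "\<forall>y. \<exists>u\<in>D. A 1 u = y"
proof -
  obtain n :: nat where n: "\<bar>K\<bar> < real n" using reals_Archimedean2 by blast
  then have n0: "0 < real n" by linarith
  have "\<forall>y. \<exists>u\<in>D. A (real j / real n) u = y" if "j \<le> n" for j
    using that
  proof (induction j)
    case 0
    then show ?case using surj by simp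
  next
    case (Suc j)
    show ?case
    proof (rule continuity_method_step[OF D A A])
      show "\<forall>y. \<exists>u\<in>D. A (real j / real n) u = y" using Suc by simp
      show "norm (A (real (Suc j) / real n) u - A (real j / real n) u) \<le> \<bar>K\<bar> / real n * norm (A (real j / real n) u)"
        if "u \<in> D" for u
      proof -
        have "norm (A (real (Suc j) / real n) u - A (real j / real n) u)
            \<le> K * \<bar>real (Suc j) / real n - real j / real n\<bar> * norm (A (real j / real n) u)"
          using Suc.prems n0 that by (intro close) (auto simp: field_simps)
        also have "real (Suc j) / real n - real j / real n = 1 / real n"
          using n0 by (simp add: field_simps)
        also have "K * \<bar>1 / real n\<bar> * norm (A (real j / real n) u) \<le> \<bar>K\<bar> / real n * norm (A (real j / real n) u)"
          using n0 by (intro mult_right_mono) (auto simp: divide_right_mono)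
        finally show ?thesis .
      qed
      show "0 \<le> \<bar>K\<bar> / real n" "\<bar>K\<bar> / real n < 1" using n n0 by auto
    qed
  qed
  from this[of n] show ?thesis using n0 by simp
qed

text \<open>Surjectivity of $H-z$ on $W_2^2(\mathbb{R})$, the property that is carried along paths of $z$ and of coefficients.\<close>
definition surj_at :: "(real \<Rightarrow> real) \<Rightarrow> (real \<Rightarrow> real) \<Rightarrow> (real \<Rightarrow> real) \<Rightarrow> complex \<Rightarrow> bool" where
  "surj_at p d q z \<longleftrightarrow> (\<forall>y. \<exists>t\<in>W22_triples. SLz p d q z t = y)"

text \<open>At this point the operator with constant coefficients $1,0,-c$ is $u \mapsto -u''+u$, whatever \<open>c\<close>
is.\<close>
lemma surj_at_free: "surj_at (\<lambda>_. 1) (\<lambda>_. 0) (\<lambda>_. - c) (of_real (- (c + 1)))"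
  unfolding surj_at_def
proof
  fix y :: l2
  obtain f where f: "y = cls f" "f \<in> L2 UNIV" by (rule cls_cases)
  obtain u u1 where W: "W22_triple u u1 (\<lambda>x. u x - f x)" using free_equation_solvable[OF f(2)] .
  have 1: "rmult (\<lambda>_. r) x = r *\<^sub>R x" for r x by (rule mult_l2_of_real)
  have u: "u \<in> L2 UNIV" using W by (simp add: W22_triple_def)
  have "SLz (\<lambda>_. 1) (\<lambda>_. 0) (\<lambda>_. - c) (of_real (- (c + 1))) (cls u, cls u1, cls (\<lambda>x. u x - f x)) = y"
    unfolding SLz_def SL_def fst_conv snd_conv 1 using f u
    by (simp add: cls_diff[symmetric] algebra_simps)
  then show "\<exists>t\<in>W22_triples. SLz (\<lambda>_. 1) (\<lambda>_. 0) (\<lambda>_. - c) (of_real (- (c + 1))) t = y"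
    using W unfolding W22_triples_def by blast
qed

lemma mult_l2_combination:
  assumes "multiplier m" "multiplier n"
  shows "mult_l2 (\<lambda>x. of_real a * m x + of_real b * n x) x = a *\<^sub>R mult_l2 m x + b *\<^sub>R mult_l2 n x"
proof -
  have am: "multiplier (\<lambda>x. of_real a * m x)" "multiplier (\<lambda>x. of_real b * n x)"
    using assms by (auto intro: mult_mult_l2(2))
  obtain A B where AB: "\<And>x. cmod (of_real a * m x) \<le> A" "\<And>x. cmod (of_real b * n x) \<le> B"
    using am by (auto simp: multiplier_def)
  have "cmod (of_real a * m x + of_real b * n x) \<le> A + B" for x
    by (rule norm_triangle_mono[OF AB])
  then have m: "multiplier (\<lambda>x. of_real a * m x + of_real b * n x)"
    using am unfolding multiplier_def by (intro conjI borel_measurable_add) auto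
  obtain u where u: "x = cls u" "u \<in> L2 UNIV" by (rule cls_cases)
  have L: "(\<lambda>x. m x * u x) \<in> L2 UNIV" "(\<lambda>x. n x * u x) \<in> L2 UNIV" using assms u multiplier_L2 by auto
  then have "a *\<^sub>R cls (\<lambda>x. m x * u x) + b *\<^sub>R cls (\<lambda>x. n x * u x) = cls (\<lambda>x. of_real a * (m x * u x) + of_real b * (n x * u x))"
    by (simp add: cls_scaleR cls_add L2_scale scaleR_conv_of_real)
  then show ?thesis using m assms u by (simp add: mult_l2_cls algebra_simps)
qed

context coeffs begin

lemma norm_SL:
  "norm (SL p d q t) \<le> B * (norm (fst t) + norm (fst (snd t)) + norm (snd (snd t)))"
proof -
  have "norm (SL p d q t) \<le> norm (rmult q (fst t)) + (norm (rmult d (fst (snd t))) + norm (rmult p (snd (snd t))))"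
    unfolding SL_def by (rule order_trans[OF norm_triangle_ineq4 add_left_mono[OF norm_triangle_ineq]])
  then show ?thesis
    using norm_rmult[OF measurable_q q_bound, of "fst t"] norm_rmult[OF measurable_d d_bound, of "fst (snd t)"]
      norm_rmult[OF measurable_p abs_p, of "snd (snd t)"]
    by (simp add: algebra_simps)
qed

lemma W22_bound:
  assumes "t \<in> W22_triples"
  shows "norm (fst t) + norm (fst (snd t)) + norm (snd (snd t))
    \<le> (2 + 2 * (2 + B\<^sup>2 / p0 + 2 * B) / p0) * (norm (SL p d q t) + norm (fst t))"
proof -
  let ?N = "norm (SL p d q t)" and ?x = "norm (fst t)" and ?x2 = "norm (snd (snd t))"
  let ?k = "2 + B\<^sup>2 / p0 + 2 * B"
  have k: "?k \<ge> 2" using B_pos p0_pos by simp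
  have "p0 * ?x2 \<le> 2 * ?N + (B\<^sup>2 / p0 + 2 * B) * ?x" by (rule norm_second_derivative[OF assms])
  also have "\<dots> \<le> ?k * ?N + ?k * ?x" using k B_pos p0_pos by (intro add_mono mult_right_mono) auto
  finally have "?x2 * p0 \<le> ?k * (?N + ?x)" by (simp only: mult.commute[of ?x2] distrib_left)
  then have "?x2 \<le> ?k * (?N + ?x) / p0" by (simp only: pos_le_divide_eq[OF p0_pos])
  then have "?x2 \<le> ?k / p0 * (?N + ?x)" by simp
  moreover have "norm (fst (snd t)) \<le> ?x + ?x2" by (rule norm_first_derivative[OF assms])
  moreover have "?x \<le> ?N + ?x" by simp
  moreover have arith: "x + x1 + x2 \<le> 2 * M + 2 * Y" if "x2 \<le> Y" "x1 \<le> x + x2" "x \<le> M" for x x1 x2 M Y :: real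
    using that by linarith
  ultimately have "?x + norm (fst (snd t)) + ?x2 \<le> 2 * (?N + ?x) + 2 * (?k / p0 * (?N + ?x))" by blast
  moreover have "2 * M + 2 * (k / p0 * M) = (2 + 2 * k / p0) * M" for k M
    by (simp add: algebra_simps)
  ultimately show ?thesis by (simp only:)
qed

text \<open>The coefficients are joined by a segment with $1,0,-b$. Along it the coercivity estimate and the bound in $W_2^2$
hold with the same constants. Here \<open>b\<close> is at least $1$ in order to bound the coefficient $1$.\<close>
lemma surj_coercive:
  defines "b \<equiv> max B 1"
  shows "surj_at p d q (of_real (- (b + 1)))"
proof -
  define pt dt qt where "pt s x = (1 - s) * 1 + s * p x" and "dt s x = (1 - s) * 0 + s * d x"
    and "qt s x = (1 - s) * (- b) + s * q x" for s x
  let ?k0 = "min p0 1"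
  have b: "b \<ge> 1" "b \<ge> B" by (auto simp: b_def)
  have co: "coeffs (pt s) (dt s) (qt s) ?k0 b" if s: "s \<in> {0..1}" for s
  proof
    have pq: "(1 - s) * u + s * v \<le> w" if "u \<le> w" "v \<le> w" for u v w :: real
      using s that convex_bound_le[of u w v "1 - s" s] by auto
    have pq': "w \<le> (1 - s) * u + s * v" if "w \<le> u" "w \<le> v" for u v w :: real
      using pq[of "- u" "- w" "- v"] that by (simp add: algebra_simps)
    show "primitive (\<lambda>x. of_real (pt s x)) (\<lambda>x. of_real (dt s x))"
      using primitive_add[OF primitive_const[of "of_real ((1 - s) * 1)"] primitive_scale[OF p_primitive, of "of_real s"]]
      by (simp add: pt_def dt_def)
    show "dt s \<in> borel_measurable lebesgue" "qt s \<in> borel_measurable lebesgue"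
      using measurable_d measurable_q unfolding dt_def qt_def by measurable
    show "0 < ?k0" using p0_pos by simp
    show "?k0 \<le> pt s x" for x using p_lower[of x] unfolding pt_def by (intro pq') auto
    show "pt s x \<le> b" for x using p_upper[of x] b unfolding pt_def by (intro pq) auto
    have d: "d x \<le> B" "- B \<le> d x" "q x \<le> B" "- B \<le> q x" for x using d_bound[of x] q_bound[of x] by auto
    have "dt s x \<le> b" "- b \<le> dt s x" "qt s x \<le> b" "- b \<le> qt s x" for x
      using d[of x] b unfolding dt_def qt_def by (intro pq pq'; simp)+
    then show "\<bar>dt s x\<bar> \<le> b" "\<bar>qt s x\<bar> \<le> b" for x by (simp_all add: abs_le_iff minus_le_iff)
  qed
  interpret one: coeffs "\<lambda>_. 1" "\<lambda>_. 0" "\<lambda>_. - b" ?k0 b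
    using co[of 0] by (simp add: pt_def[abs_def] dt_def[abs_def] qt_def[abs_def])
  define z where "z = complex_of_real (- (b + 1))"
  define A where "A s t = SLz (pt s) (dt s) (qt s) z t" for s t
  define K0 where "K0 = B + b"
  define K1 where "K1 = 2 + 2 * (2 + b\<^sup>2 / ?k0 + 2 * b) / ?k0"
  have comb: "rmult (\<lambda>x. (1 - s) * m x + s * n x) y = (1 - s) *\<^sub>R rmult m y + s *\<^sub>R rmult n y"
    if "multiplier (\<lambda>x. of_real (m x))" "multiplier (\<lambda>x. of_real (n x))" for s m n y
    using mult_l2_combination[OF that, of "1 - s" s y] by simp
  have A_eq: "A s t = (1 - s) *\<^sub>R SL (\<lambda>_. 1) (\<lambda>_. 0) (\<lambda>_. - b) t + s *\<^sub>R SL p d q t - mult_l2 (\<lambda>_. z) (fst t)" for s t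
    unfolding A_def SLz_def SL_def pt_def dt_def qt_def
    by (simp only: comb[OF one.mult_p mult_p] comb[OF one.mult_d mult_d] comb[OF one.mult_q mult_q])
      (simp add: algebra_simps)
  have "\<forall>y. \<exists>t\<in>W22_triples. A 1 t = y"
  proof (rule continuity_method[OF subspace_W22_triples])
    show "linear (A s)" for s unfolding A_def by (rule linear_SLz)
    show "\<forall>y. \<exists>t\<in>W22_triples. A 0 t = y"
      using surj_at_free[of b] unfolding surj_at_def A_def z_def by (simp add: pt_def[abs_def] dt_def[abs_def] qt_def[abs_def])
    fix s r t assume sr: "s \<in> {0..1::real}" "r \<in> {0..1::real}" and t: "t \<in> W22_triples"
    interpret r: coeffs "pt r" "dt r" "qt r" ?k0 b by (rule co[OF sr(2)])
    let ?S = "norm (fst t) + norm (fst (snd t)) + norm (snd (snd t))"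
    have "A s t - A r t = (s - r) *\<^sub>R (SL p d q t - SL (\<lambda>_. 1) (\<lambda>_. 0) (\<lambda>_. - b) t)"
      by (simp add: A_eq algebra_simps)
    then have "norm (A s t - A r t) = \<bar>s - r\<bar> * norm (SL p d q t - SL (\<lambda>_. 1) (\<lambda>_. 0) (\<lambda>_. - b) t)" by simp
    also have "\<dots> \<le> \<bar>s - r\<bar> * (K0 * ?S)"
      using norm_SL[of t] one.norm_SL[of t] norm_triangle_ineq4[of "SL p d q t" "SL (\<lambda>_. 1) (\<lambda>_. 0) (\<lambda>_. - b) t"]
      by (intro mult_left_mono) (auto simp: K0_def algebra_simps)
    also have "\<dots> \<le> \<bar>s - r\<bar> * (K0 * (K1 * ((b + 3) * norm (A r t))))"
    proof (intro mult_left_mono)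
      have cr: "norm (fst t) \<le> norm (A r t)" using r.coercive[OF t] by (simp add: A_def z_def)
      have "SL (pt r) (dt r) (qt r) t = A r t + mult_l2 (\<lambda>_. z) (fst t)" by (simp add: A_def SLz_def)
      then have "norm (SL (pt r) (dt r) (qt r) t) \<le> norm (A r t) + norm (mult_l2 (\<lambda>_. z) (fst t))"
        by (metis norm_triangle_ineq)
      also have "norm (mult_l2 (\<lambda>_. z) (fst t)) = (b + 1) * norm (fst t)"
        unfolding norm_mult_l2_const z_def norm_of_real using b by simp
      also have "\<dots> \<le> (b + 1) * norm (A r t)" using cr b by (intro mult_left_mono) auto
      finally have "norm (SL (pt r) (dt r) (qt r) t) + norm (fst t) \<le> (b + 3) * norm (A r t)"
        using cr by (simp add: algebra_simps)
      moreover have "K1 \<ge> 0" unfolding K1_def using b p0_pos by (intro add_nonneg_nonneg divide_nonneg_nonneg mult_nonneg_nonneg) auto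
      ultimately show "?S \<le> K1 * ((b + 3) * norm (A r t))"
        using r.W22_bound[OF t] unfolding K1_def[symmetric] by (meson mult_left_mono order_trans)
      show "0 \<le> K0" using B_pos b by (simp add: K0_def)
    qed auto
    also have "\<dots> = (K0 * K1 * (b + 3)) * \<bar>s - r\<bar> * norm (A r t)" by simp
    finally show "norm (A s t - A r t) \<le> (K0 * K1 * (b + 3)) * \<bar>s - r\<bar> * norm (A r t)" .
  qed
  then show ?thesis
    unfolding surj_at_def A_def z_def by (simp add: pt_def[abs_def] dt_def[abs_def] qt_def[abs_def])
qed

text \<open>Along a segment of spectral parameters the operator changes by a multiple of the embedding only.\<close>
lemma surj_segment:
  assumes s: "surj_at p d q z0" and c: "c > 0"
    and below: "\<And>s t. s \<in> {0..1} \<Longrightarrow> t \<in> W22_triples \<Longrightarrow>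
       c * norm (fst t) \<le> norm (SLz p d q (z0 + of_real s * (z1 - z0)) t)"
  shows "surj_at p d q z1"
proof -
  define A where "A s t = SLz p d q (z0 + of_real s * (z1 - z0)) t" for s t
  have "\<forall>y. \<exists>t\<in>W22_triples. A 1 t = y"
  proof (rule continuity_method[OF subspace_W22_triples])
    show "linear (A s)" for s unfolding A_def by (rule linear_SLz)
    show "\<forall>y. \<exists>t\<in>W22_triples. A 0 t = y" using s by (simp add: A_def surj_at_def)
    fix s r t assume sr: "s \<in> {0..1::real}" "r \<in> {0..1::real}" and t: "t \<in> W22_triples"
    have diff: "mult_l2 (\<lambda>_. w) x - mult_l2 (\<lambda>_. w') x = mult_l2 (\<lambda>_. w - w') x" for w w' x
    proof -
      obtain u where u: "x = cls u" "u \<in> L2 UNIV" by (rule cls_cases)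
      then show ?thesis by (simp add: mult_l2_cls cls_diff L2_scale left_diff_distrib)
    qed
    have "A s t - A r t = mult_l2 (\<lambda>_. of_real (r - s) * (z1 - z0)) (fst t)"
      unfolding A_def SLz_def diff_diff_eq2 by (simp add: diff algebra_simps)
    then have "norm (A s t - A r t) = \<bar>r - s\<bar> * cmod (z1 - z0) * norm (fst t)"
      by (simp add: norm_mult_l2_const norm_mult del: of_real_diff)
    also have "\<dots> \<le> \<bar>r - s\<bar> * cmod (z1 - z0) * (norm (A r t) / c)"
      using below[OF sr(2) t] c by (intro mult_left_mono) (auto simp: A_def field_simps)
    finally show "norm (A s t - A r t) \<le> (cmod (z1 - z0) / c) * \<bar>s - r\<bar> * norm (A r t)"
      by (simp add: field_simps abs_minus_commute)
  qed
  then show ?thesis by (simp add: A_def surj_at_def)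
qed

lemma SLz_lower_bounds:
  assumes "t \<in> W22_triples"
  shows "\<bar>Im z\<bar> * norm (fst t) \<le> norm (SLz p d q z t)" "norm (SLz p d q (of_real (Re z)) t) \<le> norm (SLz p d q z t)"
proof -
  have *: "(norm (SLz p d q z t))\<^sup>2 = (norm (SLz p d q (of_real (Re z)) t))\<^sup>2 + (Im z)\<^sup>2 * (norm (fst t))\<^sup>2"
    using norm_shift_imaginary[OF assms, of "Re z" "Im z"] by simp
  show "\<bar>Im z\<bar> * norm (fst t) \<le> norm (SLz p d q z t)"
    by (rule power2_le_imp_le) (simp_all add: * power_mult_distrib)
  show "norm (SLz p d q (of_real (Re z)) t) \<le> norm (SLz p d q z t)"
    by (rule power2_le_imp_le) (simp_all add: *)
qed

lemma coeffs_enlarge_bound: "coeffs p d q p0 (max B 1)"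
  using coeffs_axioms unfolding coeffs_def by (auto simp: le_max_iff_disj)

text \<open>The path runs from $-(b+1)$ vertically to imaginary part $y \ne 0$, horizontally to real part $\mathrm{Re}\,z$,
and back down to $z$ if $z$ is real. The lower bound is coercivity on the first piece, $|y|$ on the second and, by
symmetry, the lower bound at $z$ on the third.\<close>
theorem surjective_of_lower_bound:
  assumes c: "c > 0" and below: "\<And>t. t \<in> W22_triples \<Longrightarrow> c * norm (fst t) \<le> norm (SLz p d q z t)"
  shows "surj_at p d q z"
proof -
  define b where "b = max B 1"
  interpret b: coeffs p d q p0 b unfolding b_def by (rule coeffs_enlarge_bound)
  define y where "y = (if Im z = 0 then 1 else Im z)"
  have y0: "\<bar>y\<bar> > 0" by (simp add: y_def)
  have 0: "surj_at p d q (of_real (- (b + 1)))" unfolding b_def by (rule surj_coercive)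
  have 1: "surj_at p d q (Complex (- (b + 1)) y)"
  proof (rule surj_segment[OF 0, of 1])
    fix s t assume "s \<in> {0..1::real}" and t: "t \<in> W22_triples"
    have "Re (of_real (- (b + 1)) + of_real s * (Complex (- (b + 1)) y - of_real (- (b + 1)))) = - (b + 1)" by simp
    then show "1 * norm (fst t) \<le> norm (SLz p d q (of_real (- (b + 1)) + of_real s * (Complex (- (b + 1)) y - of_real (- (b + 1)))) t)"
      using b.coercive[OF t] SLz_lower_bounds(2)[OF t] by (metis mult_1 order_trans)
  qed simp
  have 2: "surj_at p d q (Complex (Re z) y)"
  proof (rule surj_segment[OF 1 y0])
    fix s t assume "s \<in> {0..1::real}" and t: "t \<in> W22_triples"
    have "Im (Complex (- (b + 1)) y + of_real s * (Complex (Re z) y - Complex (- (b + 1)) y)) = y" by simp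
    then show "\<bar>y\<bar> * norm (fst t) \<le> norm (SLz p d q (Complex (- (b + 1)) y + of_real s * (Complex (Re z) y - Complex (- (b + 1)) y)) t)"
      using SLz_lower_bounds(1)[OF t] by metis
  qed
  show ?thesis
  proof (cases "Im z = 0")
    case False
    then show ?thesis using 2 by (simp add: y_def)
  next
    case True
    then have z: "z = of_real (Re z)" by (simp add: complex_eq_iff)
    show ?thesis
    proof (rule surj_segment[OF 2 c])
      fix s t assume "s \<in> {0..1::real}" and t: "t \<in> W22_triples"
      have "Re (Complex (Re z) y + of_real s * (z - Complex (Re z) y)) = Re z" by simp
      then show "c * norm (fst t) \<le> norm (SLz p d q (Complex (Re z) y + of_real s * (z - Complex (Re z) y)) t)"
        using below[OF t] SLz_lower_bounds(2)[OF t] z by (metis order_trans)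
    qed
  qed
qed

end

section \<open>Singular sequences and a Fredholm alternative\<close>

text \<open>The closure of the range is complete but not compact, hence not totally bounded; so one can always pick a further
term at distance $e/2$ from all earlier terms of the whole sequence.\<close>
lemma separated_subsequence:
  fixes x :: "nat \<Rightarrow> 'x::complete_space"
  assumes none: "\<not> (\<exists>r. strict_mono (r :: nat \<Rightarrow> nat) \<and> convergent (\<lambda>n. x (r n)))"
  obtains \<delta> s where "\<delta> > 0" "strict_mono (s :: nat \<Rightarrow> nat)" "\<And>n m. n \<noteq> m \<Longrightarrow> \<delta> \<le> dist (x (s n)) (x (s m))"
proof -
  let ?C = "closure (range x)"
  have "\<not> compact ?C"
  proof
    assume "compact ?C"
    then have "seq_compact ?C" by (rule compact_imp_seq_compact)
    moreover have "\<forall>n. x n \<in> ?C"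
    proof
      fix n show "x n \<in> ?C" using closure_subset[of "range x"] by (rule subsetD) (rule rangeI)
    qed
    ultimately have "\<exists>l\<in>?C. \<exists>r. strict_mono (r :: nat \<Rightarrow> nat) \<and> (x \<circ> r) \<longlonglongrightarrow> l"
      unfolding seq_compact_def by (elim allE[of _ x]) (erule mp)
    then obtain l r where "strict_mono (r :: nat \<Rightarrow> nat)" "(\<lambda>n. x (r n)) \<longlonglongrightarrow> l"
      unfolding o_def by (elim bexE exE conjE) 
    then have "strict_mono r \<and> convergent (\<lambda>n. x (r n))" by (simp add: convergentI)
    then show False using none by (elim notE) (rule exI)
  qed
  moreover have "complete ?C" by (simp add: complete_eq_closed)
  ultimately obtain e where e: "e > 0" "\<And>k. finite k \<Longrightarrow> \<not> ?C \<subseteq> (\<Union>y\<in>k. ball y e)"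
    unfolding compact_eq_totally_bounded by blast
  have far: "\<exists>n>N. \<forall>i\<le>N. e / 2 \<le> dist (x i) (x n)" for N
  proof (rule ccontr)
    assume "\<not> ?thesis"
    then have *: "\<exists>i\<le>N. dist (x i) (x n) < e / 2" if "n > N" for n using that by (meson not_le)
    have "range x \<subseteq> (\<Union>i\<le>N. cball (x i) (e / 2))"
    proof clarify
      fix n
      show "x n \<in> (\<Union>i\<le>N. cball (x i) (e / 2))"
      proof (cases "n > N")
        case True
        then obtain i where "i \<le> N" "dist (x i) (x n) < e / 2" using * by blast
        then show ?thesis by (auto intro!: bexI[of _ i])
      next
        case False
        then show ?thesis using e(1) by (auto intro!: bexI[of _ n])
      qed
    qed
    then have "?C \<subseteq> (\<Union>i\<le>N. cball (x i) (e / 2))"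
      by (intro closure_minimal) auto
    also have "\<dots> \<subseteq> (\<Union>y\<in>x ` {..N}. ball y e)" using e(1) by force
    finally show False using e(2)[of "x ` {..N}"] by simp
  qed
  have "\<exists>s. \<forall>n. True \<and> (s n < s (Suc n) \<and> (\<forall>i\<le>s n. e / 2 \<le> dist (x i) (x (s (Suc n)))))"
    by (rule dependent_nat_choice) (use far in auto)
  then obtain s where s': "\<forall>n. True \<and> (s n < s (Suc n) \<and> (\<forall>i\<le>s n. e / 2 \<le> dist (x i) (x (s (Suc n)))))" ..
  have s: "s n < s (Suc n)" "i \<le> s n \<Longrightarrow> e / 2 \<le> dist (x i) (x (s (Suc n)))" for n i
    using s'[rule_format, of n] by simp_all
  have mono: "strict_mono s" using s(1) by (rule strict_monoI_Suc)
  have lt: "e / 2 \<le> dist (x (s n)) (x (s m))" if nm: "n < m" for n m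
  proof -
    obtain k where k: "m = Suc k" "n \<le> k" using nm by (cases m) auto
    then have "s n \<le> s k" using mono by (simp add: strict_mono_less_eq)
    then show ?thesis using s(2) k by blast
  qed
  show thesis
  proof (rule that[of "e / 2" s])
    show "e / 2 \<le> dist (x (s n)) (x (s m))" if "n \<noteq> m" for n m
      using lt[of n m] lt[of m n] that by (cases n m rule: linorder_cases) (auto simp: dist_commute)
  qed (use e mono in auto)
qed

lemma separated_no_convergent_subsequence:
  fixes v :: "nat \<Rightarrow> 'x::metric_space"
  assumes "\<delta> > 0" "\<And>n m. m < n \<Longrightarrow> \<delta> \<le> dist (v n) (v m)"
  shows "\<not> (\<exists>r. strict_mono (r :: nat \<Rightarrow> nat) \<and> convergent (\<lambda>n. v (r n)))"
proof
  assume "\<exists>r. strict_mono (r :: nat \<Rightarrow> nat) \<and> convergent (\<lambda>n. v (r n))"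
  then obtain r where r: "strict_mono (r :: nat \<Rightarrow> nat)" "Cauchy (\<lambda>n. v (r n))"
    using convergent_Cauchy by blast
  obtain K where "\<And>m n. m \<ge> K \<Longrightarrow> n \<ge> K \<Longrightarrow> dist (v (r m)) (v (r n)) < \<delta>"
    using r(2) assms(1) unfolding Cauchy_def by metis
  then have "dist (v (r (Suc K))) (v (r K)) < \<delta>" by simp
  moreover have "r K < r (Suc K)" using r(1) by (simp add: strict_mono_less)
  ultimately show False using assms(2) by (meson not_le)
qed

text \<open>For fixed \<open>k\<close> the differences $y_n-y_k$ are again $\delta$-separated in $n$. So each earlier
difference excludes at most one \<open>n\<close>, and infinitely many candidates remain.\<close>
lemma separated_differences:
  fixes y :: "nat \<Rightarrow> 'x::real_normed_vector"
  assumes \<delta>: "\<delta> > 0" and sep: "\<And>n m. n \<noteq> m \<Longrightarrow> \<delta> \<le> dist (y n) (y m)"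
  obtains a :: "nat \<Rightarrow> nat" where "\<And>k. k \<le> a k"
    "\<And>k j. j < k \<Longrightarrow> \<delta> / 2 \<le> dist (y (a k) - y k) (y (a j) - y j)"
proof -
  let ?P = "\<lambda>a k n. k \<le> n \<and> (\<forall>j<k. \<delta> / 2 \<le> dist (y n - y k) (y (a j) - y j))"
  have "\<exists>a. \<forall>k. ?P a k (a k)"
  proof (rule dependent_wf_choice[OF wf_less_than])
    show "?P f k n = ?P g k n" if "\<And>z. (z, k) \<in> less_than \<Longrightarrow> f z = g z" for f g k n
      using that by auto
    fix k f
    have fin: "finite {n. dist (y n - y k) (y (f j) - y j) < \<delta> / 2}" for j
    proof -
      let ?S = "{n. dist (y n - y k) (y (f j) - y j) < \<delta> / 2}"
      have "n = m" if "n \<in> ?S" "m \<in> ?S" for n m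
      proof (rule ccontr)
        assume "n \<noteq> m"
        have "dist (y n) (y m) = dist (y n - y k) (y m - y k)" by (simp add: dist_norm)
        also have "\<dots> < \<delta>"
          using that dist_triangle2[of "y n - y k" "y m - y k" "y (f j) - y j"] by simp
        finally show False using sep[OF \<open>n \<noteq> m\<close>] by simp
      qed
      then show ?thesis by (metis finite.simps is_singletonI' is_singleton_def)
    qed
    have "finite ({..<k} \<union> (\<Union>j<k. {n. dist (y n - y k) (y (f j) - y j) < \<delta> / 2}))"
      using fin by simp
    then obtain n where "n \<notin> {..<k} \<union> (\<Union>j<k. {n. dist (y n - y k) (y (f j) - y j) < \<delta> / 2})"
      using ex_new_if_finite infinite_UNIV_nat by blast
    then show "\<exists>n. ?P f k n" by (auto simp: not_less)
  qed
  then show thesis using that by blast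
qed

text \<open>Singular sequences in the sense of Glazman for a map \<open>A\<close> on a space \<open>D\<close> that is
embedded into the target space by \<open>J\<close>.\<close>
definition glazman :: "'d set \<Rightarrow> ('d \<Rightarrow> 'x::real_normed_vector) \<Rightarrow> ('d \<Rightarrow> 'x) \<Rightarrow> bool" where
  "glazman D J A \<longleftrightarrow> (\<exists>u :: nat \<Rightarrow> 'd. (\<forall>n. u n \<in> D) \<and> (\<exists>C. \<forall>n. norm (J (u n)) \<le> C) \<and>
     \<not> (\<exists>r. strict_mono (r :: nat \<Rightarrow> nat) \<and> convergent (\<lambda>n. J (u (r n)))) \<and> (\<lambda>n. A (u n)) \<longlonglongrightarrow> 0)"

text \<open>If \<open>A\<close> is small on the differences of the terms, these differences form a singular sequence, provided
that they are chosen separated. No weak limit has to be subtracted.\<close>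
lemma glazman_of_differences:
  fixes J A :: "'d::real_vector \<Rightarrow> 'x::banach"
  assumes D: "subspace D" and J: "linear J" and u: "\<And>n. u n \<in> D" "\<And>n. norm (J (u n)) \<le> C"
    and none: "\<not> (\<exists>r. strict_mono (r :: nat \<Rightarrow> nat) \<and> convergent (\<lambda>n. J (u (r n))))"
    and small: "\<And>e. e > 0 \<Longrightarrow> \<exists>K. \<forall>n\<ge>K. \<forall>m\<ge>K. norm (A (u n - u m)) < e"
  shows "glazman D J A"
proof -
  obtain \<delta> s where \<delta>: "\<delta> > 0" and s: "strict_mono (s :: nat \<Rightarrow> nat)"
    and sep: "\<And>n m. n \<noteq> m \<Longrightarrow> \<delta> \<le> dist (J (u (s n))) (J (u (s m)))"
    using separated_subsequence[OF none] by metis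
  obtain a :: "nat \<Rightarrow> nat" where a: "\<And>k. k \<le> a k"
    "\<And>k j. j < k \<Longrightarrow> \<delta> / 2 \<le> dist (J (u (s (a k))) - J (u (s k))) (J (u (s (a j))) - J (u (s j)))"
    using separated_differences[where y = "\<lambda>n. J (u (s n))", OF \<delta> sep] by blast
  define v where "v k = u (s (a k)) - u (s k)" for k
  have Jv: "J (v k) = J (u (s (a k))) - J (u (s k))" for k by (simp add: v_def linear_diff[OF J])
  have "\<forall>k. v k \<in> D" using u(1) by (simp add: v_def subspace_diff[OF D])
  moreover have "norm (J (v k)) \<le> C + C" for k
    unfolding Jv by (rule order_trans[OF norm_triangle_ineq4 add_mono[OF u(2) u(2)]])
  moreover have "\<not> (\<exists>r. strict_mono (r :: nat \<Rightarrow> nat) \<and> convergent (\<lambda>n. J (v (r n))))"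
    by (rule separated_no_convergent_subsequence[of "\<delta> / 2" "\<lambda>k. J (v k)"]) (use \<delta> a(2) in \<open>auto simp: Jv\<close>)
  moreover have "(\<lambda>k. A (v k)) \<longlonglongrightarrow> 0"
  proof (rule LIMSEQ_I)
    fix e :: real assume "e > 0"
    then obtain K where K: "\<forall>n\<ge>K. \<forall>m\<ge>K. norm (A (u n - u m)) < e" using small by blast
    have "norm (A (v k) - 0) < e" if "k \<ge> K" for k
    proof -
      have "K \<le> s k" using strict_mono_imp_increasing[OF s, of k] that by linarith
      moreover have "K \<le> s (a k)" using strict_mono_imp_increasing[OF s, of "a k"] a(1)[of k] that by linarith
      ultimately show ?thesis using K by (simp add: v_def)
    qed
    then show "\<exists>no. \<forall>n\<ge>no. norm (A (v n) - 0) < e" by blast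
  qed
  ultimately show ?thesis unfolding glazman_def by blast
qed

lemma riesz_lemma:
  fixes Y :: "'x::real_normed_vector set"
  assumes Y: "subspace Y" "closed Y" and Z: "subspace Z" "Y \<subseteq> Z" and z: "z \<in> Z" "z \<notin> Y"
  obtains x where "x \<in> Z" "norm x = 1" "\<And>y. y \<in> Y \<Longrightarrow> 1 / 2 \<le> norm (x - y)"
proof -
  define \<rho> where "\<rho> = infdist z Y"
  have ne: "Y \<noteq> {}" using subspace_0[OF Y(1)] by blast
  have \<rho>: "\<rho> > 0"
    using in_closed_iff_infdist_zero[OF Y(2) ne, of z] z(2) infdist_nonneg[of z Y] by (simp add: \<rho>_def less_le)
  have "\<exists>y\<in>Y. dist z y < 2 * \<rho>"
  proof (rule ccontr)
    assume "\<not> ?thesis"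
    then have "2 * \<rho> \<le> infdist z Y" unfolding infdist_def using ne by (auto intro!: cINF_greatest simp: not_less)
    then show False using \<rho> by (simp add: \<rho>_def)
  qed
  then obtain y0 where y0: "y0 \<in> Y" "dist z y0 < 2 * \<rho>" by blast
  define N where "N = norm (z - y0)"
  have N: "N > 0" "N < 2 * \<rho>" using y0 z(2) by (auto simp: N_def dist_norm)
  define x where "x = (z - y0) /\<^sub>R N"
  show thesis
  proof (rule that[of x])
    show "x \<in> Z" unfolding x_def using Z y0(1) z(1) by (intro subspace_scale subspace_diff) auto
    show "norm x = 1" using N by (simp add: x_def N_def)
    fix y assume y: "y \<in> Y"
    have "x - y = (z - (y0 + N *\<^sub>R y)) /\<^sub>R N"
      using N by (simp add: x_def algebra_simps)
    then have "norm (x - y) = dist z (y0 + N *\<^sub>R y) / N" using N by (simp add: dist_norm divide_inverse mult.commute)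
    moreover have "\<rho> \<le> dist z (y0 + N *\<^sub>R y)"
      unfolding \<rho>_def using Y(1) y y0(1) by (intro infdist_le subspace_add subspace_scale)
    ultimately have "\<rho> / N \<le> norm (x - y)" using N by (simp add: divide_right_mono)
    moreover have "1 / 2 \<le> \<rho> / N" using N by (simp add: field_simps)
    ultimately show "1 / 2 \<le> norm (x - y)" by linarith
  qed
qed

text \<open>Riesz' argument, with a compact operator replaced by one that contracts by the factor $\eta$ up to a compact error.
If $1-N$ were not onto, the ranges of its powers would decrease strictly. Unit vectors $x_n$ at distance at least $1/2$ from
the next range satisfy $\|Nx_n-Nx_m\|\ge 1/2$ for $n<m$, while the contraction property gives at most
$2\eta+o(1)$. This is why $\eta<1/4$ is needed.\<close>
lemma fredholm_alternative:
  fixes N :: "'x::banach \<Rightarrow> 'x"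
  assumes N: "bounded_linear N" and \<eta>: "0 \<le> \<eta>" "\<eta> < 1 / 4"
    and comp: "\<And>x C. (\<And>n. norm (x n) \<le> C) \<Longrightarrow> \<exists>r. strict_mono (r :: nat \<Rightarrow> nat) \<and>
       (\<forall>e>0. \<exists>K. \<forall>n\<ge>K. \<forall>m\<ge>K. norm (N (x (r n)) - N (x (r m))) \<le> \<eta> * norm (x (r n) - x (r m)) + e)"
    and inj: "\<And>x. x - N x = 0 \<Longrightarrow> x = 0"
  shows "\<exists>c>0. \<forall>x. c * norm x \<le> norm (x - N x)" and "\<exists>x. x - N x = y"
proof -
  define T where "T x = x - N x" for x
  have T: "bounded_linear T" unfolding T_def by (intro bounded_linear_sub bounded_linear_ident N)
  note linT = bounded_linear.linear[OF T]
  have below: "\<exists>c>0. \<forall>x. c * norm x \<le> norm (T x)"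
  proof (rule ccontr)
    assume "\<not> ?thesis"
    then have *: "\<exists>x. norm (T x) < c * norm x" if "c > 0" for c using that by (meson not_le)
    have "\<exists>x. norm x = 1 \<and> norm (T x) < 1 / real (Suc n)" for n
    proof -
      obtain x where x: "norm (T x) < 1 / real (Suc n) * norm x" using *[of "1 / real (Suc n)"] by auto
      then have x0: "norm x > 0" by (metis mult_zero_right norm_ge_zero not_le zero_less_norm_iff norm_zero)
      have "norm (T (x /\<^sub>R norm x)) = norm (T x) / norm x"
        using x0 by (simp add: linear_scale[OF linT] divide_inverse mult.commute)
      also have "\<dots> < 1 / real (Suc n)" using x x0 by (simp add: field_simps)
      finally show ?thesis using x0 by (intro exI[of _ "x /\<^sub>R norm x"]) simp
    qed
    then obtain x where x: "\<And>n. norm (x n) = 1" "\<And>n. norm (T (x n)) < 1 / real (Suc n)" by metis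
    obtain r where r: "strict_mono (r :: nat \<Rightarrow> nat)"
      "\<And>e. e > 0 \<Longrightarrow> \<exists>K. \<forall>n\<ge>K. \<forall>m\<ge>K. norm (N (x (r n)) - N (x (r m))) \<le> \<eta> * norm (x (r n) - x (r m)) + e"
      using comp[of x 1] x(1) by auto
    have T0: "(\<lambda>n. T (x n)) \<longlonglongrightarrow> 0"
      by (rule Lim_null_comparison[OF _ LIMSEQ_Suc[OF lim_1_over_n]]) (use x(2) in \<open>auto intro!: always_eventually less_imp_le\<close>)
    then have T0r: "(\<lambda>n. T (x (r n))) \<longlonglongrightarrow> 0" using LIMSEQ_subseq_LIMSEQ[OF _ r(1)] by (simp add: o_def)
    have "Cauchy (\<lambda>n. x (r n))"
    proof (rule CauchyI)
      fix e :: real assume e: "e > 0"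
      obtain K1 where K1: "\<forall>n\<ge>K1. \<forall>m\<ge>K1. norm (N (x (r n)) - N (x (r m))) \<le> \<eta> * norm (x (r n) - x (r m)) + e / 8"
        using r(2)[of "e / 8"] e by auto
      obtain K2 where K2: "\<And>n. n \<ge> K2 \<Longrightarrow> norm (T (x (r n))) < e / 8"
        using LIMSEQ_D[OF T0r, of "e / 8"] e by auto
      have "norm (x (r n) - x (r m)) < e" if nm: "n \<ge> max K1 K2" "m \<ge> max K1 K2" for n m
      proof -
        have "x (r n) - x (r m) = (T (x (r n)) - T (x (r m))) + (N (x (r n)) - N (x (r m)))" by (simp add: T_def)
        then have "norm (x (r n) - x (r m)) \<le> norm (T (x (r n)) - T (x (r m))) + norm (N (x (r n)) - N (x (r m)))"
          by (metis norm_triangle_ineq)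
        moreover have "norm (T (x (r n)) - T (x (r m))) < e / 8 + e / 8"
          using K2[of n] K2[of m] nm norm_triangle_ineq4[of "T (x (r n))" "T (x (r m))"] by simp
        moreover have "norm (N (x (r n)) - N (x (r m))) \<le> \<eta> * norm (x (r n) - x (r m)) + e / 8" using K1 nm by simp
        moreover have "\<eta> * norm (x (r n) - x (r m)) \<le> 1 / 4 * norm (x (r n) - x (r m))"
          using \<eta> by (intro mult_right_mono) auto
        ultimately show ?thesis using e by linarith
      qed
      then show "\<exists>M. \<forall>m\<ge>M. \<forall>n\<ge>M. norm (x (r m) - x (r n)) < e" by blast
    qed
    then obtain l where l: "(\<lambda>n. x (r n)) \<longlonglongrightarrow> l" using Cauchy_convergent convergent_def by blast
    have "(\<lambda>n. T (x (r n))) \<longlonglongrightarrow> T l" by (rule bounded_linear.tendsto[OF T l])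
    then have "T l = 0" using T0r LIMSEQ_unique by blast
    then have "l = 0" using inj by (simp add: T_def)
    moreover have "(\<lambda>n. norm (x (r n))) \<longlonglongrightarrow> norm l" by (rule tendsto_norm[OF l])
    then have "norm l = 1" by (simp add: x(1) LIMSEQ_const_iff)
    ultimately show False by simp
  qed
  then show "\<exists>c>0. \<forall>x. c * norm x \<le> norm (x - N x)" by (simp add: T_def)
  obtain c where c: "c > 0" "\<And>x. c * norm x \<le> norm (T x)" using below by blast
  have injT: "inj T"
    using inj by (auto intro!: linear_injective_0[OF linT, THEN iffD2] simp: T_def)
  define X where "X n = (T ^^ n) ` UNIV" for n
  have XSuc: "X (Suc n) = T ` X n" for n by (simp add: X_def image_comp)
  have sub: "subspace (X n) \<and> complete (X n)" for n
  proof (induction n)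
    case 0 then show ?case by (simp add: X_def complete_UNIV)
  next
    case (Suc n)
    then show ?case unfolding XSuc
      using linear_subspace_image[OF linT] complete_isometric_image[OF c(1) _ T] c(2) by blast
  qed
  have dec: "X (Suc n) \<subseteq> X n" for n
    by (induction n) (auto simp: XSuc X_def)
  then have anti: "X m \<subseteq> X n" if "n \<le> m" for n m using that by (rule lift_Suc_antimono_le)
  have "surj T"
  proof (rule ccontr)
    assume ns: "\<not> surj T"
    have strict: "\<exists>z. z \<in> X n \<and> z \<notin> X (Suc n)" for n
    proof -
      obtain y where y: "y \<notin> range T" using ns by blast
      have injn: "inj (T ^^ n)" using injT by (rule inj_fn)
      have "(T ^^ n) y \<notin> X (Suc n)"
      proof
        assume "(T ^^ n) y \<in> X (Suc n)"
        then obtain w where "(T ^^ n) y = (T ^^ Suc n) w" by (auto simp: X_def)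
        then have "(T ^^ n) y = (T ^^ n) (T w)" by (simp add: funpow_swap1)
        then have "y = T w" using injn by (simp add: inj_eq)
        then show False using y by blast
      qed
      then show ?thesis by (auto simp: X_def)
    qed
    have "\<exists>x. x \<in> X n \<and> norm x = 1 \<and> (\<forall>y\<in>X (Suc n). 1 / 2 \<le> norm (x - y))" for n
    proof -
      obtain z where "z \<in> X n" "z \<notin> X (Suc n)" using strict by blast
      then show ?thesis
        using riesz_lemma[of "X (Suc n)" "X n" z] sub[of n] sub[of "Suc n"] dec[of n] complete_imp_closed by metis
    qed
    then obtain x where x: "\<And>n. x n \<in> X n" "\<And>n. norm (x n) = 1" "\<And>n y. y \<in> X (Suc n) \<Longrightarrow> 1 / 2 \<le> norm (x n - y)" by metis
    obtain r where r: "strict_mono (r :: nat \<Rightarrow> nat)"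
      "\<And>e. e > 0 \<Longrightarrow> \<exists>K. \<forall>n\<ge>K. \<forall>m\<ge>K. norm (N (x (r n)) - N (x (r m))) \<le> \<eta> * norm (x (r n) - x (r m)) + e"
      using comp[of x 1] x(2) by auto
    obtain K where K: "\<forall>n\<ge>K. \<forall>m\<ge>K. norm (N (x (r n)) - N (x (r m))) \<le> \<eta> * norm (x (r n) - x (r m)) + (1 / 2 - 2 * \<eta>) / 2"
      using r(2)[of "(1 / 2 - 2 * \<eta>) / 2"] \<eta> by auto
    let ?n = "r K" and ?m = "r (Suc K)"
    have nm: "Suc ?n \<le> ?m" using r(1) by (simp add: strict_mono_less Suc_le_eq)
    have "T (x ?n) \<in> X (Suc ?n)" using x(1)[of ?n] unfolding XSuc by (rule imageI)
    moreover have "x ?m \<in> X (Suc ?n)" using x(1)[of ?m] anti[OF nm] by blast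
    moreover have "T (x ?m) \<in> X (Suc ?n)"
      using imageI[OF x(1)[of ?m], of T] anti[of "Suc ?n" "Suc ?m"] nm unfolding XSuc[symmetric] by auto
    ultimately have "T (x ?n) + x ?m - T (x ?m) \<in> X (Suc ?n)"
      using sub[of "Suc ?n"] by (intro subspace_diff subspace_add) auto
    from x(3)[OF this] have "1 / 2 \<le> norm (N (x ?n) - N (x ?m))" by (simp add: T_def algebra_simps)
    also have "\<dots> \<le> \<eta> * norm (x ?n - x ?m) + (1 / 2 - 2 * \<eta>) / 2" using K by simp
    also have "\<dots> \<le> \<eta> * 2 + (1 / 2 - 2 * \<eta>) / 2"
      using norm_triangle_ineq4[of "x ?n" "x ?m"] x(2) \<eta> by (intro add_mono mult_left_mono) auto
    finally show False using \<eta> by (simp add: field_simps)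
  qed
  then show "\<exists>x. x - N x = y" unfolding surj_def T_def by metis
qed

section \<open>Local compactness and escape to infinity\<close>

abbreviation restr :: "real set \<Rightarrow> l2 \<Rightarrow> l2" where
  "restr S \<equiv> rmult (indicator S)"

lemma multiplier_indicator: "S \<in> sets lebesgue \<Longrightarrow> multiplier (\<lambda>x. complex_of_real (indicator S x))"
  unfolding multiplier_def
  by (intro conjI exI[of _ 1] borel_measurable_of_real borel_measurable_indicator) (auto simp: indicator_def)

lemma norm_restr_le:
  assumes "S \<in> sets lebesgue"
  shows "norm (restr S x) \<le> norm x"
proof -
  have "norm (restr S x) \<le> 1 * norm x"
    using assms by (intro norm_mult_l2 borel_measurable_of_real borel_measurable_indicator) (auto simp: indicator_def)
  then show ?thesis by simp
qed

lemma indicator_interval_L2: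
  assumes "a \<le> b"
  shows "(\<lambda>x. complex_of_real (indicator {a..b} x)) \<in> L2 UNIV"
    and "l2norm UNIV (\<lambda>x. complex_of_real (indicator {a..b} x)) = sqrt (b - a)"
proof -
  have sq: "(indicator {a..b} x :: real)\<^sup>2 = indicator {a..b} x" for x by (simp add: indicator_def)
  have int: "integrable lebesgue (indicator {a..b} :: real \<Rightarrow> real)"
    using assms by (intro integrable_real_indicator) auto
  have m: "(\<lambda>x. complex_of_real (indicator {a..b} x)) \<in> borel_measurable lebesgue"
    using multiplier_indicator[of "{a..b}"] by (simp add: multiplier_def)
  then show "(\<lambda>x. complex_of_real (indicator {a..b} x)) \<in> L2 UNIV"
    by (simp add: L2_def lebesgue_on_UNIV_eq sq int)
  show "l2norm UNIV (\<lambda>x. complex_of_real (indicator {a..b} x)) = sqrt (b - a)"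
    using assms by (simp add: l2norm_def lebesgue_on_UNIV_eq sq)
qed

lemma primitive_Holder:
  assumes "primitive F f" "f \<in> L2 UNIV" "x \<le> y"
  shows "cmod (F y - F x) \<le> sqrt (y - x) * l2norm UNIV f"
proof -
  have "F y - F x = integral {x..y} f" by (rule primitive_diff[OF assms(1,3)])
  also have "\<dots> = (LINT t|lebesgue_on UNIV. of_real (indicator {x..y} t) * f t)"
    using set_lebesgue_integral_eq_integral(2)[OF primitive_integrable[OF assms(1), of x y]]
    by (simp add: set_lebesgue_integral_def lebesgue_on_UNIV_eq scaleR_conv_of_real)
  also have "cmod \<dots> \<le> l2norm UNIV (\<lambda>x'. complex_of_real (indicator {x..y} x')) * l2norm UNIV f"
    by (rule L2_Cauchy_Schwarz[OF indicator_interval_L2(1)[OF assms(3)] assms(2)])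
  finally show ?thesis using indicator_interval_L2(2)[OF assms(3)] by simp
qed

text \<open>By the Hoelder estimate, $|F|\ge|F(x)|-\sqrt{b-a}\,\|f\|$ on the whole interval. Hence the norm of $F$ is at
least $\sqrt{b-a}$ times the right-hand side.\<close>
lemma primitive_sup_bound:
  assumes Ff: "primitive F f" and L: "F \<in> L2 UNIV" "f \<in> L2 UNIV" and ab: "a < b" and x: "x \<in> {a..b}"
  shows "cmod (F x) \<le> l2norm UNIV F / sqrt (b - a) + sqrt (b - a) * l2norm UNIV f"
proof -
  define c where "c = cmod (F x) - sqrt (b - a) * l2norm UNIV f"
  have sqrt_le: "sqrt (\<bar>y - x\<bar>) * l2norm UNIV f \<le> sqrt (b - a) * l2norm UNIV f" if "y \<in> {a..b}" for y
    using that x by (intro mult_right_mono real_sqrt_le_mono) auto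
  have low: "c \<le> cmod (F y)" if y: "y \<in> {a..b}" for y
  proof -
    have "cmod (F x - F y) \<le> sqrt (\<bar>y - x\<bar>) * l2norm UNIV f"
      using primitive_Holder[OF Ff L(2), of x y] primitive_Holder[OF Ff L(2), of y x]
      by (cases "x \<le> y") (auto simp: norm_minus_commute)
    then show ?thesis
      using sqrt_le[OF y] norm_triangle_ineq2[of "F x" "F y"] unfolding c_def by linarith
  qed
  have "c \<le> l2norm UNIV F / sqrt (b - a)"
  proof (cases "c > 0")
    case True
    have "l2norm UNIV (\<lambda>t. of_real c * complex_of_real (indicator {a..b} t)) \<le> l2norm UNIV F"
    proof (rule l2norm_mono[OF _ L(1)])
      show "(\<lambda>t. of_real c * complex_of_real (indicator {a..b} t)) \<in> borel_measurable (lebesgue_on UNIV)"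
        using ab by (intro L2_measurable L2_scale indicator_interval_L2(1)) simp
      show "cmod (of_real c * complex_of_real (indicator {a..b} t)) \<le> cmod (F t)" for t
        using low[of t] True by (cases "t \<in> {a..b}") (simp_all add: norm_mult)
    qed
    then have "c * sqrt (b - a) \<le> l2norm UNIV F"
      using True ab by (simp add: l2norm_scale indicator_interval_L2(2) del: of_real_mult)
    then show ?thesis using ab by (simp add: field_simps)
  next
    case False
    moreover have "0 \<le> l2norm UNIV F / sqrt (b - a)" using ab by simp
    ultimately show ?thesis by linarith
  qed
  then show ?thesis by (simp add: c_def)
qed

lemma norm_restr_sup:
  assumes u: "u \<in> L2 UNIV" and ab: "a \<le> b" and M: "\<And>x. x \<in> {a..b} \<Longrightarrow> cmod (u x) \<le> M" "0 \<le> M"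
  shows "norm (restr {a<..<b} (cls u)) \<le> M * sqrt (b - a)"
proof -
  have m: "multiplier (\<lambda>x. complex_of_real (indicator {a<..<b} x))" by (rule multiplier_indicator) simp
  have "norm (restr {a<..<b} (cls u)) = l2norm UNIV (\<lambda>x. of_real (indicator {a<..<b} x) * u x)"
    using u m by (simp add: mult_l2_cls norm_cls multiplier_L2)
  also have "\<dots> \<le> l2norm UNIV (\<lambda>x. of_real M * complex_of_real (indicator {a..b} x))"
  proof (rule l2norm_mono)
    show "(\<lambda>x. of_real (indicator {a<..<b} x) * u x) \<in> borel_measurable (lebesgue_on UNIV)"
      by (rule L2_measurable[OF multiplier_L2[OF m u]])
    show "(\<lambda>x. of_real M * complex_of_real (indicator {a..b} x)) \<in> L2 UNIV"
      by (rule L2_scale[OF indicator_interval_L2(1)[OF ab]])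
    show "cmod (of_real (indicator {a<..<b} x) * u x) \<le> cmod (of_real M * complex_of_real (indicator {a..b} x))" for x
      using M(1)[of x] M(2) by (cases "x \<in> {a<..<b}") (auto simp: norm_mult)
  qed
  also have "\<dots> = M * sqrt (b - a)" using ab M(2) by (simp add: l2norm_scale indicator_interval_L2(2) del: of_real_mult)
  finally show ?thesis .
qed

text \<open>The pairs of $u_n$ and $u_n'$ are uniformly bounded and uniformly Hoelder continuous on the closed interval, so the
Arzela--Ascoli theorem applies to them jointly.\<close>
lemma local_compactness:
  fixes t :: "nat \<Rightarrow> l2 \<times> l2 \<times> l2"
  assumes ab: "a < b" and t: "\<And>n. t n \<in> W22_triples"
    and M: "\<And>n. norm (fst (t n)) \<le> M" "\<And>n. norm (fst (snd (t n))) \<le> M" "\<And>n. norm (snd (snd (t n))) \<le> M"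
  shows "\<exists>r. strict_mono (r :: nat \<Rightarrow> nat) \<and>
    (\<forall>e>0. \<exists>K. \<forall>n\<ge>K. \<forall>m\<ge>K. norm (restr {a<..<b} (fst (t (r n) - t (r m)))) < e \<and>
        norm (restr {a<..<b} (fst (snd (t (r n) - t (r m))))) < e)"
proof -
  have "\<exists>U U1 U2. t n = (cls U, cls U1, cls U2) \<and> W22_triple U U1 U2" for n
    using W22_triples_cases[OF t[of n]] by metis
  then obtain U U1 U2 where tU: "\<And>n. t n = (cls (U n), cls (U1 n), cls (U2 n))" and W: "\<And>n. W22_triple (U n) (U1 n) (U2 n)"
    by metis
  have L: "U n \<in> L2 UNIV" "U1 n \<in> L2 UNIV" "U2 n \<in> L2 UNIV" and pr: "primitive (U n) (U1 n)" "primitive (U1 n) (U2 n)" for n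
    using W[of n] by (auto simp: W22_triple_def)
  have N: "l2norm UNIV (U n) \<le> M" "l2norm UNIV (U1 n) \<le> M" "l2norm UNIV (U2 n) \<le> M" for n
    using M[of n] L[of n] by (simp_all add: tU norm_cls)
  have M0: "0 \<le> M" using N(1)[of 0] l2norm_nonneg order_trans by blast
  define S where "S = M / sqrt (b - a) + sqrt (b - a) * M"
  have S0: "0 \<le> S" using M0 ab by (simp add: S_def)
  have sup: "cmod (U n x) \<le> S" "cmod (U1 n x) \<le> S" if x: "x \<in> {a..b}" for n x
  proof -
    have "cmod (U n x) \<le> l2norm UNIV (U n) / sqrt (b - a) + sqrt (b - a) * l2norm UNIV (U1 n)"
      by (rule primitive_sup_bound[OF pr(1) L(1,2) ab x])
    also have "\<dots> \<le> S" unfolding S_def using N ab by (intro add_mono divide_right_mono mult_left_mono) auto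
    finally show "cmod (U n x) \<le> S" .
    have "cmod (U1 n x) \<le> l2norm UNIV (U1 n) / sqrt (b - a) + sqrt (b - a) * l2norm UNIV (U2 n)"
      by (rule primitive_sup_bound[OF pr(2) L(2,3) ab x])
    also have "\<dots> \<le> S" unfolding S_def using N ab by (intro add_mono divide_right_mono mult_left_mono) auto
    finally show "cmod (U1 n x) \<le> S" .
  qed
  have holder: "cmod (U n x - U n y) \<le> sqrt \<bar>x - y\<bar> * M" "cmod (U1 n x - U1 n y) \<le> sqrt \<bar>x - y\<bar> * M" for n x y
  proof -
    have 1: "cmod (F x - F y) \<le> sqrt \<bar>x - y\<bar> * l2norm UNIV f" if "primitive F f" "f \<in> L2 UNIV" for F f
      using primitive_Holder[OF that, of x y] primitive_Holder[OF that, of y x]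
      by (cases "x \<le> y") (auto simp: norm_minus_commute)
    have 2: "sqrt \<bar>x - y\<bar> * l2norm UNIV (U1 n) \<le> sqrt \<bar>x - y\<bar> * M" "sqrt \<bar>x - y\<bar> * l2norm UNIV (U2 n) \<le> sqrt \<bar>x - y\<bar> * M"
      using N[of n] by (auto intro!: mult_left_mono)
    show "cmod (U n x - U n y) \<le> sqrt \<bar>x - y\<bar> * M" "cmod (U1 n x - U1 n y) \<le> sqrt \<bar>x - y\<bar> * M"
      using order_trans[OF 1[OF pr(1) L(2)] 2(1)] order_trans[OF 1[OF pr(2) L(3)] 2(2)] by blast+
  qed
  obtain g r where g: "strict_mono (r :: nat \<Rightarrow> nat)"
    "\<And>e. 0 < e \<Longrightarrow> \<exists>N. \<forall>n x. n \<ge> N \<and> x \<in> {a..b} \<longrightarrow> norm ((U (r n) x, U1 (r n) x) - g x) < e"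
  proof (rule Arzela_Ascoli[of "{a..b}" "\<lambda>n x. (U n x, U1 n x)" "S + S"])
    show "norm (U n x, U1 n x) \<le> S + S" if "x \<in> {a..b}" for n x
      using norm_Pair_le[of "U n x" "U1 n x"] sup[OF that, of n] by linarith
    fix x e :: real assume e: "0 < e"
    define d where "d = (e / (2 * M + 1))\<^sup>2"
    have "d > 0" using e M0 by (simp add: d_def)
    moreover have "norm ((U n x, U1 n x) - (U n y, U1 n y)) < e" if "norm (x - y) < d" for n y
    proof -
      have "sqrt \<bar>x - y\<bar> < e / (2 * M + 1)"
        using that e M0 unfolding d_def by (intro real_less_lsqrt) auto
      then have s: "sqrt \<bar>x - y\<bar> * (2 * M + 1) < e" using M0 by (simp add: field_simps)
      have "norm ((U n x, U1 n x) - (U n y, U1 n y)) \<le> cmod (U n x - U n y) + cmod (U1 n x - U1 n y)"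
        using norm_Pair_le[of "U n x - U n y" "U1 n x - U1 n y"] by simp
      also have "\<dots> \<le> sqrt \<bar>x - y\<bar> * M + sqrt \<bar>x - y\<bar> * M" by (intro add_mono holder)
      also have "\<dots> \<le> sqrt \<bar>x - y\<bar> * (2 * M + 1)" by (simp add: algebra_simps)
      finally show ?thesis using s by simp
    qed
    ultimately show "\<exists>d. 0 < d \<and> (\<forall>n y. y \<in> {a..b} \<and> norm (x - y) < d \<longrightarrow> norm ((U n x, U1 n x) - (U n y, U1 n y)) < e)"
      by blast
  qed auto
  show ?thesis
  proof (intro exI[of _ r] conjI g(1) allI impI)
    fix e :: real assume e: "e > 0"
    define e' where "e' = e / (4 * (sqrt (b - a) + 1))"
    have e': "e' > 0" using e ab by (simp add: e'_def add_nonneg_pos)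
    obtain K where K: "\<forall>n x. n \<ge> K \<and> x \<in> {a..b} \<longrightarrow> norm ((U (r n) x, U1 (r n) x) - g x) < e'"
      using g(2)[OF e'] by blast
    have close: "cmod (U (r n) x - U (r m) x) \<le> 2 * e'" "cmod (U1 (r n) x - U1 (r m) x) \<le> 2 * e'"
      if "n \<ge> K" "m \<ge> K" "x \<in> {a..b}" for n m x
    proof -
      have A: "norm ((U (r n) x, U1 (r n) x) - (U (r m) x, U1 (r m) x)) \<le> 2 * e'"
        using K[rule_format, of n x] K[rule_format, of m x] that
          norm_triangle_ineq4[of "(U (r n) x, U1 (r n) x) - g x" "(U (r m) x, U1 (r m) x) - g x"] by simp
      then show "cmod (U (r n) x - U (r m) x) \<le> 2 * e'" "cmod (U1 (r n) x - U1 (r m) x) \<le> 2 * e'"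
        using norm_fst_le[of "U (r n) x - U (r m) x" "U1 (r n) x - U1 (r m) x"]
          norm_snd_le[of "U1 (r n) x - U1 (r m) x" "U (r n) x - U (r m) x"] by simp_all
    qed
    have small: "2 * e' * sqrt (b - a) < e"
    proof -
      have "2 * e' * sqrt (b - a) \<le> 2 * e' * (sqrt (b - a) + 1)" using e' by simp
      also have "\<dots> = e / 2" using ab by (simp add: e'_def field_simps add_nonneg_eq_0_iff)
      finally show ?thesis using e by simp
    qed
    show "\<exists>K. \<forall>n\<ge>K. \<forall>m\<ge>K. norm (restr {a<..<b} (fst (t (r n) - t (r m)))) < e \<and>
        norm (restr {a<..<b} (fst (snd (t (r n) - t (r m))))) < e"
    proof (intro exI[of _ K] allI impI conjI)
      fix n m assume nm: "K \<le> n" "K \<le> m"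
      have "norm (restr {a<..<b} (cls (\<lambda>x. U (r n) x - U (r m) x))) \<le> 2 * e' * sqrt (b - a)"
        by (rule norm_restr_sup[OF L2_diff[OF L(1) L(1)]]) (use close nm ab e' in auto)
      then show "norm (restr {a<..<b} (fst (t (r n) - t (r m)))) < e"
        using small L by (simp add: tU cls_diff)
      have "norm (restr {a<..<b} (cls (\<lambda>x. U1 (r n) x - U1 (r m) x))) \<le> 2 * e' * sqrt (b - a)"
        by (rule norm_restr_sup[OF L2_diff[OF L(2) L(2)]]) (use close nm ab e' in auto)
      then show "norm (restr {a<..<b} (fst (snd (t (r n) - t (r m))))) < e"
        using small L by (simp add: tU cls_diff)
    qed
  qed
qed

lemma tail_shift_small:
  assumes u: "u \<in> L2 UNIV" and e: "e > 0"
  shows "\<exists>k::nat. l2norm UNIV (\<lambda>x. of_real (indicator {-R..R} x) * u (x + real k)) < e"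
proof -
  let ?f = "\<lambda>k x. indicator {real k - R..real k + R} x * (cmod (u x))\<^sup>2"
  have int: "integrable lebesgue (\<lambda>x. (cmod (u x))\<^sup>2)" using L2_integrable[OF u] by (simp add: lebesgue_on_UNIV_eq)
  have "(\<lambda>k. LINT x|lebesgue. ?f k x) \<longlonglongrightarrow> integral\<^sup>L lebesgue (\<lambda>x::real. 0::real)"
  proof (rule integral_dominated_convergence[where w = "\<lambda>x. (cmod (u x))\<^sup>2"])
    show "?f k \<in> borel_measurable lebesgue" for k
      by (intro borel_measurable_times borel_measurable_indicator borel_measurable_integrable[OF int]) simp
    show "AE x in lebesgue. (\<lambda>k. ?f k x) \<longlonglongrightarrow> 0"
    proof (rule AE_I2)
      fix x :: real
      obtain k0 :: nat where "x + R < real k0" using reals_Archimedean2 by blast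
      then have "\<forall>\<^sub>F k in sequentially. 0 = ?f k x"
        by (intro eventually_mono[OF eventually_ge_at_top[of k0]]) (auto simp: indicator_def)
      then show "(\<lambda>k. ?f k x) \<longlonglongrightarrow> 0" by (rule Lim_transform_eventually[OF tendsto_const])
    qed
    show "AE x in lebesgue. norm (?f k x) \<le> (cmod (u x))\<^sup>2" for k
      by (intro AE_I2) (auto simp: indicator_def)
  qed (use int in auto)
  then have "(\<lambda>k. LINT x|lebesgue. ?f k x) \<longlonglongrightarrow> 0" by simp
  moreover have "0 < e\<^sup>2" using e by simp
  ultimately have "\<forall>\<^sub>F k in sequentially. (LINT x|lebesgue. ?f k x) < e\<^sup>2" by (rule order_tendstoD(2))
  then obtain k where k: "(LINT x|lebesgue. ?f k x) < e\<^sup>2" using eventually_happens' sequentially_bot by blast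
  have "(l2norm UNIV (\<lambda>x. of_real (indicator {-R..R} x) * u (x + real k)))\<^sup>2 = (LINT x|lebesgue. ?f k (real k + 1 * x))"
    unfolding l2norm_power2 lebesgue_on_UNIV_eq
    by (intro Bochner_Integration.integral_cong) (auto simp: norm_mult power_mult_distrib indicator_def add.commute)
  also have "\<dots> = (LINT x|lebesgue. ?f k x)"
    using lebesgue_integral_real_affine[of 1 "?f k" "real k"] by simp
  finally have "(l2norm UNIV (\<lambda>x. of_real (indicator {-R..R} x) * u (x + real k)))\<^sup>2 < e\<^sup>2" using k by simp
  then have "l2norm UNIV (\<lambda>x. of_real (indicator {-R..R} x) * u (x + real k)) < e"
    using e by (intro power2_less_imp_less[of _ e]) auto
  then show ?thesis by blast
qed

text \<open>The only possible limit is zero, because it vanishes on every bounded interval; but it would have norm $1$.\<close>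
lemma vanishing_no_convergent_subsequence:
  fixes V :: "nat \<Rightarrow> l2"
  assumes V: "\<And>n. norm (V n) = 1" and small: "\<And>n. norm (restr {- real n..real n} (V n)) \<le> 1 / real (Suc n)"
  shows "\<not> (\<exists>r. strict_mono (r :: nat \<Rightarrow> nat) \<and> convergent (\<lambda>n. V (r n)))"
proof
  assume "\<exists>r. strict_mono (r :: nat \<Rightarrow> nat) \<and> convergent (\<lambda>n. V (r n))"
  then obtain r v where r: "strict_mono (r :: nat \<Rightarrow> nat)" and v: "(\<lambda>n. V (r n)) \<longlonglongrightarrow> v" by (auto simp: convergent_def)
  have zero: "restr {- real k..real k} v = 0" for k
  proof -
    have "(\<lambda>n. restr {- real k..real k} (V (r n))) \<longlonglongrightarrow> restr {- real k..real k} v"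
      by (rule bounded_linear.tendsto[OF bounded_linear_mult_l2 v])
    moreover have "(\<lambda>n. restr {- real k..real k} (V (r n))) \<longlonglongrightarrow> 0"
    proof (rule Lim_null_comparison[OF _ LIMSEQ_Suc[OF lim_1_over_n]])
      show "\<forall>\<^sub>F n in sequentially. norm (restr {- real k..real k} (V (r n))) \<le> 1 / real (Suc n)"
        using eventually_ge_at_top[of k]
      proof eventually_elim
        case (elim n)
        have rn: "n \<le> r n" by (rule strict_mono_imp_increasing[OF r])
        have eq: "of_real (indicator {- real k..real k} x) * complex_of_real (indicator {- real (r n)..real (r n)} x)
            = complex_of_real (indicator {- real k..real k} x)" for x
          using elim rn by (auto simp: indicator_def)
        have mi: "multiplier (\<lambda>x. complex_of_real (indicator {- real j..real j} x))" for j
          by (rule multiplier_indicator) simp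
        have "restr {- real k..real k} (V (r n)) = restr {- real k..real k} (restr {- real (r n)..real (r n)} (V (r n)))"
          by (simp only: mult_mult_l2(1)[OF mi mi] eq)
        then have "norm (restr {- real k..real k} (V (r n))) \<le> norm (restr {- real (r n)..real (r n)} (V (r n)))"
          using norm_restr_le[of "{- real k..real k}"] by simp
        also have "\<dots> \<le> 1 / real (Suc (r n))" by (rule small)
        also have "\<dots> \<le> 1 / real (Suc n)" using rn by (intro divide_left_mono) auto
        finally show ?case .
      qed
    qed
    ultimately show ?thesis by (rule LIMSEQ_unique)
  qed
  obtain f where f: "v = cls f" "f \<in> L2 UNIV" by (rule cls_cases)
  have ae: "AE x in lebesgue. of_real (indicator {- real k..real k} x) * f x = 0" for k
  proof -
    have m: "multiplier (\<lambda>x. complex_of_real (indicator {- real k..real k} x))" by (rule multiplier_indicator) simp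
    have "cls (\<lambda>x. of_real (indicator {- real k..real k} x) * f x) = cls (\<lambda>x. 0)"
      using zero[of k] f m by (simp add: mult_l2_cls cls_zero)
    then show ?thesis using cls_eq_iff[OF multiplier_L2[OF m f(2)] L2_zero] by (simp add: ae_eq_UNIV)
  qed
  have "AE x in lebesgue. \<forall>k::nat. of_real (indicator {- real k..real k} x) * f x = 0"
    unfolding AE_all_countable by (rule allI) (rule ae)
  then have "AE x in lebesgue. f x = 0"
  proof eventually_elim
    case (elim x)
    obtain k :: nat where "\<bar>x\<bar> \<le> real k" using real_arch_simple by blast
    then have "x \<in> {- real k..real k}" by (auto simp: abs_le_iff)
    then show ?case using elim[rule_format, of k] by simp
  qed
  then have "v = 0" using f cls_eqI[of f "\<lambda>x. 0"] by (simp add: ae_eq_UNIV cls_zero)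
  moreover have "(\<lambda>n. norm (V (r n))) \<longlonglongrightarrow> norm v" by (rule tendsto_norm[OF v])
  then have "norm v = 1" by (simp add: V LIMSEQ_const_iff)
  ultimately show False by simp
qed

section \<open>Local perturbations\<close>

text \<open>A linear map on the domain that is controlled by the $W_2^2$-norm on an interval. Linearity is stated on the
subspace of triples because nothing is known outside of it.\<close>
definition local_pert :: "real \<Rightarrow> real \<Rightarrow> real \<Rightarrow> (l2 \<times> l2 \<times> l2 \<Rightarrow> l2) \<Rightarrow> bool" where
  "local_pert a b \<eta> T \<longleftrightarrow> (\<forall>s\<in>W22_triples. \<forall>t\<in>W22_triples. T (s - t) = T s - T t) \<and>
     (\<forall>c. \<forall>t\<in>W22_triples. T (c *\<^sub>R t) = c *\<^sub>R T t) \<and>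
     (\<forall>t\<in>W22_triples. norm (T t) \<le> \<eta> * (norm (restr {a<..<b} (fst t)) + norm (restr {a<..<b} (fst (snd t)))
        + norm (restr {a<..<b} (snd (snd t)))))"

lemma local_pert_diff: "local_pert a b \<eta> T \<Longrightarrow> s \<in> W22_triples \<Longrightarrow> t \<in> W22_triples \<Longrightarrow> T (s - t) = T s - T t"
  and local_pert_scale: "local_pert a b \<eta> T \<Longrightarrow> t \<in> W22_triples \<Longrightarrow> T (c *\<^sub>R t) = c *\<^sub>R T t"
  and local_pert_norm: "local_pert a b \<eta> T \<Longrightarrow> t \<in> W22_triples \<Longrightarrow>
     norm (T t) \<le> \<eta> * (norm (restr {a<..<b} (fst t)) + norm (restr {a<..<b} (fst (snd t)))
        + norm (restr {a<..<b} (snd (snd t))))"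
  unfolding local_pert_def by blast+

context coeffs begin

lemma rmult_commute:
  assumes "multiplier (\<lambda>x. complex_of_real (m x))" "multiplier (\<lambda>x. complex_of_real (n x))"
  shows "rmult m (rmult n x) = rmult n (rmult m x)"
  using assms by (simp add: mult_mult_l2 mult.commute)

text \<open>Multiply the equation, solved for $pu''$, by the indicator function of the interval; multiplication operators
commute.\<close>
lemma local_elliptic_estimate:
  fixes a b :: real
  assumes "t \<in> W22_triples"
  defines "R \<equiv> restr {a<..<b}"
  shows "p0 * norm (R (snd (snd t))) \<le> norm (SLz p d q z t) + (B + cmod z) * (norm (R (fst t)) + norm (R (fst (snd t))))"
proof -
  obtain x x1 x2 where t: "t = (x, x1, x2)" by (cases t) auto
  have mi: "multiplier (\<lambda>x. complex_of_real (indicator {a<..<b} x))" by (rule multiplier_indicator) simp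
  note linR = linear_mult_l2[of "\<lambda>x. complex_of_real (indicator {a<..<b} x)", folded R_def]
  have "rmult p x2 = rmult q x - rmult d x1 - mult_l2 (\<lambda>_. z) x - SLz p d q z t" by (simp add: SLz_def SL_def t)
  then have "R (rmult p x2) = R (rmult q x) - R (rmult d x1) - R (mult_l2 (\<lambda>_. z) x) - R (SLz p d q z t)"
    by (simp add: linear_diff[OF linR])
  then have "rmult p (R x2) = rmult q (R x) - rmult d (R x1) - mult_l2 (\<lambda>_. z) (R x) - R (SLz p d q z t)"
    unfolding R_def rmult_commute[OF mi mult_p] rmult_commute[OF mi mult_q] rmult_commute[OF mi mult_d]
    using mi by (simp add: mult_mult_l2 mult.commute)
  then have "norm (rmult p (R x2)) \<le> norm (rmult q (R x)) + norm (rmult d (R x1)) + norm (mult_l2 (\<lambda>_. z) (R x)) + norm (R (SLz p d q z t))"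
    using norm_triangle_ineq4[of "rmult q (R x) - rmult d (R x1) - mult_l2 (\<lambda>_. z) (R x)" "R (SLz p d q z t)"]
      norm_triangle_ineq4[of "rmult q (R x) - rmult d (R x1)" "mult_l2 (\<lambda>_. z) (R x)"]
      norm_triangle_ineq4[of "rmult q (R x)" "rmult d (R x1)"] by simp
  moreover have "norm (R (SLz p d q z t)) \<le> norm (SLz p d q z t)" unfolding R_def by (rule norm_restr_le) simp
  moreover have "norm (mult_l2 (\<lambda>_. z) (R x)) = cmod z * norm (R x)" by (rule norm_mult_l2_const)
  moreover have "0 \<le> cmod z * norm (R x1)" by simp
  ultimately have "p0 * norm (R x2) \<le> B * norm (R x) + B * norm (R x1) + cmod z * norm (R x) + cmod z * norm (R x1) + norm (SLz p d q z t)"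
    using norm_rmult_p[of "R x2"] norm_rmult[OF measurable_q q_bound, of "R x"] norm_rmult[OF measurable_d d_bound, of "R x1"]
    by linarith
  then show ?thesis by (simp add: t algebra_simps)
qed

lemma local_pert_estimate:
  assumes T: "local_pert a b \<eta> T" and \<eta>: "0 \<le> \<eta>" and t: "t \<in> W22_triples"
  shows "norm (T t) \<le> \<eta> / p0 * norm (SLz p d q z t)
    + \<eta> * (1 + (B + cmod z) / p0) * (norm (restr {a<..<b} (fst t)) + norm (restr {a<..<b} (fst (snd t))))"
proof -
  let ?r = "norm (restr {a<..<b} (fst t)) + norm (restr {a<..<b} (fst (snd t)))" and ?s = "norm (restr {a<..<b} (snd (snd t)))"
  have "?s * p0 \<le> norm (SLz p d q z t) + (B + cmod z) * ?r"
    using local_elliptic_estimate[OF t, of a b z] by (simp add: mult.commute)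
  then have "?s \<le> (norm (SLz p d q z t) + (B + cmod z) * ?r) / p0" by (simp only: pos_le_divide_eq[OF p0_pos])
  then have "\<eta> * (?r + ?s) \<le> \<eta> * (?r + (norm (SLz p d q z t) + (B + cmod z) * ?r) / p0)"
    using \<eta> by (intro mult_left_mono add_left_mono)
  also have "\<dots> = \<eta> / p0 * norm (SLz p d q z t) + \<eta> * (1 + (B + cmod z) / p0) * ?r"
    by (simp add: field_simps add_divide_distrib)
  finally show ?thesis using local_pert_norm[OF T t] by linarith
qed

text \<open>By local compactness the lower-order terms in \<open>local_pert_estimate\<close> tend to zero on differences. The
subsequence does not depend on \<open>T\<close>, so it serves two perturbations at once.\<close>
lemma local_pert_compact:
  assumes ab: "a < b" and \<eta>: "0 \<le> \<eta>" and t: "\<And>n. t n \<in> W22_triples"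
    and M: "\<And>n. norm (fst (t n)) + norm (fst (snd (t n))) + norm (snd (snd (t n))) \<le> M"
  shows "\<exists>r. strict_mono (r :: nat \<Rightarrow> nat) \<and> (\<forall>T. local_pert a b \<eta> T \<longrightarrow> (\<forall>e>0. \<exists>K. \<forall>n\<ge>K. \<forall>m\<ge>K.
       norm (T (t (r n) - t (r m))) \<le> \<eta> / p0 * norm (SLz p d q z (t (r n) - t (r m))) + e))"
proof -
  have M': "norm (fst (t n)) \<le> M" "norm (fst (snd (t n))) \<le> M" "norm (snd (snd (t n))) \<le> M" for n
    using M[of n] norm_ge_zero[of "fst (t n)"] norm_ge_zero[of "fst (snd (t n))"] norm_ge_zero[of "snd (snd (t n))"]
    by linarith+
  obtain r where r: "strict_mono (r :: nat \<Rightarrow> nat)"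
    "\<forall>e>0. \<exists>K. \<forall>n\<ge>K. \<forall>m\<ge>K. norm (restr {a<..<b} (fst (t (r n) - t (r m)))) < e \<and>
        norm (restr {a<..<b} (fst (snd (t (r n) - t (r m))))) < e"
    using local_compactness[where t = t, OF ab t M'] by (elim exE conjE)
  show ?thesis
  proof (intro exI[of _ r] conjI r(1) allI impI)
    fix T and e :: real assume T: "local_pert a b \<eta> T" and e: "e > 0"
    define k where "k = \<eta> * (1 + (B + cmod z) / p0)"
    have k0: "k \<ge> 0" using \<eta> B_pos p0_pos by (simp add: k_def)
    obtain K where K: "\<forall>n\<ge>K. \<forall>m\<ge>K. norm (restr {a<..<b} (fst (t (r n) - t (r m)))) < e / (2 * (k + 1)) \<and>
        norm (restr {a<..<b} (fst (snd (t (r n) - t (r m))))) < e / (2 * (k + 1))"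
      using r(2)[rule_format, of "e / (2 * (k + 1))"] e k0 by auto
    show "\<exists>K. \<forall>n\<ge>K. \<forall>m\<ge>K.
       norm (T (t (r n) - t (r m))) \<le> \<eta> / p0 * norm (SLz p d q z (t (r n) - t (r m))) + e"
    proof (intro exI[of _ K] allI impI)
      fix n m assume nm: "K \<le> n" "K \<le> m"
      let ?w = "t (r n) - t (r m)"
      have w: "?w \<in> W22_triples" using t by (intro subspace_diff subspace_W22_triples)
      let ?r = "norm (restr {a<..<b} (fst ?w)) + norm (restr {a<..<b} (fst (snd ?w)))"
      have "?r \<le> e / (2 * (k + 1)) + e / (2 * (k + 1))" using K nm by (intro add_mono) (auto simp: less_imp_le)
      also have "\<dots> = e / (k + 1)"
      proof -
        have "e / (2 * (k + 1)) = e / (k + 1) / 2" by (simp only: divide_divide_eq_left mult.commute)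
        then show ?thesis by (simp only: field_sum_of_halves)
      qed
      finally have "k * ?r \<le> k * (e / (k + 1))" using k0 by (intro mult_left_mono)
      also have "\<dots> \<le> e" using k0 e by (simp add: field_simps)
      finally show "norm (T ?w) \<le> \<eta> / p0 * norm (SLz p d q z ?w) + e"
        using local_pert_estimate[OF T \<eta> w, of z] unfolding k_def by linarith
    qed
  qed
qed

lemma SL_SLz: "SL p d q t = SLz p d q z t + mult_l2 (\<lambda>_. z) (fst t)"
  by (simp add: SLz_def)

lemma norm_SL_le: "norm (SL p d q t) \<le> norm (SLz p d q z t) + cmod z * norm (fst t)"
  unfolding SL_SLz[of t z] norm_mult_l2_const[symmetric] by (rule norm_triangle_ineq)

lemma local_pert_global_norm:
  assumes T: "local_pert a b \<eta> T" and \<eta>: "0 \<le> \<eta>" and t: "t \<in> W22_triples"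
  shows "norm (T t) \<le> 2 * \<eta> * norm (fst t) + 2 * \<eta> * norm (snd (snd t))"
proof -
  have r: "norm (restr {a<..<b} x) \<le> norm x" for x by (rule norm_restr_le) simp
  have "norm (T t) \<le> \<eta> * (norm (restr {a<..<b} (fst t)) + norm (restr {a<..<b} (fst (snd t))) + norm (restr {a<..<b} (snd (snd t))))"
    by (rule local_pert_norm[OF T t])
  also have "\<dots> \<le> \<eta> * (norm (fst t) + (norm (fst t) + norm (snd (snd t))) + norm (snd (snd t)))"
    using \<eta> order_trans[OF r norm_first_derivative[OF t]] by (intro mult_left_mono add_mono r) auto
  finally show ?thesis by (simp add: algebra_simps)
qed

text \<open>For $\eta<p_0/8$ the contribution of \<open>T\<close> is absorbed into half of the second derivative.\<close>
lemma graph_norm_bound: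
  assumes T: "local_pert a b \<eta> T" and \<eta>: "0 \<le> \<eta>" "\<eta> < p0 / 8" and t: "t \<in> W22_triples"
  shows "p0 / 2 * norm (snd (snd t)) \<le> 2 * norm (SLz p d q z t - T t) + (p0 + 2 * cmod z + B\<^sup>2 / p0 + 2 * B) * norm (fst t)"
proof -
  let ?x = "norm (fst t)" and ?x2 = "norm (snd (snd t))" and ?N = "norm (SLz p d q z t - T t)"
  have "norm (SLz p d q z t) \<le> ?N + norm (T t)"
    using norm_triangle_ineq[of "SLz p d q z t - T t" "T t"] by simp
  also have "\<dots> \<le> ?N + (2 * \<eta> * ?x + 2 * \<eta> * ?x2)"
    using local_pert_global_norm[OF T \<eta>(1) t] by simp
  finally have 1: "norm (SL p d q t) \<le> ?N + 2 * \<eta> * ?x + 2 * \<eta> * ?x2 + cmod z * ?x"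
    using norm_SL_le[of t z] by simp
  have 2: "2 * \<eta> * ?x \<le> p0 / 4 * ?x" "2 * \<eta> * ?x2 \<le> p0 / 4 * ?x2"
    using \<eta> by (intro mult_right_mono norm_ge_zero; simp)+
  define V where "V = (B\<^sup>2 / p0 + 2 * B) * ?x"
  have "p0 * ?x2 \<le> 2 * norm (SL p d q t) + V" unfolding V_def by (rule norm_second_derivative[OF t])
  also have "\<dots> \<le> 2 * (?N + p0 / 4 * ?x + p0 / 4 * ?x2 + cmod z * ?x) + V"
    using 1 2 by simp
  finally have 3: "p0 * ?x2 \<le> 2 * ?N + (p0 * ?x) / 2 + (p0 * ?x2) / 2 + 2 * (cmod z * ?x) + V" by simp
  moreover have "0 \<le> p0 * ?x" using p0_pos by simp
  ultimately have "(p0 * ?x2) / 2 \<le> 2 * ?N + p0 * ?x + 2 * (cmod z * ?x) + V" by linarith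
  then show ?thesis unfolding V_def by (simp add: distrib_right)
qed

text \<open>Stated for two perturbations, it gives both inclusions between the continuous spectra of $H_0$ and of its
perturbation.\<close>
theorem glazman_perturbation:
  assumes ab: "a < b" and \<eta>: "0 \<le> \<eta>" "\<eta> < p0 / 8"
    and T1: "local_pert a b \<eta> T1" and T2: "local_pert a b \<eta> T2"
    and gl: "glazman W22_triples fst (\<lambda>t. SLz p d q z t - T1 t)"
  shows "glazman W22_triples fst (\<lambda>t. SLz p d q z t - T2 t)"
proof -
  let ?A1 = "\<lambda>t. SLz p d q z t - T1 t" and ?A2 = "\<lambda>t. SLz p d q z t - T2 t"
  obtain u C where u: "\<And>n. u n \<in> W22_triples" "\<And>n. norm (fst (u n)) \<le> C"
    and none: "\<not> (\<exists>r. strict_mono (r :: nat \<Rightarrow> nat) \<and> convergent (\<lambda>n. fst (u (r n))))"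
    and lim: "(\<lambda>n. ?A1 (u n)) \<longlonglongrightarrow> 0"
    using gl unfolding glazman_def by blast
  have C0: "0 \<le> C" using u(2)[of 0] norm_ge_zero order_trans by blast
  obtain D where D: "\<And>n. norm (?A1 (u n)) \<le> D"
    using convergent_imp_Bseq[OF convergentI[OF lim]] unfolding Bseq_def by blast
  define k where "k = p0 + 2 * cmod z + B\<^sup>2 / p0 + 2 * B"
  have k0: "k \<ge> 0" using p0_pos B_pos by (simp add: k_def)
  define M2 where "M2 = (2 * D + k * C) / (p0 / 2)"
  have x2: "norm (snd (snd (u n))) \<le> M2" for n
  proof -
    have "p0 / 2 * norm (snd (snd (u n))) \<le> 2 * norm (?A1 (u n)) + k * norm (fst (u n))"
      unfolding k_def by (rule graph_norm_bound[OF T1 \<eta> u(1)])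
    also have "\<dots> \<le> 2 * D + k * C" using D[of n] u(2)[of n] k0 by (intro add_mono mult_left_mono) auto
    finally have "norm (snd (snd (u n))) * (p0 / 2) \<le> 2 * D + k * C" by (simp add: mult.commute)
    then show ?thesis unfolding M2_def using p0_pos by (subst pos_le_divide_eq) auto
  qed
  have bound: "norm (fst (u n)) + norm (fst (snd (u n))) + norm (snd (snd (u n))) \<le> C + (C + M2) + M2" for n
    using u(2)[of n] x2[of n] norm_first_derivative[OF u(1)[of n]] by linarith
  obtain r where r: "strict_mono (r :: nat \<Rightarrow> nat)"
    and T': "\<forall>T. local_pert a b \<eta> T \<longrightarrow> (\<forall>e>0. \<exists>K. \<forall>n\<ge>K. \<forall>m\<ge>K.
       norm (T (u (r n) - u (r m))) \<le> \<eta> / p0 * norm (SLz p d q z (u (r n) - u (r m))) + e)"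
    using local_pert_compact[where t = u and z = z, OF ab \<eta>(1) u(1) bound] by (elim exE conjE)
  note T = T'[rule_format]
  have ratio: "\<eta> / p0 < 1 / 8" "0 \<le> \<eta> / p0" using \<eta> p0_pos by (simp_all add: field_simps)
  show ?thesis
  proof (rule glazman_of_differences[OF subspace_W22_triples, of fst "\<lambda>n. u (r n)" C])
    show "linear fst" by (rule linear_fst)
    show "\<not> (\<exists>s. strict_mono (s :: nat \<Rightarrow> nat) \<and> convergent (\<lambda>n. fst (u (r (s n)))))"
    proof
      assume "\<exists>s. strict_mono (s :: nat \<Rightarrow> nat) \<and> convergent (\<lambda>n. fst (u (r (s n))))"
      then obtain s where "strict_mono (s :: nat \<Rightarrow> nat)" "convergent (\<lambda>n. fst (u ((r \<circ> s) n)))" by auto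
      then show False using none strict_mono_o[OF r] by blast
    qed
    fix e :: real assume e: "e > 0"
    \<comment> \<open>the differences are nearly annihilated by $H_0-z$, since $T_1$ is absorbed, and then by $T_2$ as well\<close>
    obtain K1 where K1: "\<forall>n\<ge>K1. \<forall>m\<ge>K1. norm (T1 (u (r n) - u (r m))) \<le> \<eta> / p0 * norm (SLz p d q z (u (r n) - u (r m))) + e / 8"
      using T[OF T1, of "e / 8"] e by auto
    obtain K2 where K2: "\<forall>n\<ge>K2. \<forall>m\<ge>K2. norm (T2 (u (r n) - u (r m))) \<le> \<eta> / p0 * norm (SLz p d q z (u (r n) - u (r m))) + e / 8"
      using T[OF T2, of "e / 8"] e by auto
    obtain K3 where K3: "\<And>n. n \<ge> K3 \<Longrightarrow> norm (?A1 (u n)) < e / 8"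
      using LIMSEQ_D[OF lim, of "e / 8"] e by auto
    show "\<exists>K. \<forall>n\<ge>K. \<forall>m\<ge>K. norm (?A2 (u (r n) - u (r m))) < e"
    proof (intro exI[of _ "max (max K1 K2) K3"] allI impI)
      fix n m assume nm: "max (max K1 K2) K3 \<le> n" "max (max K1 K2) K3 \<le> m"
      let ?w = "u (r n) - u (r m)"
      have rn: "K3 \<le> r n" "K3 \<le> r m"
        using strict_mono_imp_increasing[OF r, of n] strict_mono_imp_increasing[OF r, of m] nm by auto
      have "?A1 ?w = ?A1 (u (r n)) - ?A1 (u (r m))"
        using local_pert_diff[OF T1 u(1) u(1)] by (simp add: linear_diff[OF linear_SLz])
      then have A1: "norm (?A1 ?w) \<le> e / 8 + e / 8"
        using norm_triangle_ineq4[of "?A1 (u (r n))" "?A1 (u (r m))"] K3[OF rn(1)] K3[OF rn(2)] by simp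
      let ?Z = "norm (SLz p d q z ?w)"
      have t1: "norm (T1 ?w) \<le> \<eta> / p0 * ?Z + e / 8" using K1 nm by simp
      have t2: "norm (T2 ?w) \<le> \<eta> / p0 * ?Z + e / 8" using K2 nm by simp
      have z8: "\<eta> / p0 * ?Z \<le> 1 / 8 * ?Z" using ratio by (intro mult_right_mono) auto
      have "?Z \<le> norm (?A1 ?w) + norm (T1 ?w)"
        using norm_triangle_ineq[of "?A1 ?w" "T1 ?w"] by simp
      moreover have "norm (?A2 ?w) \<le> ?Z + norm (T2 ?w)" by (rule norm_triangle_ineq4)
      ultimately show "norm (?A2 ?w) < e" using A1 t1 t2 z8 e by linarith
    qed
  qed (use u in auto)
qed

text \<open>With \<open>R\<close> the inverse of $H-z$ and $N=TR$ one has $H-z-T=(1-N)(H-z)$, and the Fredholm alternative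
applies to $N$.\<close>
theorem surjective_perturbation:
  assumes ab: "a < b" and \<eta>: "0 \<le> \<eta>" "\<eta> < p0 / 8" and T: "local_pert a b \<eta> T"
    and c: "c > 0" and below: "\<And>t. t \<in> W22_triples \<Longrightarrow> c * norm (fst t) \<le> norm (SLz p d q z t)"
    and inj: "\<And>t. t \<in> W22_triples \<Longrightarrow> SLz p d q z t - T t = 0 \<Longrightarrow> fst t = 0"
  shows "\<exists>t\<in>W22_triples. SLz p d q z t - T t = y"
    and "\<exists>C. \<forall>t\<in>W22_triples. norm (fst t) \<le> C * norm (SLz p d q z t - T t)"
proof -
  let ?A = "SLz p d q z"
  define W where "W = (2 + 2 * (2 + B\<^sup>2 / p0 + 2 * B) / p0) * (1 + (cmod z + 1) / c)"
  have W: "norm (fst t) + norm (fst (snd t)) + norm (snd (snd t)) \<le> W * norm (?A t)" if t: "t \<in> W22_triples" for t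
  proof -
    have x: "norm (fst t) \<le> norm (?A t) / c" using below[OF t] c by (simp add: field_simps)
    have "norm (SL p d q t) + norm (fst t) \<le> norm (?A t) + (cmod z + 1) * norm (fst t)"
      using norm_SL_le[of t z] by (simp add: algebra_simps)
    also have "\<dots> \<le> norm (?A t) + (cmod z + 1) * (norm (?A t) / c)"
      using x by (intro add_left_mono mult_left_mono) auto
    also have "\<dots> = (1 + (cmod z + 1) / c) * norm (?A t)" by (simp add: field_simps)
    finally have "(2 + 2 * (2 + B\<^sup>2 / p0 + 2 * B) / p0) * (norm (SL p d q t) + norm (fst t))
      \<le> (2 + 2 * (2 + B\<^sup>2 / p0 + 2 * B) / p0) * ((1 + (cmod z + 1) / c) * norm (?A t))"
      using B_pos p0_pos by (intro mult_left_mono add_nonneg_nonneg divide_nonneg_nonneg mult_nonneg_nonneg) auto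
    then show ?thesis using W22_bound[OF t] unfolding W_def by (simp only: mult.assoc)
  qed
  have W0: "W \<ge> 0" unfolding W_def using B_pos p0_pos c
    by (intro mult_nonneg_nonneg add_nonneg_nonneg divide_nonneg_nonneg) auto
  have "\<forall>y. \<exists>t\<in>W22_triples. ?A t = y" using surjective_of_lower_bound[OF c below] by (simp add: surj_at_def)
  then obtain R where R: "\<And>y. R y \<in> W22_triples" "\<And>y. ?A (R y) = y" by metis
  have uniq: "s = t" if st: "s \<in> W22_triples" "t \<in> W22_triples" "?A s = ?A t" for s t
  proof -
    have w: "s - t \<in> W22_triples" using st by (intro subspace_diff subspace_W22_triples)
    have "?A (s - t) = 0" using st(3) by (simp add: linear_diff[OF linear_SLz])
    then have "norm (fst (s - t)) + norm (fst (snd (s - t))) + norm (snd (snd (s - t))) \<le> 0" using W[OF w] by simp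
    then have "fst (s - t) = 0" "fst (snd (s - t)) = 0" "snd (snd (s - t)) = 0"
      using norm_ge_zero[of "fst (s - t)"] norm_ge_zero[of "fst (snd (s - t))"] norm_ge_zero[of "snd (snd (s - t))"]
      by (simp_all only: norm_le_zero_iff[symmetric])
    then have "s - t = 0" by (simp add: prod_eq_iff)
    then show ?thesis by simp
  qed
  have R_diff: "R (y - y') = R y - R y'" for y y'
    by (rule uniq) (simp_all add: R subspace_diff[OF subspace_W22_triples] linear_diff[OF linear_SLz])
  have R_scale: "R (k *\<^sub>R y) = k *\<^sub>R R y" for k y
    by (rule uniq) (simp_all add: R subspace_scale[OF subspace_W22_triples] linear_scale[OF linear_SLz])
  define N where "N y = T (R y)" for y
  have N_diff: "N (y - y') = N y - N y'" for y y'
    unfolding N_def R_diff by (rule local_pert_diff[OF T R(1) R(1)])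
  have N_scale: "N (k *\<^sub>R y) = k *\<^sub>R N y" for k y
    unfolding N_def R_scale by (rule local_pert_scale[OF T R(1)])
  have N: "bounded_linear N"
  proof (rule bounded_linear_intro)
    show "N (x + y) = N x + N y" for x y
      using N_diff[of x "(-1) *\<^sub>R y"] N_scale[of "-1" y] by simp
    show "N (k *\<^sub>R x) = k *\<^sub>R N x" for k x by (rule N_scale)
    show "norm (N x) \<le> norm x * (2 * \<eta> * W)" for x
    proof -
      have "norm (N x) \<le> 2 * \<eta> * norm (fst (R x)) + 2 * \<eta> * norm (snd (snd (R x)))"
        unfolding N_def by (rule local_pert_global_norm[OF T \<eta>(1) R(1)])
      also have "\<dots> = 2 * \<eta> * (norm (fst (R x)) + norm (snd (snd (R x))))" by (simp add: algebra_simps)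
      also have "\<dots> \<le> 2 * \<eta> * (W * norm x)"
      proof (rule mult_left_mono)
        show "norm (fst (R x)) + norm (snd (snd (R x))) \<le> W * norm x"
          using W[OF R(1)[of x]] norm_ge_zero[of "fst (snd (R x))"] unfolding R(2) by linarith
      qed (use \<eta> in simp)
      finally show ?thesis by (simp add: algebra_simps)
    qed
  qed
  have ratio: "0 \<le> \<eta> / p0" "\<eta> / p0 < 1 / 4" using \<eta> p0_pos by (simp_all add: field_simps)
  have comp: "\<exists>r. strict_mono (r :: nat \<Rightarrow> nat) \<and>
       (\<forall>e>0. \<exists>K. \<forall>n\<ge>K. \<forall>m\<ge>K. norm (N (x (r n)) - N (x (r m))) \<le> \<eta> / p0 * norm (x (r n) - x (r m)) + e)"
    if x: "\<And>n. norm (x n) \<le> C" for x :: "nat \<Rightarrow> l2" and C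
  proof -
    have xb: "norm (fst (R (x n))) + norm (fst (snd (R (x n)))) + norm (snd (snd (R (x n)))) \<le> W * C" for n
      using W[OF R(1)[of "x n"]] mult_left_mono[OF x[of n] W0] unfolding R(2) by linarith
    obtain r where r: "strict_mono (r :: nat \<Rightarrow> nat)"
      and rT: "\<forall>T. local_pert a b \<eta> T \<longrightarrow> (\<forall>e>0. \<exists>K. \<forall>n\<ge>K. \<forall>m\<ge>K.
       norm (T (R (x (r n)) - R (x (r m)))) \<le> \<eta> / p0 * norm (?A (R (x (r n)) - R (x (r m)))) + e)"
      using local_pert_compact[where t = "\<lambda>n. R (x n)" and z = z, OF ab \<eta>(1) R(1) xb] by (elim exE conjE)
    have "?A (R y - R y') = y - y'" "T (R y - R y') = N y - N y'" for y y'
      by (simp_all add: linear_diff[OF linear_SLz] R N_def local_pert_diff[OF T])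
    then show ?thesis using r rT[rule_format, OF T] by auto
  qed
  \<comment> \<open>injectivity is known for the function only; the estimate of $u''$ shows that then also $x=(H-z)u$ vanishes\<close>
  have inj': "x = 0" if "x - N x = 0" for x
  proof -
    have "fst (R x) = 0" using that by (intro inj[OF R(1)]) (simp add: R N_def)
    then have "norm (N x) \<le> 2 * \<eta> * norm (snd (snd (R x)))"
      using local_pert_global_norm[OF T \<eta>(1) R(1)[of x]] by (simp add: N_def)
    also have "\<dots> \<le> p0 / 4 * norm (snd (snd (R x)))" using \<eta> by (intro mult_right_mono) auto
    finally have 1: "norm x \<le> p0 / 4 * norm (snd (snd (R x)))" using that by simp
    have "p0 * norm (snd (snd (R x))) \<le> 2 * norm (SL p d q (R x))"
      using norm_second_derivative[OF R(1)[of x]] \<open>fst (R x) = 0\<close> by simp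
    also have "\<dots> \<le> 2 * norm x" using norm_SL_le[of "R x" z] \<open>fst (R x) = 0\<close> by (simp add: R)
    finally have "norm x \<le> 0" using 1 by linarith
    then show ?thesis by simp
  qed
  have fa1: "\<exists>k>0. \<forall>x. k * norm x \<le> norm (x - N x)"
    by (rule fredholm_alternative(1)[OF N ratio]) (fact comp, fact inj')
  have fa2: "\<exists>x. x - N x = y"
    by (rule fredholm_alternative(2)[OF N ratio]) (fact comp, fact inj')
  obtain x where x: "x - N x = y" using fa2 by blast
  then show "\<exists>t\<in>W22_triples. ?A t - T t = y" using R by (intro bexI[of _ "R x"]) (simp_all add: N_def)
  obtain k where k: "k > 0" "\<And>x. k * norm x \<le> norm (x - N x)" using fa1 by blast
  show "\<exists>C. \<forall>t\<in>W22_triples. norm (fst t) \<le> C * norm (?A t - T t)"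
  proof (intro exI ballI)
    fix t assume t: "t \<in> W22_triples"
    have "R (?A t) = t" by (rule uniq[OF R(1) t]) (simp add: R)
    then have "k * norm (?A t) \<le> norm (?A t - T t)" using k(2)[of "?A t"] by (simp add: N_def)
    moreover have "k * (c * norm (fst t)) \<le> k * norm (?A t)" using below[OF t] k(1) by (intro mult_left_mono) auto
    ultimately have "norm (fst t) * (k * c) \<le> norm (?A t - T t)" by (simp add: mult_ac)
    then show "norm (fst t) \<le> (1 / (k * c)) * norm (?A t - T t)"
      using k(1) c by (simp add: pos_le_divide_eq)
  qed
qed

end

locale periodic_coeffs = coeffs +
  assumes p_periodic: "\<And>x. p (x + 1) = p x" and d_periodic: "\<And>x. d (x + 1) = d x" and q_periodic: "\<And>x. q (x + 1) = q x"
begin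

lemma periodic_nat: "p (x + real k) = p x" "d (x + real k) = d x" "q (x + real k) = q x"
proof -
  have "f (x + real k) = f x" if "\<And>x. f (x + 1) = f x" for f :: "real \<Rightarrow> real"
  proof (induction k)
    case (Suc k)
    then show ?case using that[of "x + real k"] by (simp add: add.commute add.left_commute)
  qed simp
  then show "p (x + real k) = p x" "d (x + real k) = d x" "q (x + real k) = q x"
    using p_periodic d_periodic q_periodic by blast+
qed

text \<open>Translation by a large integer keeps all norms and moves the mass of the function out of any given interval.\<close>
lemma escaping_translate:
  assumes t: "t \<in> W22_triples" and e: "e > 0"
  obtains s where "s \<in> W22_triples" "norm (fst s) = norm (fst t)" "norm (SLz p d q z s) = norm (SLz p d q z t)"
    "norm (restr {-R..R} (fst s)) \<le> e"
proof -
  obtain U U1 U2 where tU: "t = (cls U, cls U1, cls U2)" and W: "W22_triple U U1 U2" using W22_triples_cases[OF t] .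
  have L: "U \<in> L2 UNIV" "U1 \<in> L2 UNIV" "U2 \<in> L2 UNIV" using W by (auto simp: W22_triple_def)
  obtain k :: nat where k: "l2norm UNIV (\<lambda>x. of_real (indicator {-R..R} x) * U (x + real k)) < e"
    using tail_shift_small[OF L(1) e] by blast
  have sh: "(\<lambda>x. u (x + real k)) \<in> L2 UNIV" "l2norm UNIV (\<lambda>x. u (x + real k)) = l2norm UNIV u" if "u \<in> L2 UNIV" for u
    using L2_affine[OF that, of 1 "real k"] by (simp_all add: add.commute)
  define V V1 V2 where "V x = U (x + real k)" and "V1 x = U1 (x + real k)" and "V2 x = U2 (x + real k)" for x
  have WV: "W22_triple V V1 V2"
    using W22_triple_shift[OF W] sh L unfolding W22_triple_def V_def V1_def V2_def by blast
  have V: "V \<in> L2 UNIV" using WV by (simp add: W22_triple_def)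
  have OpU: "SLz p d q z t = cls (\<lambda>x. (of_real (q x) * U x - (of_real (d x) * U1 x + of_real (p x) * U2 x)) - z * U x)"
    unfolding SLz_def tU SL_cls(1)[OF W] using L SL_cls(2)[OF W] by (simp add: mult_l2_cls cls_diff L2_scale)
  have OpV: "SLz p d q z (cls V, cls V1, cls V2)
     = cls (\<lambda>x. (of_real (q x) * V x - (of_real (d x) * V1 x + of_real (p x) * V2 x)) - z * V x)"
    unfolding SLz_def SL_cls(1)[OF WV] using V SL_cls(2)[OF WV] by (simp add: mult_l2_cls cls_diff L2_scale)
  let ?E = "\<lambda>x. (of_real (q x) * U x - (of_real (d x) * U1 x + of_real (p x) * U2 x)) - z * U x"
  have E: "?E \<in> L2 UNIV" by (intro L2_diff SL_cls(2)[OF W] L2_scale L)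
  have EV: "(\<lambda>x. (of_real (q x) * V x - (of_real (d x) * V1 x + of_real (p x) * V2 x)) - z * V x) = (\<lambda>x. ?E (x + real k))"
    by (simp add: V_def V1_def V2_def periodic_nat)
  show thesis
  proof (rule that)
    show "(cls V, cls V1, cls V2) \<in> W22_triples" using WV unfolding W22_triples_def by blast
    show "norm (fst (cls V, cls V1, cls V2)) = norm (fst t)"
      using sh(2)[OF L(1)] L(1) V by (simp add: tU norm_cls V_def[abs_def])
    show "norm (SLz p d q z (cls V, cls V1, cls V2)) = norm (SLz p d q z t)"
      unfolding OpU OpV EV using E sh[OF E] by (simp add: norm_cls)
    have m: "multiplier (\<lambda>x. complex_of_real (indicator {-R..R} x))" by (rule multiplier_indicator) simp
    show "norm (restr {-R..R} (fst (cls V, cls V1, cls V2))) \<le> e"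
      using k multiplier_L2[OF m V] by (simp add: mult_l2_cls[OF m V] norm_cls) (simp add: V_def)
  qed
qed

text \<open>If there were no lower bound, translates of normalized approximate solutions, each moved out of a longer interval,
would be a singular sequence. So a periodic operator has no isolated eigenvalues.\<close>
theorem lower_bound_of_not_glazman:
  assumes ng: "\<not> glazman W22_triples fst (SLz p d q z)"
  shows "\<exists>c>0. \<forall>t\<in>W22_triples. c * norm (fst t) \<le> norm (SLz p d q z t)"
proof (rule ccontr)
  assume "\<not> ?thesis"
  then have *: "\<exists>t\<in>W22_triples. norm (SLz p d q z t) < c * norm (fst t)" if "c > 0" for c using that by (meson not_le)
  have "\<exists>s. s \<in> W22_triples \<and> norm (fst s) = 1 \<and> norm (SLz p d q z s) \<le> 1 / real (Suc n) \<and>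
     norm (restr {- real n..real n} (fst s)) \<le> 1 / real (Suc n)" for n
  proof -
    obtain t where t: "t \<in> W22_triples" "norm (SLz p d q z t) < 1 / real (Suc n) * norm (fst t)"
      using *[of "1 / real (Suc n)"] by auto
    define N where "N = norm (fst t)"
    have N: "N > 0"
    proof (rule ccontr)
      assume "\<not> N > 0"
      then have "norm (fst t) = 0" by (simp add: N_def)
      then show False using t(2) by simp
    qed
    define t' where "t' = inverse N *\<^sub>R t"
    have t': "t' \<in> W22_triples" unfolding t'_def by (rule subspace_scale[OF subspace_W22_triples t(1)])
    have n1: "norm (fst t') = 1" using N by (simp add: t'_def N_def)
    have "norm (SLz p d q z t') = norm (SLz p d q z t) / N"
      using N by (simp add: t'_def linear_scale[OF linear_SLz] divide_inverse mult.commute)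
    also have "\<dots> \<le> 1 / real (Suc n)"
      using t(2) N by (simp add: N_def[symmetric] pos_divide_le_eq less_imp_le)
    finally have n2: "norm (SLz p d q z t') \<le> 1 / real (Suc n)" .
    obtain s where "s \<in> W22_triples" "norm (fst s) = norm (fst t')" "norm (SLz p d q z s) = norm (SLz p d q z t')"
      "norm (restr {- real n..real n} (fst s)) \<le> 1 / real (Suc n)"
      using escaping_translate[OF t', of "1 / real (Suc n)" z "real n"] by auto
    then show ?thesis using n1 n2 by (intro exI[of _ s]) simp
  qed
  then obtain s where s: "\<And>n. s n \<in> W22_triples" "\<And>n. norm (fst (s n)) = 1" "\<And>n. norm (SLz p d q z (s n)) \<le> 1 / real (Suc n)"
    "\<And>n. norm (restr {- real n..real n} (fst (s n))) \<le> 1 / real (Suc n)" by metis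
  have "(\<lambda>n. SLz p d q z (s n)) \<longlonglongrightarrow> 0"
    by (rule Lim_null_comparison[OF _ LIMSEQ_Suc[OF lim_1_over_n]]) (use s(3) in auto)
  moreover have "\<not> (\<exists>r. strict_mono (r :: nat \<Rightarrow> nat) \<and> convergent (\<lambda>n. fst (s (r n))))"
    by (rule vanishing_no_convergent_subsequence[of "\<lambda>n. fst (s n)"]) (use s in auto)
  moreover have "\<exists>C. \<forall>n. norm (fst (s n)) \<le> C" using s(2) by (intro exI[of _ 1]) simp
  ultimately have "glazman W22_triples fst (SLz p d q z)" unfolding glazman_def using s(1) by blast
  then show False using ng by blast
qed

end

section \<open>Piecewise regular periodic coefficients\<close>

lemma exceptional_set_countable:
  assumes "\<And>a b :: real. finite {x \<in> {a..b}. P x}"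
  shows "countable {x. P x}"
proof -
  have "{x. P x} = (\<Union>n::nat. {x \<in> {- real n..real n}. P x})"
  proof (intro equalityI subsetI)
    fix x assume x: "x \<in> {x. P x}"
    obtain n :: nat where "\<bar>x\<bar> \<le> real n" using real_arch_simple by blast
    then have "x \<in> {x \<in> {- real n..real n}. P x}" using x by (auto simp: abs_le_iff)
    then show "x \<in> (\<Union>n::nat. {x \<in> {- real n..real n}. P x})" by blast
  qed auto
  then show ?thesis using assms by (simp add: countable_finite)
qed

lemma piecewise_continuous_measurable:
  assumes "piecewise_continuous f"
  shows "f \<in> borel_measurable lebesgue"
proof -
  let ?X = "{x. \<not> isCont f x}"
  have "countable ?X" using assms by (intro exceptional_set_countable) (simp add: piecewise_continuous_def)
  moreover have "continuous_on (- ?X) f" by (intro continuous_at_imp_continuous_on) simp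
  ultimately have "f \<in> borel_measurable borel" by (rule borel_measurable_continuous_countable_exceptions)
  then show ?thesis by (intro measurable_completion) simp
qed

text \<open>One-sided limits bound the function near each point; bisection bounds it on compact intervals.\<close>
lemma piecewise_continuous_bounded:
  assumes "piecewise_continuous f" "a \<le> b"
  shows "bounded (f ` {a..b})"
  using assms(2)
proof (rule Bolzano)
  fix a b c :: real
  assume "bounded (f ` {a..b})" "bounded (f ` {b..c})" "a \<le> b" "b \<le> c"
  moreover from this have "{a..c} = {a..b} \<union> {b..c}" by auto
  ultimately show "bounded (f ` {a..c})" by (simp add: image_Un)
next
  fix x :: real
  have "\<exists>l. (f \<longlongrightarrow> l) (at_left x)" "\<exists>r. (f \<longlongrightarrow> r) (at_right x)"
    using assms(1) by (simp_all add: piecewise_continuous_def)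
  then obtain l r where l: "(f \<longlongrightarrow> l) (at_left x)" and r: "(f \<longlongrightarrow> r) (at_right x)" by (elim exE)
  have "\<forall>\<^sub>F y in at_left x. dist (f y) l < 1" using tendstoD[OF l, of 1] by simp
  then obtain c where c: "c < x" "\<And>y. c < y \<Longrightarrow> y < x \<Longrightarrow> dist (f y) l < 1"
    unfolding eventually_at_left_field by blast
  have "\<forall>\<^sub>F y in at_right x. dist (f y) r < 1" using tendstoD[OF r, of 1] by simp
  then obtain d where d: "x < d" "\<And>y. x < y \<Longrightarrow> y < d \<Longrightarrow> dist (f y) r < 1"
    unfolding eventually_at_right_field by blast
  define M where "M = \<bar>l\<bar> + \<bar>r\<bar> + \<bar>f x\<bar> + 1"
  have M: "\<bar>f y\<bar> \<le> M" if "c < y" "y < d" for y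
    using c(2)[of y] d(2)[of y] that unfolding M_def dist_real_def
    by (cases y x rule: linorder_cases) auto
  show "\<exists>\<delta>>0. \<forall>a b. a \<le> x \<and> x \<le> b \<and> b - a < \<delta> \<longrightarrow> bounded (f ` {a..b})"
  proof (intro exI[of _ "min (x - c) (d - x)"] conjI allI impI)
    show "0 < min (x - c) (d - x)" using c d by simp
    fix a b assume ab: "a \<le> x \<and> x \<le> b \<and> b - a < min (x - c) (d - x)"
    have "norm (f y) \<le> M" if "y \<in> {a..b}" for y
      using that ab by (simp add: M)
    then show "bounded (f ` {a..b})" unfolding bounded_iff by blast
  qed
qed

lemma periodic_bounded:
  fixes f :: "real \<Rightarrow> real"
  assumes per: "\<And>x. f (x + 1) = f x" and bd: "bounded (f ` {0..1})"
  obtains M where "\<And>x. \<bar>f x\<bar> \<le> M"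
proof -
  have nat: "f (x + real k) = f x" for x k
  proof (induction k)
    case (Suc k)
    then show ?case using per[of "x + real k"] by (simp add: add.commute add.left_commute)
  qed simp
  have int: "f (x + of_int k) = f x" for x and k :: int
  proof (cases "k \<ge> 0")
    case True
    then show ?thesis using nat[of x "nat k"] by simp
  next
    case False
    then show ?thesis using nat[of "x + of_int k" "nat (- k)"] by simp
  qed
  obtain M where M: "\<forall>y\<in>f ` {0..1}. norm y \<le> M" using bd bounded_iff by blast
  have "\<bar>f x\<bar> \<le> M" for x
  proof -
    have "f x = f (frac x)" using int[of "frac x" "\<lfloor>x\<rfloor>"] by (simp add: frac_def)
    moreover have "frac x \<in> {0..1}" using frac_ge_0[of x] frac_lt_1[of x] by auto
    ultimately show ?thesis using M by simp
  qed
  then show thesis by (rule that)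
qed

text \<open>The given derivative of $p$ need not be periodic at the exceptional points. The coefficient \<open>d\<close> is the
true derivative where it exists and zero elsewhere, which is periodic and agrees with the given one almost
everywhere.\<close>
lemma periodic_coeffs_exist:
  fixes p q :: "real \<Rightarrow> real"
  assumes p_periodic: "\<And>x. p (x + 1) = p x" and q_periodic: "\<And>x. q (x + 1) = q x"
    and p_regular: "piecewise_C1 p" and q_regular: "piecewise_continuous q"
    and p0: "0 < p0" "\<And>x. p0 \<le> p x"
  obtains d B where "periodic_coeffs p d q p0 B"
proof -
  obtain g where cp: "continuous_on UNIV p" and g: "piecewise_continuous g"
    and fin: "\<And>a b. finite {x \<in> {a..b}. \<not> (p has_real_derivative g x) (at x)}"
    using p_regular unfolding piecewise_C1_def by blast
  define d where "d x = (if \<exists>D. (p has_real_derivative D) (at x) then SOME D. (p has_real_derivative D) (at x) else 0)" for x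
  have dg: "d x = g x" if "(p has_real_derivative g x) (at x)" for x
  proof -
    have "(SOME D. (p has_real_derivative D) (at x)) = g x"
      using that by (intro some_equality) (auto intro: DERIV_unique)
    then show ?thesis using that unfolding d_def by auto
  qed
  have d_per: "d (x + 1) = d x" for x
  proof -
    have "(p has_real_derivative D) (at (x + 1)) \<longleftrightarrow> (p has_real_derivative D) (at x)" for D
      using DERIV_shift[of p D x 1] by (simp add: p_periodic)
    then show ?thesis by (simp add: d_def)
  qed
  let ?N = "{x. \<not> (p has_real_derivative g x) (at x)}"
  have "countable ?N" using fin by (rule exceptional_set_countable)
  then have N: "?N \<in> null_sets lebesgue"
    by (intro null_sets_completionI countable_imp_null_set_lborel)
  have ae: "AE x in lebesgue. g x = d x"
    by (rule AE_I'[OF N]) (use dg in auto)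
  have d_meas: "d \<in> borel_measurable lebesgue"
    by (rule borel_measurable_AE[OF piecewise_continuous_measurable[OF g] ae])
  have "bounded (d ` {0..1})"
  proof (rule bounded_subset)
    show "bounded (g ` {0..1} \<union> d ` {x \<in> {0..1}. \<not> (p has_real_derivative g x) (at x)})"
      using piecewise_continuous_bounded[OF g, of 0 1] fin[of 0 1] by (simp add: finite_imp_bounded)
    show "d ` {0..1} \<subseteq> g ` {0..1} \<union> d ` {x \<in> {0..1}. \<not> (p has_real_derivative g x) (at x)}"
      using dg by fastforce
  qed
  then obtain B1 where B1: "\<And>x. \<bar>d x\<bar> \<le> B1" using periodic_bounded[of d] d_per by blast
  obtain B2 where B2: "\<And>x. \<bar>q x\<bar> \<le> B2"
    using periodic_bounded[of q] q_periodic piecewise_continuous_bounded[OF q_regular, of 0 1] by auto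
  have "bounded (p ` {0..1})"
    using cp continuous_on_subset by (intro compact_imp_bounded compact_continuous_image compact_Icc) blast
  then obtain B3 where B3: "\<And>x. \<bar>p x\<bar> \<le> B3" using periodic_bounded[of p] p_periodic by blast
  have "periodic_coeffs p d q p0 (max (max B1 B2) B3)"
  proof
    show "primitive (\<lambda>x. complex_of_real (p x)) (\<lambda>x. complex_of_real (d x))"
    proof (rule primitive_piecewise)
      show "continuous_on UNIV (\<lambda>x. complex_of_real (p x))" using cp by (intro continuous_intros)
      show "(\<lambda>x. complex_of_real (d x)) \<in> borel_measurable lebesgue" using d_meas by measurable
      show "norm (complex_of_real (d t)) \<le> B1" for t using B1 by simp
      show "finite {t \<in> {x..y}. \<not> ((\<lambda>x. complex_of_real (p x)) has_vector_derivative complex_of_real (d t)) (at t)}" for x y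
      proof (rule finite_subset[OF _ fin[of x y]])
        have "((\<lambda>x. complex_of_real (p x)) has_vector_derivative complex_of_real (d t)) (at t)"
          if "(p has_real_derivative g t) (at t)" for t
          using that dg[OF that] by (intro has_vector_derivative_of_real) (simp add: has_real_derivative_iff_has_vector_derivative)
        then show "{t \<in> {x..y}. \<not> ((\<lambda>x. complex_of_real (p x)) has_vector_derivative complex_of_real (d t)) (at t)}
           \<subseteq> {t \<in> {x..y}. \<not> (p has_real_derivative g t) (at t)}" by blast
      qed
    qed
    show "q \<in> borel_measurable lebesgue" by (rule piecewise_continuous_measurable[OF q_regular])
    show "p x \<le> max (max B1 B2) B3" for x using B3[of x] by (simp add: abs_le_iff le_max_iff_disj)
    show "\<bar>d x\<bar> \<le> max (max B1 B2) B3" "\<bar>q x\<bar> \<le> max (max B1 B2) B3" for x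
      using B1[of x] B2[of x] by (simp_all add: le_max_iff_disj)
  qed (use d_meas p0 p_periodic q_periodic d_per in auto)
  then show thesis by (rule that)
qed

section \<open>From functions to classes\<close>

lemma cut_eq: "cut Q g = (\<lambda>x. of_real (indicator Q x) * g x)"
  by (auto simp: cut_def indicator_def fun_eq_iff)

lemma L2_cut:
  assumes Q: "Q \<in> sets lebesgue"
  shows "cut Q g \<in> L2 UNIV \<longleftrightarrow> g \<in> L2 Q" "l2norm UNIV (cut Q g) = l2norm Q g"
proof -
  have sq: "(cmod (cut Q g x))\<^sup>2 = indicator Q x *\<^sub>R (cmod (g x))\<^sup>2" for x by (simp add: cut_def indicator_def)
  have m: "cut Q g \<in> borel_measurable lebesgue \<longleftrightarrow> g \<in> borel_measurable (lebesgue_on Q)"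
    unfolding cut_def by (rule borel_measurable_if[OF Q])
  have i: "integrable (lebesgue_on Q) (\<lambda>x. (cmod (g x))\<^sup>2) \<longleftrightarrow> integrable lebesgue (\<lambda>x. indicator Q x *\<^sub>R (cmod (g x))\<^sup>2)"
    using Q by (intro integrable_restrict_space) simp
  show "cut Q g \<in> L2 UNIV \<longleftrightarrow> g \<in> L2 Q"
    by (simp only: L2_def lebesgue_on_UNIV_eq mem_Collect_eq sq m i)
  have "(LINT x|lebesgue_on Q. (cmod (g x))\<^sup>2) = (LINT x|lebesgue. indicator Q x *\<^sub>R (cmod (g x))\<^sup>2)"
    using Q by (intro integral_restrict_space) simp
  then show "l2norm UNIV (cut Q g) = l2norm Q g"
    by (simp only: l2norm_def lebesgue_on_UNIV_eq sq)
qed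

lemma ae_eq_cut:
  assumes Q: "Q \<in> sets lebesgue"
  shows "ae_eq Q u v \<longleftrightarrow> ae_eq UNIV (cut Q u) (cut Q v)"
proof -
  have "ae_eq Q u v \<longleftrightarrow> (AE x in lebesgue. x \<in> Q \<longrightarrow> u x = v x)"
    unfolding ae_eq_def using Q by (intro AE_restrict_space_iff) simp
  also have "\<dots> \<longleftrightarrow> (AE x in lebesgue. cut Q u x = cut Q v x)"
    by (intro eventually_cong always_eventually) (auto simp: cut_def)
  finally show ?thesis by (simp add: ae_eq_UNIV)
qed

lemma norm_restr_cls:
  assumes Q: "Q \<in> sets lebesgue" and g: "g \<in> L2 UNIV"
  shows "norm (restr Q (cls g)) = l2norm Q g" "g \<in> L2 Q"
proof -
  note m = multiplier_indicator[OF Q]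
  have L: "cut Q g \<in> L2 UNIV" unfolding cut_eq by (rule multiplier_L2[OF m g])
  then show "g \<in> L2 Q" using L2_cut(1)[OF Q] by blast
  show "norm (restr Q (cls g)) = l2norm Q g"
    unfolding mult_l2_cls[OF m g] cut_eq[symmetric] norm_cls[OF L] L2_cut(2)[OF Q] ..
qed

lemma W22_cut:
  assumes Q: "open Q" and W: "W22_triple U U1 U2" and u: "ae_eq UNIV U u"
  shows "cut Q u \<in> W22 Q"
    and "w22norm Q (cut Q u) \<le> norm (restr Q (cls U)) + norm (restr Q (cls U1)) + norm (restr Q (cls U2))"
proof -
  have S: "Q \<in> sets lebesgue" using Q by (simp add: borel_open)
  have L: "U \<in> L2 UNIV" "U1 \<in> L2 UNIV" "U2 \<in> L2 UNIV" using W by (auto simp: W22_triple_def)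
  have uL: "u \<in> L2 UNIV" using L2_ae_cong[OF L(1) u] .
  have wd: "has_weak_deriv Q k (cut Q u) v" if "has_weak_deriv UNIV k u v" for k v
    by (rule has_weak_deriv_cong[OF has_weak_deriv_restrict[OF that Q] _ S]) (simp add: cut_def)
  note w = wd[OF W22_triple_weak_deriv(1)[OF W u]] wd[OF W22_triple_weak_deriv(2)[OF W u]] wd[OF W22_triple_weak_deriv(3)[OF W u]]
  have LQ: "u \<in> L2 Q" "U1 \<in> L2 Q" "U2 \<in> L2 Q" using norm_restr_cls(2)[OF S] uL L by auto
  have "cut Q u \<in> L2 Q"
  proof -
    have "cut Q (cut Q u) = cut Q u" by (auto simp: cut_def)
    then show ?thesis using L2_cut(1)[OF S, of u] L2_cut(1)[OF S, of "cut Q u"] LQ(1) by simp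
  qed
  moreover have "\<exists>v\<in>L2 Q. has_weak_deriv Q k (cut Q u) v" if k: "k \<le> 2" for k
  proof -
    consider "k = 0" | "k = 1" | "k = 2" using k by linarith
    then show ?thesis using LQ w by cases blast+
  qed
  ultimately show "cut Q u \<in> W22 Q" by (simp add: W22_def)
  have n: "l2norm Q (weak_deriv Q k (cut Q u)) = norm (restr Q (cls v))"
    if "has_weak_deriv Q k (cut Q u) v" "v \<in> L2 UNIV" for k v
  proof -
    have "ae_eq Q v (weak_deriv Q k (cut Q u))" by (rule ae_eq_sym[OF weak_deriv_ae[OF Q that(1)]])
    then have ae: "ae_eq UNIV (cut Q v) (cut Q (weak_deriv Q k (cut Q u)))" using ae_eq_cut[OF S] by blast
    have "cut Q v \<in> L2 UNIV" using norm_restr_cls(2)[OF S that(2)] L2_cut(1)[OF S] by blast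
    then have "l2norm UNIV (cut Q v) = l2norm UNIV (cut Q (weak_deriv Q k (cut Q u)))" by (rule l2norm_cong[OF ae])
    then show ?thesis unfolding L2_cut(2)[OF S] norm_restr_cls(1)[OF S that(2)] by simp
  qed
  have "cls u = cls U" using cls_eqI[OF L(1) u] by simp
  then have n0: "l2norm Q (weak_deriv Q 0 (cut Q u)) = norm (restr Q (cls U))"
    using n[OF w(1) uL] by simp
  have "w22norm Q (cut Q u) = sqrt ((norm (restr Q (cls U)))\<^sup>2 + (norm (restr Q (cls U1)))\<^sup>2 + (norm (restr Q (cls U2)))\<^sup>2)"
    unfolding w22norm_def using n0 n[OF w(2) L(2)] n[OF w(3) L(3)] by (simp add: numeral_2_eq_2)
  also have "\<dots> \<le> norm (restr Q (cls U)) + norm (restr Q (cls U1)) + norm (restr Q (cls U2))"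
  proof (rule real_le_lsqrt)
    have "x\<^sup>2 + y\<^sup>2 + z\<^sup>2 \<le> (x + y + z)\<^sup>2" if "0 \<le> x" "0 \<le> y" "0 \<le> z" for x y z :: real
      using that by (simp add: power2_eq_square algebra_simps)
    then show "(norm (restr Q (cls U)))\<^sup>2 + (norm (restr Q (cls U1)))\<^sup>2 + (norm (restr Q (cls U2)))\<^sup>2
      \<le> (norm (restr Q (cls U)) + norm (restr Q (cls U1)) + norm (restr Q (cls U2)))\<^sup>2" by simp
  qed auto
  finally show "w22norm Q (cut Q u) \<le> norm (restr Q (cls U)) + norm (restr Q (cls U1)) + norm (restr Q (cls U2))" .
qed

text \<open>Links a function, which may be an arbitrary representative, to the triple of its class.\<close>
definition has_triple :: "(real \<Rightarrow> complex) \<Rightarrow> l2 \<times> l2 \<times> l2 \<Rightarrow> bool" where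
  "has_triple u t \<longleftrightarrow> (\<exists>U U1 U2. W22_triple U U1 U2 \<and> ae_eq UNIV U u \<and> t = (cls U, cls U1, cls U2))"

lemma has_tripleD:
  assumes "has_triple u t"
  shows "t \<in> W22_triples" "u \<in> W22 UNIV" "u \<in> L2 UNIV" "fst t = cls u"
proof -
  obtain U U1 U2 where W: "W22_triple U U1 U2" "ae_eq UNIV U u" "t = (cls U, cls U1, cls U2)"
    using assms unfolding has_triple_def by blast
  have U: "U \<in> L2 UNIV" using W(1) by (simp add: W22_triple_def)
  show "t \<in> W22_triples" using W unfolding W22_triples_def by blast
  show "u \<in> W22 UNIV" by (rule W22_triple_imp_W22[OF W(1,2)])
  show "u \<in> L2 UNIV" by (rule L2_ae_cong[OF U W(2)])
  show "fst t = cls u" using W(3) cls_eqI[OF U W(2)] by simp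
qed

lemma has_triple_exists: "u \<in> W22 UNIV \<Longrightarrow> \<exists>t. has_triple u t"
  using W22_imp_triple unfolding has_triple_def by metis

lemma has_triple_rep:
  assumes "t \<in> W22_triples"
  shows "has_triple (rep_l2 (fst t)) t"
proof -
  obtain U U1 U2 where t: "t = (cls U, cls U1, cls U2)" and W: "W22_triple U U1 U2" using W22_triples_cases[OF assms] .
  have U: "U \<in> L2 UNIV" using W by (simp add: W22_triple_def)
  have r: "rep_l2 (cls U) \<in> L2 UNIV" "cls (rep_l2 (cls U)) = cls U"
    using Quotient3_abs_rep[OF Quotient3_l2, of "cls U"] Quotient3_rep_reflp[OF Quotient3_l2, of "cls U"] by auto
  then have "ae_eq UNIV U (rep_l2 (cls U))" using cls_eq_iff[OF U r(1)] by simp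
  then show ?thesis using W t unfolding has_triple_def by auto
qed

context coeffs begin

lemma H0_has_triple:
  assumes "has_triple u t"
  shows "snd (H0 p q) u \<in> L2 UNIV" "cls (snd (H0 p q) u) = SL p d q t"
proof -
  obtain U U1 U2 where W: "W22_triple U U1 U2" "ae_eq UNIV U u" "t = (cls U, cls U1, cls U2)"
    using assms unfolding has_triple_def by blast
  have pr: "primitive U1 U2" using W(1) by (simp add: W22_triple_def)
  have a1: "ae_eq UNIV (weak_deriv UNIV 1 u) U1"
    by (rule weak_deriv_ae[OF open_UNIV W22_triple_weak_deriv(2)[OF W(1,2)]])
  have "has_weak_deriv UNIV 1 (\<lambda>x. of_real (p x) * U1 x) (\<lambda>x. U1 x * of_real (d x) + of_real (p x) * U2 x)"
    by (rule primitive_has_weak_deriv[OF primitive_mult[OF p_primitive pr]])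
  moreover have "ae_eq UNIV (\<lambda>x. of_real (p x) * U1 x) (\<lambda>y. of_real (p y) * weak_deriv UNIV 1 u y)"
    using a1 unfolding ae_eq_def by eventually_elim simp
  ultimately have "has_weak_deriv UNIV 1 (\<lambda>y. of_real (p y) * weak_deriv UNIV 1 u y) (\<lambda>x. U1 x * of_real (d x) + of_real (p x) * U2 x)"
    by (rule has_weak_deriv_ae_cong)
  then have a2: "ae_eq UNIV (weak_deriv UNIV 1 (\<lambda>y. of_real (p y) * weak_deriv UNIV 1 u y)) (\<lambda>x. U1 x * of_real (d x) + of_real (p x) * U2 x)"
    by (rule weak_deriv_ae[OF open_UNIV])
  have ae: "ae_eq UNIV (\<lambda>x. of_real (q x) * U x - (of_real (d x) * U1 x + of_real (p x) * U2 x)) (snd (H0 p q) u)"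
    using a2 W(2) unfolding ae_eq_def H0_def snd_conv by eventually_elim simp
  show "snd (H0 p q) u \<in> L2 UNIV" by (rule L2_ae_cong[OF SL_cls(2)[OF W(1)] ae])
  show "cls (snd (H0 p q) u) = SL p d q t"
    unfolding W(3) SL_cls(1)[OF W(1)] by (rule cls_eqI[OF SL_cls(2)[OF W(1)] ae, symmetric])
qed

end

text \<open>The counterpart of \<^const>\<open>local_pert\<close> for operators that act on functions. The three terms
bound the $W_2^2$-norm on the interval.\<close>
definition function_pert :: "real \<Rightarrow> real \<Rightarrow> real \<Rightarrow> ((real \<Rightarrow> complex) \<Rightarrow> real \<Rightarrow> complex) \<Rightarrow> bool" where
  "function_pert a b \<eta> F \<longleftrightarrow> linear_into_L2 UNIV (W22 UNIV) F \<and>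
     (\<forall>u U U1 U2. W22_triple U U1 U2 \<longrightarrow> ae_eq UNIV U u \<longrightarrow>
        l2norm UNIV (F u) \<le> \<eta> * (norm (restr {a<..<b} (cls U)) + norm (restr {a<..<b} (cls U1)) + norm (restr {a<..<b} (cls U2))))"

definition pert_op :: "(real \<Rightarrow> real) \<Rightarrow> (real \<Rightarrow> real) \<Rightarrow> ((real \<Rightarrow> complex) \<Rightarrow> real \<Rightarrow> complex) \<Rightarrow> l2_operator" where
  "pert_op p q F = (W22 UNIV, \<lambda>u x. snd (H0 p q) u x - F u x)"

text \<open>Any representative would do; \<open>lift_pert_eq\<close> shows that the choice does not matter.\<close>
definition lift_pert :: "((real \<Rightarrow> complex) \<Rightarrow> real \<Rightarrow> complex) \<Rightarrow> l2 \<times> l2 \<times> l2 \<Rightarrow> l2" where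
  "lift_pert F t = cls (F (rep_l2 (fst t)))"

lemma lift_pert_eq:
  assumes F: "function_pert a b \<eta> F" and u: "has_triple u t"
  shows "lift_pert F t = cls (F u)" "F u \<in> L2 UNIV"
proof -
  have lin: "linear_into_L2 UNIV (W22 UNIV) F" using F by (simp add: function_pert_def)
  note r = has_triple_rep[OF has_tripleD(1)[OF u]]
  have "cls (rep_l2 (fst t)) = cls u" using has_tripleD(4)[OF r] has_tripleD(4)[OF u] by simp
  then have "ae_eq UNIV (rep_l2 (fst t)) u" using cls_eq_iff[OF has_tripleD(3)[OF r] has_tripleD(3)[OF u]] by simp
  then have "ae_eq UNIV (F (rep_l2 (fst t))) (F u)"
    using lin has_tripleD(2)[OF r] has_tripleD(2)[OF u] unfolding linear_into_L2_def by blast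
  moreover have "F (rep_l2 (fst t)) \<in> L2 UNIV" "F u \<in> L2 UNIV"
    using lin has_tripleD(2)[OF r] has_tripleD(2)[OF u] unfolding linear_into_L2_def by blast+
  ultimately show "lift_pert F t = cls (F u)" "F u \<in> L2 UNIV" unfolding lift_pert_def by (auto intro: cls_eqI)
qed

lemma has_triple_combination:
  assumes "has_triple u s" "has_triple v t"
  shows "has_triple (\<lambda>x. of_real c * u x + of_real e * v x) (c *\<^sub>R s + e *\<^sub>R t)"
proof -
  obtain U U1 U2 where W: "W22_triple U U1 U2" "ae_eq UNIV U u" "s = (cls U, cls U1, cls U2)"
    using assms(1) unfolding has_triple_def by blast
  obtain V V1 V2 where X: "W22_triple V V1 V2" "ae_eq UNIV V v" "t = (cls V, cls V1, cls V2)"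
    using assms(2) unfolding has_triple_def by blast
  have W3c: "W22_triple (\<lambda>x. of_real c * U x + of_real e * V x) (\<lambda>x. of_real c * U1 x + of_real e * V1 x) (\<lambda>x. of_real c * U2 x + of_real e * V2 x)"
    by (rule W22_triple_add[OF W22_triple_scale[OF W(1)] W22_triple_scale[OF X(1)]])
  moreover have "ae_eq UNIV (\<lambda>x. of_real c * U x + of_real e * V x) (\<lambda>x. of_real c * u x + of_real e * v x)"
    using W(2) X(2) unfolding ae_eq_def by eventually_elim simp
  moreover have "c *\<^sub>R s + e *\<^sub>R t = (cls (\<lambda>x. of_real c * U x + of_real e * V x), cls (\<lambda>x. of_real c * U1 x + of_real e * V1 x), cls (\<lambda>x. of_real c * U2 x + of_real e * V2 x))"
    using W(1,3) X(1,3) by (simp add: W22_triple_def cls_scaleR scaleR_conv_of_real cls_add L2_scale)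
  ultimately show ?thesis unfolding has_triple_def by blast
qed

lemma lift_pert_combination:
  assumes F: "function_pert a b \<eta> F" and st: "s \<in> W22_triples" "t \<in> W22_triples"
  shows "lift_pert F (c *\<^sub>R s + e *\<^sub>R t) = c *\<^sub>R lift_pert F s + e *\<^sub>R lift_pert F t"
proof -
  note u = has_triple_rep[OF st(1)] and v = has_triple_rep[OF st(2)]
  note w = has_triple_combination[OF u v, of c e]
  have lin: "linear_into_L2 UNIV (W22 UNIV) F" using F by (simp add: function_pert_def)
  let ?u = "rep_l2 (fst s)" and ?v = "rep_l2 (fst t)"
  have ae: "ae_eq UNIV (F (\<lambda>x. of_real c * ?u x + of_real e * ?v x)) (\<lambda>x. of_real c * F ?u x + of_real e * F ?v x)"
    using lin has_tripleD(2)[OF u] has_tripleD(2)[OF v] unfolding linear_into_L2_def by blast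
  note L = lift_pert_eq(2)[OF F u] lift_pert_eq(2)[OF F v]
  have "lift_pert F (c *\<^sub>R s + e *\<^sub>R t) = cls (\<lambda>x. of_real c * F ?u x + of_real e * F ?v x)"
    unfolding lift_pert_eq(1)[OF F w] by (rule cls_eqI[OF lift_pert_eq(2)[OF F w] ae])
  also have "\<dots> = c *\<^sub>R cls (F ?u) + e *\<^sub>R cls (F ?v)"
    using L by (simp add: cls_scaleR scaleR_conv_of_real cls_add L2_scale)
  finally show ?thesis by (simp add: lift_pert_def)
qed

lemma local_pert_lift:
  assumes F: "function_pert a b \<eta> F"
  shows "local_pert a b \<eta> (lift_pert F)"
  unfolding local_pert_def
proof (intro conjI ballI allI)
  show "lift_pert F (s - t) = lift_pert F s - lift_pert F t" if "s \<in> W22_triples" "t \<in> W22_triples" for s t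
    using lift_pert_combination[OF F that, of 1 "-1"] by simp
  show "lift_pert F (c *\<^sub>R t) = c *\<^sub>R lift_pert F t" if "t \<in> W22_triples" for c t
    using lift_pert_combination[OF F that that, of c 0] by simp
  fix t assume t: "t \<in> W22_triples"
  note u = has_triple_rep[OF t]
  obtain U U1 U2 where W: "W22_triple U U1 U2" "ae_eq UNIV U (rep_l2 (fst t))" "t = (cls U, cls U1, cls U2)"
    using u unfolding has_triple_def by blast
  have "l2norm UNIV (F (rep_l2 (fst t))) \<le> \<eta> * (norm (restr {a<..<b} (cls U)) + norm (restr {a<..<b} (cls U1)) + norm (restr {a<..<b} (cls U2)))"
    using F W(1,2) unfolding function_pert_def by blast
  then show "norm (lift_pert F t) \<le> \<eta> * (norm (restr {a<..<b} (fst t)) + norm (restr {a<..<b} (fst (snd t)))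
        + norm (restr {a<..<b} (snd (snd t))))"
    unfolding lift_pert_def norm_cls[OF lift_pert_eq(2)[OF F u]] using W(3) by simp
qed

context coeffs begin

lemma shifted_has_triple:
  assumes F: "function_pert a b \<eta> F" and u: "has_triple u t"
  shows "shifted (pert_op p q F) z u \<in> L2 UNIV"
    "cls (shifted (pert_op p q F) z u) = SLz p d q z t - lift_pert F t"
proof -
  note H = H0_has_triple[OF u] and T = lift_pert_eq[OF F u] and uD = has_tripleD[OF u]
  have eq: "shifted (pert_op p q F) z u = (\<lambda>x. snd (H0 p q) u x - z * u x - F u x)"
    by (simp add: shifted_def pert_op_def algebra_simps)
  have L: "(\<lambda>x. snd (H0 p q) u x - z * u x) \<in> L2 UNIV" by (intro L2_diff L2_scale H uD)
  then show "shifted (pert_op p q F) z u \<in> L2 UNIV" unfolding eq by (rule L2_diff[OF _ T(2)])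
  have O: "SLz p d q z t = cls (\<lambda>x. snd (H0 p q) u x - z * u x)"
    unfolding SLz_def H(2)[symmetric] uD(4) using H(1) uD(3) by (simp add: mult_l2_cls cls_diff L2_scale)
  show "cls (shifted (pert_op p q F) z u) = SLz p d q z t - lift_pert F t"
    unfolding eq T(1) O by (rule cls_diff[OF L T(2), symmetric])
qed

text \<open>Every quantity in the definition of the continuous spectrum depends on the classes of the functions only, so
sequences of functions and of triples can be exchanged term by term.\<close>
lemma continuous_spectrum_glazman:
  assumes F: "function_pert a b \<eta> F"
  shows "z \<in> continuous_spectrum (pert_op p q F) \<longleftrightarrow> glazman W22_triples fst (\<lambda>t. SLz p d q z t - lift_pert F t)"
proof -
  have core: "((\<exists>C. \<forall>n. l2norm UNIV (u n) \<le> C) \<and>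
     \<not> (\<exists>r v. strict_mono (r :: nat \<Rightarrow> nat) \<and> v \<in> L2 UNIV \<and>
          (\<lambda>n. l2norm UNIV (\<lambda>x. u (r n) x - v x)) \<longlonglongrightarrow> 0) \<and>
     (\<lambda>n. l2norm UNIV (shifted (pert_op p q F) z (u n))) \<longlonglongrightarrow> 0) \<longleftrightarrow>
     ((\<exists>C. \<forall>n. norm (fst (t n)) \<le> C) \<and> \<not> (\<exists>r. strict_mono (r :: nat \<Rightarrow> nat) \<and> convergent (\<lambda>n. fst (t (r n))))
      \<and> (\<lambda>n. SLz p d q z (t n) - lift_pert F (t n)) \<longlonglongrightarrow> 0)"
    if ut: "\<And>n. has_triple (u n) (t n)" for u :: "nat \<Rightarrow> real \<Rightarrow> complex" and t
  proof -
    note D = has_tripleD[OF ut]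
    have 1: "l2norm UNIV (u n) = norm (fst (t n))" for n using D(3,4)[of n] by (simp add: norm_cls)
    have 2: "l2norm UNIV (shifted (pert_op p q F) z (u n)) = norm (SLz p d q z (t n) - lift_pert F (t n))" for n
      using shifted_has_triple[OF F ut] by (metis norm_cls)
    have 3: "(\<exists>v. v \<in> L2 UNIV \<and> (\<lambda>n. l2norm UNIV (\<lambda>x. u (r n) x - v x)) \<longlonglongrightarrow> 0) \<longleftrightarrow> convergent (\<lambda>n. fst (t (r n)))" for r :: "nat \<Rightarrow> nat"
    proof -
      have e: "l2norm UNIV (\<lambda>x. u (r n) x - v x) = norm (fst (t (r n)) - cls v)" if "v \<in> L2 UNIV" for n v
        using D(3,4)[of "r n"] that by (simp add: cls_diff norm_cls L2_diff)
      have "(\<lambda>n. l2norm UNIV (\<lambda>x. u (r n) x - v x)) \<longlonglongrightarrow> 0 \<longleftrightarrow> (\<lambda>n. fst (t (r n))) \<longlonglongrightarrow> cls v" if "v \<in> L2 UNIV" for v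
        unfolding e[OF that] tendsto_norm_zero_iff by (rule LIM_zero_iff)
      note lim = this
      show ?thesis
      proof
        assume "\<exists>v. v \<in> L2 UNIV \<and> (\<lambda>n. l2norm UNIV (\<lambda>x. u (r n) x - v x)) \<longlonglongrightarrow> 0"
        then obtain v where "v \<in> L2 UNIV" "(\<lambda>n. l2norm UNIV (\<lambda>x. u (r n) x - v x)) \<longlonglongrightarrow> 0" by (elim exE conjE)
        then show "convergent (\<lambda>n. fst (t (r n)))" using lim by (auto intro: convergentI)
      next
        assume "convergent (\<lambda>n. fst (t (r n)))"
        then obtain y where y: "(\<lambda>n. fst (t (r n))) \<longlonglongrightarrow> y" by (auto simp: convergent_def)
        obtain v where v: "y = cls v" "v \<in> L2 UNIV" by (rule cls_cases)
        then have "(\<lambda>n. l2norm UNIV (\<lambda>x. u (r n) x - v x)) \<longlonglongrightarrow> 0" using y lim[OF v(2)] by simp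
        with v(2) show "\<exists>v. v \<in> L2 UNIV \<and> (\<lambda>n. l2norm UNIV (\<lambda>x. u (r n) x - v x)) \<longlonglongrightarrow> 0" by (intro exI[of _ v] conjI)
      qed
    qed
    show ?thesis unfolding 1 2 tendsto_norm_zero_iff using 3 by blast
  qed
  have dom: "dom_op (pert_op p q F) = W22 UNIV" by (simp add: dom_op_def pert_op_def)
  show ?thesis
  proof
    assume "z \<in> continuous_spectrum (pert_op p q F)"
    then obtain u :: "nat \<Rightarrow> real \<Rightarrow> complex" where u: "\<forall>n. u n \<in> W22 UNIV" "\<exists>C. \<forall>n. l2norm UNIV (u n) \<le> C"
     "\<not> (\<exists>r v. strict_mono (r :: nat \<Rightarrow> nat) \<and> v \<in> L2 UNIV \<and>
          (\<lambda>n. l2norm UNIV (\<lambda>x. u (r n) x - v x)) \<longlonglongrightarrow> 0)"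
     "(\<lambda>n. l2norm UNIV (shifted (pert_op p q F) z (u n))) \<longlonglongrightarrow> 0"
      unfolding continuous_spectrum_def dom by blast
    have "\<exists>t. has_triple (u n) t" for n using u(1) has_triple_exists by blast
    then obtain t where t: "\<And>n. has_triple (u n) (t n)" by metis
    then have tTR: "\<forall>n. t n \<in> W22_triples" using has_tripleD(1) by blast
    from core[of u t, OF t] u(2-4) have "(\<exists>C. \<forall>n. norm (fst (t n)) \<le> C) \<and> \<not> (\<exists>r. strict_mono (r :: nat \<Rightarrow> nat) \<and> convergent (\<lambda>n. fst (t (r n))))
      \<and> (\<lambda>n. SLz p d q z (t n) - lift_pert F (t n)) \<longlonglongrightarrow> 0" by blast
    with tTR show "glazman W22_triples fst (\<lambda>t. SLz p d q z t - lift_pert F t)" unfolding glazman_def by blast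
  next
    assume "glazman W22_triples fst (\<lambda>t. SLz p d q z t - lift_pert F t)"
    then obtain t where t: "\<forall>n. t n \<in> W22_triples" "(\<exists>C. \<forall>n. norm (fst (t n)) \<le> C) \<and> \<not> (\<exists>r. strict_mono (r :: nat \<Rightarrow> nat) \<and> convergent (\<lambda>n. fst (t (r n))))
      \<and> (\<lambda>n. SLz p d q z (t n) - lift_pert F (t n)) \<longlonglongrightarrow> 0"
      unfolding glazman_def by blast
    define u where "u n = rep_l2 (fst (t n))" for n
    have ut: "has_triple (u n) (t n)" for n unfolding u_def using t(1) by (intro has_triple_rep) blast
    then have uW: "\<forall>n. u n \<in> W22 UNIV" using has_tripleD(2) by blast
    from core[of u t, OF ut] t(2) uW show "z \<in> continuous_spectrum (pert_op p q F)"
      unfolding continuous_spectrum_def dom by blast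
  qed
qed

end

context periodic_coeffs begin

theorem residual_spectrum_empty:
  assumes ab: "a < b" and \<eta>: "0 \<le> \<eta>" "\<eta> < p0 / 8" and F: "function_pert a b \<eta> F"
  shows "residual_spectrum (pert_op p q F) = {}"
proof -
  let ?A = "pert_op p q F" and ?T = "lift_pert F"
  note T = local_pert_lift[OF F]
  have dom: "dom_op ?A = W22 UNIV" by (simp add: dom_op_def pert_op_def)
  have "z \<in> resolvent_set ?A" if nc: "z \<notin> continuous_spectrum ?A" and np: "z \<notin> point_spectrum ?A" for z
  proof -
    have "\<not> glazman W22_triples fst (\<lambda>t. SLz p d q z t - ?T t)" using nc continuous_spectrum_glazman[OF F] by blast
    moreover have zero: "local_pert a b \<eta> (\<lambda>t. 0)" using \<eta>(1) by (simp add: local_pert_def)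
    ultimately have "\<not> glazman W22_triples fst (\<lambda>t. SLz p d q z t - 0)"
      using glazman_perturbation[OF ab \<eta> zero T] by blast
    then have "\<not> glazman W22_triples fst (SLz p d q z)" by simp
    then obtain c where c: "c > 0" "\<And>t. t \<in> W22_triples \<Longrightarrow> c * norm (fst t) \<le> norm (SLz p d q z t)"
      using lower_bound_of_not_glazman by blast
    have inj: "fst t = 0" if t: "t \<in> W22_triples" "SLz p d q z t - ?T t = 0" for t
    proof -
      let ?u = "rep_l2 (fst t)"
      note u = has_triple_rep[OF t(1)]
      have "ae_eq UNIV (shifted ?A z ?u) (\<lambda>x. 0)"
        using shifted_has_triple[OF F u, of z] t(2) cls_eq_iff[of "shifted ?A z ?u" "\<lambda>x. 0"] L2_zero by (simp add: cls_zero)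
      then have "ae_eq UNIV ?u (\<lambda>x. 0)"
        using np has_tripleD(2)[OF u] unfolding point_spectrum_def dom by blast
      then show "fst t = 0" using has_tripleD(3,4)[OF u] cls_eqI[of ?u "\<lambda>x. 0"] by (simp add: cls_zero)
    qed
    note surj = surjective_perturbation(1)[OF ab \<eta> T c inj]
    obtain C where C: "\<forall>t\<in>W22_triples. norm (fst t) \<le> C * norm (SLz p d q z t - ?T t)"
      using surjective_perturbation(2)[OF ab \<eta> T c inj] by blast
    show ?thesis unfolding resolvent_set_def mem_Collect_eq dom
    proof (intro conjI ballI impI)
      show "ae_eq UNIV u (\<lambda>x. 0)" if "u \<in> W22 UNIV" "ae_eq UNIV (shifted ?A z u) (\<lambda>x. 0)" for u
        using np that unfolding point_spectrum_def dom by blast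
      show "\<exists>u\<in>W22 UNIV. ae_eq UNIV (shifted ?A z u) f" if f: "f \<in> L2 UNIV" for f
      proof -
        obtain t where t: "t \<in> W22_triples" "SLz p d q z t - ?T t = cls f" using surj by blast
        note u = has_triple_rep[OF t(1)]
        have "ae_eq UNIV (shifted ?A z (rep_l2 (fst t))) f"
          using shifted_has_triple[OF F u, of z] t(2) cls_eq_iff[OF _ f] by simp
        then show ?thesis using has_tripleD(2)[OF u] by blast
      qed
      show "\<exists>C. \<forall>u\<in>W22 UNIV. l2norm UNIV u \<le> C * l2norm UNIV (shifted ?A z u)"
      proof (intro exI[of _ C] ballI)
        fix u assume "u \<in> W22 UNIV"
        then obtain t where u: "has_triple u t" using has_triple_exists by blast
        have "norm (fst t) \<le> C * norm (SLz p d q z t - ?T t)" using C has_tripleD(1)[OF u] by blast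
        then show "l2norm UNIV u \<le> C * l2norm UNIV (shifted ?A z u)"
          using has_tripleD(3,4)[OF u] shifted_has_triple[OF F u, of z] by (metis norm_cls)
      qed
    qed
  qed
  then show ?thesis unfolding residual_spectrum_def spectrum_def by blast
qed

end

lemma function_pert_zero: "0 \<le> \<eta> \<Longrightarrow> function_pert a b \<eta> (\<lambda>u x. 0)"
  by (simp add: function_pert_def linear_into_L2_def L2_zero l2norm_def)

lemma H0_pert_op: "H0 p q = pert_op p q (\<lambda>u x. 0)"
  by (simp add: pert_op_def H0_def)

lemma function_pert_localized:
  assumes Q: "Q = {a<..<b}" and e: "0 \<le> e"
    and lin: "linear_into_L2 Q (W22 Q) T" and bd: "\<And>u. u \<in> W22 Q \<Longrightarrow> l2norm Q (T u) \<le> C * w22norm Q u"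
  shows "function_pert a b (e * \<bar>C\<bar>) (\<lambda>u x. complex_of_real e * localized Q T u x)"
proof -
  have oQ: "open Q" by (simp add: Q)
  have S: "Q \<in> sets lebesgue" using oQ by (simp add: borel_open)
  have cW: "cut Q u \<in> W22 Q" if u: "u \<in> W22 UNIV" for u
  proof -
    obtain U U1 U2 where W: "W22_triple U U1 U2" "ae_eq UNIV U u" using W22_imp_triple[OF u] .
    show ?thesis by (rule W22_cut(1)[OF oQ W])
  qed
  have loc: "localized Q T u \<in> L2 UNIV" if "u \<in> W22 UNIV" for u
    unfolding localized_def using lin cW[OF that] L2_cut(1)[OF S] by (auto simp: linear_into_L2_def)
  have ae1: "ae_eq UNIV (localized Q T u) (localized Q T v)" if uv: "u \<in> W22 UNIV" "v \<in> W22 UNIV" "ae_eq UNIV u v" for u v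
  proof -
    have "ae_eq UNIV (cut Q (cut Q u)) (cut Q (cut Q v))"
      using uv(3) unfolding ae_eq_def by eventually_elim (simp add: cut_def)
    then have "ae_eq Q (cut Q u) (cut Q v)" using ae_eq_cut[OF S] by blast
    then have "ae_eq Q (T (cut Q u)) (T (cut Q v))" using lin cW uv by (simp add: linear_into_L2_def)
    then show ?thesis unfolding localized_def using ae_eq_cut[OF S] by blast
  qed
  have ae2: "ae_eq UNIV (localized Q T (\<lambda>x. c * u x + f * v x)) (\<lambda>x. c * localized Q T u x + f * localized Q T v x)"
    if uv: "u \<in> W22 UNIV" "v \<in> W22 UNIV" for u v c f
  proof -
    have c1: "cut Q (\<lambda>x. c * u x + f * v x) = (\<lambda>x. c * cut Q u x + f * cut Q v x)" by (auto simp: cut_def)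
    have "ae_eq Q (T (\<lambda>x. c * cut Q u x + f * cut Q v x)) (\<lambda>x. c * T (cut Q u) x + f * T (cut Q v) x)"
      using lin cW uv by (simp add: linear_into_L2_def)
    then have "ae_eq UNIV (cut Q (T (\<lambda>x. c * cut Q u x + f * cut Q v x))) (cut Q (\<lambda>x. c * T (cut Q u) x + f * T (cut Q v) x))"
      using ae_eq_cut[OF S] by blast
    moreover have "cut Q (\<lambda>x. c * T (cut Q u) x + f * T (cut Q v) x) = (\<lambda>x. c * localized Q T u x + f * localized Q T v x)"
      by (auto simp: cut_def localized_def)
    ultimately show ?thesis by (simp add: localized_def c1)
  qed
  show ?thesis
    unfolding function_pert_def linear_into_L2_def
  proof (intro conjI ballI allI impI)
    show "(\<lambda>x. complex_of_real e * localized Q T u x) \<in> L2 UNIV" if "u \<in> W22 UNIV" for u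
      by (rule L2_scale[OF loc[OF that]])
    show "ae_eq UNIV (\<lambda>x. complex_of_real e * localized Q T u x) (\<lambda>x. complex_of_real e * localized Q T v x)"
      if "u \<in> W22 UNIV" "v \<in> W22 UNIV" "ae_eq UNIV u v" for u v
      using ae1[OF that] unfolding ae_eq_def by eventually_elim simp
    show "ae_eq UNIV (\<lambda>x. complex_of_real e * localized Q T (\<lambda>x. c * u x + f * v x) x)
       (\<lambda>x. c * (complex_of_real e * localized Q T u x) + f * (complex_of_real e * localized Q T v x))"
      if "u \<in> W22 UNIV" "v \<in> W22 UNIV" for u v c f
      using ae2[OF that, of c f] unfolding ae_eq_def by eventually_elim (simp add: algebra_simps)
    fix u U U1 U2 assume W: "W22_triple U U1 U2" "ae_eq UNIV U u"
    let ?s = "norm (restr {a<..<b} (cls U)) + norm (restr {a<..<b} (cls U1)) + norm (restr {a<..<b} (cls U2))"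
    have "l2norm Q (T (cut Q u)) \<le> C * w22norm Q (cut Q u)" by (rule bd[OF W22_cut(1)[OF oQ W]])
    also have "\<dots> \<le> \<bar>C\<bar> * w22norm Q (cut Q u)" by (intro mult_right_mono) (auto simp: w22norm_def intro: sum_nonneg)
    also have "\<dots> \<le> \<bar>C\<bar> * ?s" using W22_cut(2)[OF oQ W] by (intro mult_left_mono) (auto simp: Q)
    finally have "e * l2norm Q (T (cut Q u)) \<le> e * (\<bar>C\<bar> * ?s)" using e by (intro mult_left_mono)
    then show "l2norm UNIV (\<lambda>x. complex_of_real e * localized Q T u x) \<le> e * \<bar>C\<bar> * ?s"
      using e by (simp add: l2norm_scale localized_def L2_cut(2)[OF S] mult.assoc)
  qed
qed

theorem theorem2p2:
  fixes p q :: "real \<Rightarrow> real" and p0 a b \<epsilon>0 C :: real and Q :: "real set"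
    and L :: "real \<Rightarrow> (real \<Rightarrow> complex) \<Rightarrow> real \<Rightarrow> complex"
  assumes p_periodic: "\<And>x. p (x + 1) = p x"
    and q_periodic: "\<And>x. q (x + 1) = q x"
    and p_regular: "piecewise_C1 p"
    and q_regular: "piecewise_continuous q"
    and p0_pos: "0 < p0"
    and p_bound: "\<And>x. p0 \<le> p x"
    and p_norm: "p 0 = 1"
    and Q_interval: "a < b" "Q = {a<..<b}"
    and eps0_pos: "0 < \<epsilon>0"
    and L_linear: "\<And>\<epsilon>. 0 < \<epsilon> \<Longrightarrow> \<epsilon> < \<epsilon>0 \<Longrightarrow> linear_into_L2 Q (W22 Q) (L \<epsilon>)"
    and L_bounded: "\<And>\<epsilon> u. 0 < \<epsilon> \<Longrightarrow> \<epsilon> < \<epsilon>0 \<Longrightarrow> u \<in> W22 Q \<Longrightarrow>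
                      l2norm Q (L \<epsilon> u) \<le> C * w22norm Q u"
  shows "\<forall>\<^sub>F \<epsilon> in at_right 0.
           continuous_spectrum (H_pert p q Q L \<epsilon>) = continuous_spectrum (H0 p q) \<and>
           residual_spectrum (H_pert p q Q L \<epsilon>) = {}"
proof -
  obtain d B where "periodic_coeffs p d q p0 B"
    using periodic_coeffs_exist[OF p_periodic q_periodic p_regular q_regular p0_pos p_bound] by blast
  then interpret periodic_coeffs p d q p0 B .
  \<comment> \<open>guarantees $\varepsilon |C| < p_0 / 8$; adding $1$ to $|C|$ avoids a division by zero\<close>
  define \<epsilon>1 where "\<epsilon>1 = min \<epsilon>0 (p0 / (8 * (\<bar>C\<bar> + 1)))"
  have "\<epsilon>1 > 0" using eps0_pos p0_pos by (simp add: \<epsilon>1_def)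
  moreover have "continuous_spectrum (H_pert p q Q L \<epsilon>) = continuous_spectrum (H0 p q) \<and>
           residual_spectrum (H_pert p q Q L \<epsilon>) = {}" if \<epsilon>: "0 < \<epsilon>" "\<epsilon> < \<epsilon>1" for \<epsilon>
  proof -
    let ?\<eta> = "\<epsilon> * \<bar>C\<bar>"
    define F where "F u x = complex_of_real \<epsilon> * localized Q (L \<epsilon>) u x" for u x
    have "\<epsilon> < \<epsilon>0" using \<epsilon> by (simp add: \<epsilon>1_def)
    then have F: "function_pert a b ?\<eta> F"
      unfolding F_def using \<epsilon>(1) by (intro function_pert_localized[OF Q_interval(2)] L_linear L_bounded) auto
    have "\<epsilon> * (8 * (\<bar>C\<bar> + 1)) < p0" using \<epsilon>(2) by (simp add: \<epsilon>1_def pos_less_divide_eq)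
    then have \<eta>: "0 \<le> ?\<eta>" "?\<eta> < p0 / 8" using \<epsilon>(1) by (simp_all add: algebra_simps)
    have H: "H_pert p q Q L \<epsilon> = pert_op p q F" by (simp add: H_pert_def pert_op_def F_def[abs_def])
    note F0 = function_pert_zero[OF \<eta>(1), of a b]
    have "z \<in> continuous_spectrum (pert_op p q F) \<longleftrightarrow> z \<in> continuous_spectrum (pert_op p q (\<lambda>u x. 0))" for z
      unfolding continuous_spectrum_glazman[OF F] continuous_spectrum_glazman[OF F0]
      using glazman_perturbation[OF Q_interval(1) \<eta> local_pert_lift[OF F] local_pert_lift[OF F0]]
        glazman_perturbation[OF Q_interval(1) \<eta> local_pert_lift[OF F0] local_pert_lift[OF F]] by blast
    then show ?thesis
      unfolding H H0_pert_op using residual_spectrum_empty[OF Q_interval(1) \<eta> F] by blast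
  qed
  ultimately show ?thesis unfolding eventually_at_right_field by blast
qed

end
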